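(* Let $A$ and $B$ be pointed topological spaces. Let $X$ be a $CW(A)$-complex, and let $\alpha:A\to B$ and $\beta:B\to A$ be continuous maps. (i) If $\beta\alpha=\mathrm{Id}_A$, then there exist a $CW(B)$-complex $Y$ and maps $\varphi:X\to Y$ and $\psi:Y\to X$ such that $\psi\varphi=\mathrm{Id}_X$. (ii) Suppose $A$ and $B$ have closed base points. If $\beta$ is a homotopy equivalence, then there exist a $CW(B)$-complex $Y$ and a homotopy equivalence $\varphi:X\to Y$. (iii) Suppose $A$ and $B$ have closed base points. If $\beta\alpha=\mathrm{Id}_A$ and $\alpha\beta\simeq\mathrm{Id}_B$, then there exist a $CW(B)$-complex $Y$ and maps $\varphi:X\to Y$ and $\psi:Y\to X$ such that $\psi\varphi=\mathrm{Id}_X$ and $\varphi\psi\simeq\mathrm{Id}_Y$.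
   Context: All spaces are pointed, all maps are pointed, and homotopies (hence homotopy equivalences) preserve base points. $\mathrm{C}X$ is the reduced cone, $\Sigma X$ the reduced suspension, $\Sigma^0A=A$. Let $A$ be a pointed space. For $n\ge 1$, $X$ is obtained from a pointed space $Z$ by attaching $n$-cells of type $A$ if $X$ is a pushout of $Z\xleftarrow{\,g\,}\bigvee_{\alpha\in J}\Sigma^{n-1}A\xrightarrow{\,i\,}\bigvee_{\alpha\in J}\mathrm{C}\Sigma^{n-1}A$ for some index set $J$ and some map $g$, where $i$ is the wedge of the inclusions as bases of the cones. $X$ is obtained from $Z$ by attaching $0$-cells of type $A$ if $X=Z\vee\bigvee_{\alpha\in J}A$. A $CW(A)$-complex is a space $X$ that is the colimit of a sequence $*=X^{-1}\to X^0\to X^1\to\cdots$ such that, for all $n\ge 0$, $X^n$ is obtained from $X^{n-1}$ by attaching $n$-cells of type $A$. *)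

theory Defs
  imports "HOL-Analysis.Analysis"
begin

section \<open>Pointed spaces, maps and homotopies\<close>

type_synonym 'a pointed = "'a topology \<times> 'a"

definition pointed_space :: "'a pointed \<Rightarrow> bool" where
  "pointed_space A \<longleftrightarrow> snd A \<in> topspace (fst A)"

definition pmap :: "'a pointed \<Rightarrow> 'b pointed \<Rightarrow> ('a \<Rightarrow> 'b) \<Rightarrow> bool" where
  "pmap A B f \<longleftrightarrow> continuous_map (fst A) (fst B) f \<and> f (snd A) = snd B"

definition phomotopic :: "'a pointed \<Rightarrow> 'b pointed \<Rightarrow> ('a \<Rightarrow> 'b) \<Rightarrow> ('a \<Rightarrow> 'b) \<Rightarrow> bool" where
  "phomotopic A B = homotopic_with (\<lambda>h. h (snd A) = snd B) (fst A) (fst B)"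

definition phomotopy_equivalence :: "'a pointed \<Rightarrow> 'b pointed \<Rightarrow> ('a \<Rightarrow> 'b) \<Rightarrow> bool" where
  "phomotopy_equivalence A B f \<longleftrightarrow> pmap A B f \<and>
     (\<exists>g. pmap B A g \<and> phomotopic A A (g \<circ> f) id \<and> phomotopic B B (f \<circ> g) id)"


section \<open>Final topologies and disjoint unions\<close>

text \<open>The finest topology on the set \<open>T\<close> for which \<open>f\<close> is continuous; if \<open>f\<close> maps onto \<open>T\<close>,
  this is the quotient topology.\<close>

definition final_topology :: "'b set \<Rightarrow> 'a topology \<Rightarrow> ('a \<Rightarrow> 'b) \<Rightarrow> 'b topology" where
  "final_topology T X f = topology (\<lambda>U. U \<subseteq> T \<and> openin X {x \<in> topspace X. f x \<in> U})"

lemma openin_final_topology: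
  "openin (final_topology T X f) U \<longleftrightarrow> U \<subseteq> T \<and> openin X {x \<in> topspace X. f x \<in> U}"
proof -
  have "istopology (\<lambda>U. U \<subseteq> T \<and> openin X {x \<in> topspace X. f x \<in> U})"
    unfolding istopology_def
  proof (intro conjI allI impI; (elim conjE)?)
    fix S S' assume "openin X {x \<in> topspace X. f x \<in> S}" "openin X {x \<in> topspace X. f x \<in> S'}"
    then have "openin X ({x \<in> topspace X. f x \<in> S} \<inter> {x \<in> topspace X. f x \<in> S'})"
      by (rule openin_Int)
    then show "openin X {x \<in> topspace X. f x \<in> S \<inter> S'}"
      by (rule back_subst[of "openin X"]) auto
  next
    fix K assume "\<forall>S\<in>K. S \<subseteq> T \<and> openin X {x \<in> topspace X. f x \<in> S}"
    then have "openin X (\<Union>S\<in>K. {x \<in> topspace X. f x \<in> S})"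
      by auto
    then show "openin X {x \<in> topspace X. f x \<in> \<Union>K}"
      by (rule back_subst[of "openin X"]) auto
  qed auto
  then show ?thesis
    by (simp add: final_topology_def)
qed

lemma topspace_final_topology [simp]:
  assumes "f ` topspace X \<subseteq> T"
  shows "topspace (final_topology T X f) = T"
proof -
  have "{x \<in> topspace X. f x \<in> T} = topspace X"
    using assms by auto
  then have "openin (final_topology T X f) T"
    by (simp add: openin_final_topology)
  then show ?thesis
    by (metis openin_final_topology openin_subset openin_topspace subset_antisym)
qed

lemma quotient_map_final_topology:
  "f ` topspace X = T \<Longrightarrow> quotient_map X (final_topology T X f) f"
  by (simp add: quotient_map_def openin_final_topology)

definition disjoint_union :: "'a topology \<Rightarrow> 'b topology \<Rightarrow> ('a + 'b) topology" where
  "disjoint_union X Y = topology (\<lambda>U. openin X (Inl -` U) \<and> openin Y (Inr -` U))"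

lemma openin_disjoint_union_iff:
  "openin (disjoint_union X Y) U \<longleftrightarrow> openin X (Inl -` U) \<and> openin Y (Inr -` U)"
proof -
  have "istopology (\<lambda>U. openin X (Inl -` U) \<and> openin Y (Inr -` U))"
    unfolding istopology_def by (auto simp: vimage_Union)
  then show ?thesis
    by (simp add: disjoint_union_def)
qed

lemma topspace_disjoint_union [simp]:
  "topspace (disjoint_union X Y) = topspace X <+> topspace Y"
proof
  have "Inl -` (topspace X <+> topspace Y) = topspace X"
       "Inr -` (topspace X <+> topspace Y) = topspace Y"
    by auto
  then have "openin (disjoint_union X Y) (topspace X <+> topspace Y)"
    by (simp add: openin_disjoint_union_iff)
  then show "topspace X <+> topspace Y \<subseteq> topspace (disjoint_union X Y)"
    by (rule openin_subset)
next
  have "openin X (Inl -` topspace (disjoint_union X Y))"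
       "openin Y (Inr -` topspace (disjoint_union X Y))"
    using openin_disjoint_union_iff by blast+
  then show "topspace (disjoint_union X Y) \<subseteq> topspace X <+> topspace Y"
    by (auto simp: subset_iff dest!: openin_subset) (metis InlI InrI old.sum.exhaust)
qed

lemma Inl_in_Plus_iff [simp]: "Inl x \<in> S <+> T \<longleftrightarrow> x \<in> S"
  and Inr_in_Plus_iff [simp]: "Inr y \<in> S <+> T \<longleftrightarrow> y \<in> T"
  by auto

lemma continuous_map_case_sum:
  assumes "continuous_map X Z f" "continuous_map Y Z g"
  shows "continuous_map (disjoint_union X Y) Z (case_sum f g)"
proof -
  show ?thesis
    using assms unfolding continuous_map_def
    by (auto simp: openin_disjoint_union_iff vimage_def)
qed


section \<open>Cones, suspensions, wedges\<close>

text \<open>The points of \<open>C\<Sigma>\<^sup>nA\<close> and of \<open>\<Sigma>\<^sup>nA\<close> for all \<open>n\<close> live in one type, so that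
  the suspension can be iterated: \<open>Pt a\<close> is a point of \<open>A\<close>, \<open>Seg x t\<close> is the class of \<open>(x, t)\<close>
  outside the collapsed set, and \<open>Base\<close> is the class of the collapsed set.\<close>

datatype 'a cpoint = Base | Pt 'a | Seg "'a cpoint" real

text \<open>\<open>CX = X \<times> [0,1] / (X \<times> {1} \<union> {x\<^sub>0} \<times> [0,1])\<close>\<close>

definition cone_proj :: "'a cpoint pointed \<Rightarrow> 'a cpoint \<times> real \<Rightarrow> 'a cpoint" where
  "cone_proj X = (\<lambda>(x, t). if x = snd X \<or> t = 1 then Base else Seg x t)"

definition red_cone :: "'a cpoint pointed \<Rightarrow> 'a cpoint pointed" where
  "red_cone X = (let P = prod_topology (fst X) (top_of_set {0..1::real})
             in (final_topology (cone_proj X ` topspace P) P (cone_proj X), Base))"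

definition cone_base :: "'a cpoint pointed \<Rightarrow> 'a cpoint \<Rightarrow> 'a cpoint" where
  "cone_base X x = cone_proj X (x, 0)"

text \<open>\<open>\<Sigma>X = X \<times> [0,1] / (X \<times> {0,1} \<union> {x\<^sub>0} \<times> [0,1])\<close>\<close>

definition susp_proj :: "'a cpoint pointed \<Rightarrow> 'a cpoint \<times> real \<Rightarrow> 'a cpoint" where
  "susp_proj X = (\<lambda>(x, t). if x = snd X \<or> t = 0 \<or> t = 1 then Base else Seg x t)"

definition red_susp :: "'a cpoint pointed \<Rightarrow> 'a cpoint pointed" where
  "red_susp X = (let P = prod_topology (fst X) (top_of_set {0..1::real})
             in (final_topology (susp_proj X ` topspace P) P (susp_proj X), Base))"

text \<open>\<open>\<Sigma>\<^sup>0A\<close> is the copy of \<open>A\<close> along \<open>Pt\<close>.\<close>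

definition iter_susp :: "nat \<Rightarrow> 'a pointed \<Rightarrow> 'a cpoint pointed" where
  "iter_susp n A = (red_susp ^^ n) (final_topology (Pt ` topspace (fst A)) (fst A) Pt, Pt (snd A))"

text \<open>The wedge of copies of \<open>X\<close> indexed by \<open>J\<close>, with all base points identified to \<open>None\<close>;
  it is a single point when \<open>J\<close> is empty.\<close>

definition wedge_in :: "'a pointed \<Rightarrow> 'j \<times> 'a \<Rightarrow> ('j \<times> 'a) option" where
  "wedge_in X = (\<lambda>(j, x). if x = snd X then None else Some (j, x))"

definition wedge :: "'j set \<Rightarrow> 'a pointed \<Rightarrow> ('j \<times> 'a) option pointed" where
  "wedge J X = (let S = sum_topology (\<lambda>_. fst X) J
                in (final_topology (insert None (wedge_in X ` topspace S)) S (wedge_in X), None))"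

definition wedge_cone_base :: "'a cpoint pointed \<Rightarrow> ('j \<times> 'a cpoint) option \<Rightarrow> ('j \<times> 'a cpoint) option" where
  "wedge_cone_base X w =
     (case w of None \<Rightarrow> None | Some (j, x) \<Rightarrow> wedge_in (red_cone X) (j, cone_base X x))"

lemma quotient_map_cone:
  "quotient_map (prod_topology (fst X) (top_of_set {0..1})) (fst (red_cone X)) (cone_proj X)"
  unfolding red_cone_def Let_def fst_conv by (rule quotient_map_final_topology) (rule refl)

lemma quotient_map_susp:
  "quotient_map (prod_topology (fst X) (top_of_set {0..1})) (fst (red_susp X)) (susp_proj X)"
  unfolding red_susp_def Let_def fst_conv by (rule quotient_map_final_topology) (rule refl)

lemma quotient_map_wedge:
  assumes "pointed_space X" "J \<noteq> {}"
  shows "quotient_map (sum_topology (\<lambda>_. fst X) J) (fst (wedge J X)) (wedge_in X)"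
proof -
  obtain j where "j \<in> J" using assms by auto
  then have "None \<in> wedge_in X ` topspace (sum_topology (\<lambda>_. fst X) J)"
    using assms by (auto simp: wedge_in_def pointed_space_def image_iff)
  then show ?thesis
    unfolding wedge_def Let_def fst_conv
    by (intro quotient_map_final_topology) auto
qed

lemma homeomorphic_map_iter_susp_0:
  "homeomorphic_map (fst A) (fst (iter_susp 0 A)) Pt"
  unfolding iter_susp_def homeomorphic_map_def
  by (auto intro!: quotient_map_final_topology inj_onI)

lemma pointed_space_cone: "pointed_space X \<Longrightarrow> pointed_space (red_cone X)"
proof -
  assume "pointed_space X"
  then have "(snd X, 0) \<in> topspace (prod_topology (fst X) (top_of_set {0..1::real}))"
    by (simp add: pointed_space_def)
  then have "cone_proj X (snd X, 0) \<in> topspace (fst (red_cone X))"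
    using quotient_imp_surjective_map[OF quotient_map_cone[of X]] by blast
  then show ?thesis
    by (simp add: pointed_space_def cone_proj_def red_cone_def Let_def)
qed

lemma pointed_space_susp: "pointed_space X \<Longrightarrow> pointed_space (red_susp X)"
proof -
  assume "pointed_space X"
  then have "(snd X, 0) \<in> topspace (prod_topology (fst X) (top_of_set {0..1::real}))"
    by (simp add: pointed_space_def)
  then have "susp_proj X (snd X, 0) \<in> topspace (fst (red_susp X))"
    using quotient_imp_surjective_map[OF quotient_map_susp[of X]] by blast
  then show ?thesis
    by (simp add: pointed_space_def susp_proj_def red_susp_def Let_def)
qed

lemma pointed_space_iter_susp: "pointed_space A \<Longrightarrow> pointed_space (iter_susp n A)"
proof (induction n)
  case 0
  then show ?case by (simp add: iter_susp_def pointed_space_def)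
next
  case (Suc n)
  then show ?case using pointed_space_susp by (simp add: iter_susp_def)
qed

lemma pointed_space_wedge: "pointed_space (wedge J X)"
  unfolding pointed_space_def wedge_def Let_def by (subst fst_conv, subst topspace_final_topology) auto


section \<open>Pushouts and sequential colimits\<close>

text \<open>\<open>X\<close>, with the maps \<open>p\<close> and \<open>q\<close>, is the pushout of \<open>Z \<leftarrow> W \<rightarrow> C\<close> (maps \<open>g\<close>, \<open>i\<close>), i.e. the
  quotient space of \<open>Z \<squnion> C\<close> by the equivalence relation generated by \<open>g w \<sim> i w\<close>. As \<open>W\<close> is
  pointed, this is also the pushout in pointed spaces; the universal property
  is \<open>is_pushout_universal\<close> and \<open>is_pushout_unique\<close> below.\<close>

definition is_pushout ::
  "'w pointed \<Rightarrow> 'z pointed \<Rightarrow> 'c pointed \<Rightarrow> ('w \<Rightarrow> 'z) \<Rightarrow> ('w \<Rightarrow> 'c) \<Rightarrow>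
   'x pointed \<Rightarrow> ('z \<Rightarrow> 'x) \<Rightarrow> ('c \<Rightarrow> 'x) \<Rightarrow> bool" where
  "is_pushout W Z C g i X p q \<longleftrightarrow>
     pmap W Z g \<and> pmap W C i \<and> pmap Z X p \<and> pmap C X q \<and>
     quotient_map (disjoint_union (fst Z) (fst C)) (fst X) (case_sum p q) \<and>
     (\<forall>u \<in> topspace (fst Z) <+> topspace (fst C). \<forall>v \<in> topspace (fst Z) <+> topspace (fst C).
        case_sum p q u = case_sum p q v \<longleftrightarrow>
        equivclp (\<lambda>u v. \<exists>w \<in> topspace (fst W). u = Inl (g w) \<and> v = Inr (i w)) u v)"

text \<open>\<open>X\<close>, with the maps \<open>\<iota> n\<close>, is the colimit of \<open>S 0 \<rightarrow> S 1 \<rightarrow> \<dots>\<close> (maps \<open>f n\<close>), i.e. the quotient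
  space of the disjoint union of the \<open>S n\<close> by the equivalence relation generated by
  \<open>(n, x) \<sim> (n + 1, f n x)\<close>; the universal property is \<open>is_seq_colimit_universal\<close> and
  \<open>is_seq_colimit_unique\<close> below.\<close>

definition is_seq_colimit ::
  "(nat \<Rightarrow> 's pointed) \<Rightarrow> (nat \<Rightarrow> 's \<Rightarrow> 's) \<Rightarrow> 'x pointed \<Rightarrow> (nat \<Rightarrow> 's \<Rightarrow> 'x) \<Rightarrow> bool" where
  "is_seq_colimit S f X \<iota> \<longleftrightarrow>
     (\<forall>n. pmap (S n) (S (Suc n)) (f n)) \<and> (\<forall>n. pmap (S n) X (\<iota> n)) \<and>
     quotient_map (sum_topology (\<lambda>n. fst (S n)) UNIV) (fst X) (\<lambda>(n, x). \<iota> n x) \<and>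
     (\<forall>n m. \<forall>x \<in> topspace (fst (S n)). \<forall>y \<in> topspace (fst (S m)).
        \<iota> n x = \<iota> m y \<longleftrightarrow>
        equivclp (\<lambda>u v. \<exists>k. \<exists>z \<in> topspace (fst (S k)). u = (k, z) \<and> v = (Suc k, f k z)) (n, x) (m, y))"

lemma equivclp_respects:
  assumes "equivclp R u v" "\<And>u v. R u v \<Longrightarrow> h u = h v"
  shows "h u = h v"
  using assms(1)
  by (induction rule: equivclp_induct) (auto dest: assms(2))

lemma is_pushout_universal:
  assumes "is_pushout W Z C g i X p q" "pointed_space Z" "pmap Z T h" "pmap C T k"
    and "\<And>w. w \<in> topspace (fst W) \<Longrightarrow> h (g w) = k (i w)"
  shows "\<exists>f. pmap X T f \<and> (\<forall>z \<in> topspace (fst Z). f (p z) = h z) \<and>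
             (\<forall>c \<in> topspace (fst C). f (q c) = k c)"
proof -
  have Q: "quotient_map (disjoint_union (fst Z) (fst C)) (fst X) (case_sum p q)"
    using assms(1) by (simp add: is_pushout_def)
  have c: "continuous_map (disjoint_union (fst Z) (fst C)) (fst T) (case_sum h k)"
    using assms(3,4) by (simp add: pmap_def continuous_map_case_sum)
  have "case_sum h k u = case_sum h k v"
    if "u \<in> topspace (disjoint_union (fst Z) (fst C))"
       "v \<in> topspace (disjoint_union (fst Z) (fst C))" "case_sum p q u = case_sum p q v" for u v
  proof -
    have "equivclp (\<lambda>u v. \<exists>w \<in> topspace (fst W). u = Inl (g w) \<and> v = Inr (i w)) u v"
      using that assms(1) unfolding is_pushout_def topspace_disjoint_union by blast
    then show ?thesis
      by (rule equivclp_respects) (auto simp: assms(5))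
  qed
  then obtain f where f: "continuous_map (fst X) (fst T) f"
    "\<And>u. u \<in> topspace (disjoint_union (fst Z) (fst C)) \<Longrightarrow> f (case_sum p q u) = case_sum h k u"
    using quotient_map_lift_exists[OF Q c] by metis
  have fp: "f (p z) = h z" if "z \<in> topspace (fst Z)" for z
    using f(2)[of "Inl z"] that by simp
  have fq: "f (q z) = k z" if "z \<in> topspace (fst C)" for z
    using f(2)[of "Inr z"] that by simp
  have "f (snd X) = snd T"
    using fp[of "snd Z"] assms(1-3) by (simp add: is_pushout_def pmap_def pointed_space_def)
  then show "\<exists>f. pmap X T f \<and> (\<forall>z \<in> topspace (fst Z). f (p z) = h z) \<and>
             (\<forall>c \<in> topspace (fst C). f (q c) = k c)"
    using f(1) fp fq by (auto simp: pmap_def)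
qed

lemma is_pushout_unique:
  assumes "is_pushout W Z C g i X p q" "x \<in> topspace (fst X)"
    and "\<And>z. z \<in> topspace (fst Z) \<Longrightarrow> f (p z) = f' (p z)"
    and "\<And>c. c \<in> topspace (fst C) \<Longrightarrow> f (q c) = f' (q c)"
  shows "f x = f' x"
proof -
  have "case_sum p q ` (topspace (fst Z) <+> topspace (fst C)) = topspace (fst X)"
    using assms(1) quotient_imp_surjective_map unfolding is_pushout_def
    by (metis topspace_disjoint_union)
  then obtain u where "u \<in> topspace (fst Z) <+> topspace (fst C)" "x = case_sum p q u"
    using assms(2) by (metis imageE)
  then show ?thesis
    using assms(3,4) by (cases u) auto
qed

lemma is_seq_colimit_universal:
  assumes "is_seq_colimit S f X \<iota>" "pointed_space (S 0)" "\<And>n. pmap (S n) T (h n)"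
    and "\<And>n x. x \<in> topspace (fst (S n)) \<Longrightarrow> h (Suc n) (f n x) = h n x"
  shows "\<exists>r. pmap X T r \<and> (\<forall>n. \<forall>x \<in> topspace (fst (S n)). r (\<iota> n x) = h n x)"
proof -
  let ?D = "sum_topology (\<lambda>n. fst (S n)) UNIV"
  have Q: "quotient_map ?D (fst X) (\<lambda>(n, x). \<iota> n x)"
    using assms(1) by (simp add: is_seq_colimit_def)
  have c: "continuous_map ?D (fst T) (\<lambda>(n, x). h n x)"
    using assms(3) unfolding continuous_map_def pmap_def openin_sum_topology
    by (auto simp: Pi_iff)
  have "(\<lambda>(n, x). h n x) u = (\<lambda>(n, x). h n x) v"
    if "u \<in> topspace ?D" "v \<in> topspace ?D" "(\<lambda>(n, x). \<iota> n x) u = (\<lambda>(n, x). \<iota> n x) v" for u v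
  proof -
    have "equivclp (\<lambda>u v. \<exists>k. \<exists>z \<in> topspace (fst (S k)). u = (k, z) \<and> v = (Suc k, f k z)) u v"
      using that assms(1) unfolding is_seq_colimit_def by (cases u; cases v) auto
    then show ?thesis
      by (rule equivclp_respects) (auto simp: assms(4))
  qed
  then obtain r where r: "continuous_map (fst X) (fst T) r"
    "\<And>u. u \<in> topspace ?D \<Longrightarrow> r ((\<lambda>(n, x). \<iota> n x) u) = (\<lambda>(n, x). h n x) u"
    using quotient_map_lift_exists[OF Q c] by metis
  have ri: "r (\<iota> n x) = h n x" if "x \<in> topspace (fst (S n))" for n x
    using r(2)[of "(n, x)"] that by simp
  have "r (snd X) = snd T"
  proof -
    have "\<iota> 0 (snd (S 0)) = snd X" "h 0 (snd (S 0)) = snd T"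
      using assms(1) assms(3)[of 0] by (auto simp: is_seq_colimit_def pmap_def)
    then show ?thesis
      using ri[of "snd (S 0)" 0] assms(2) by (simp add: pointed_space_def)
  qed
  then show "\<exists>r. pmap X T r \<and> (\<forall>n. \<forall>x \<in> topspace (fst (S n)). r (\<iota> n x) = h n x)"
    using r(1) ri by (auto simp: pmap_def)
qed

lemma is_seq_colimit_unique:
  assumes "is_seq_colimit S f X \<iota>" "y \<in> topspace (fst X)"
    and "\<And>n x. x \<in> topspace (fst (S n)) \<Longrightarrow> r (\<iota> n x) = r' (\<iota> n x)"
  shows "r y = r' y"
proof -
  have "(\<lambda>(n, x). \<iota> n x) ` topspace (sum_topology (\<lambda>n. fst (S n)) UNIV) = topspace (fst X)"
    using assms(1) quotient_imp_surjective_map unfolding is_seq_colimit_def by blast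
  then obtain n x where "x \<in> topspace (fst (S n))" "y = \<iota> n x"
    using assms(2) by (force simp: image_iff)
  then show ?thesis
    using assms(3) by simp
qed


section \<open>CW(A)-complexes\<close>

text \<open>\<open>X\<close> is obtained from \<open>Z\<close>, along the map \<open>p : Z \<rightarrow> X\<close>, by attaching \<open>n\<close>-cells of type \<open>A\<close>
  indexed by \<open>J\<close>. The wedge of \<open>Z\<close> and \<open>\<Or>\<^sub>J A\<close> needed for \<open>n = 0\<close> is the pushout over a point.\<close>

definition attaches_cells ::
  "'a pointed \<Rightarrow> nat \<Rightarrow> 'j set \<Rightarrow> 'z pointed \<Rightarrow> ('z \<Rightarrow> 'x) \<Rightarrow> 'x pointed \<Rightarrow> bool" where
  "attaches_cells A n J Z p X \<longleftrightarrow>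
     (case n of
        0 \<Rightarrow> \<exists>q. is_pushout (discrete_topology {()}, ()) Z (wedge J A)
               (\<lambda>_. snd Z) (\<lambda>_. None) X p q
      | Suc m \<Rightarrow> \<exists>g q. is_pushout (wedge J (iter_susp m A)) Z (wedge J (red_cone (iter_susp m A)))
               g (wedge_cone_base (iter_susp m A)) X p q)"

text \<open>\<open>S n\<close> is \<open>X\<^sup>n\<^sup>-\<^sup>1\<close>, so \<open>S 0\<close> is a point. The first argument is the type from which the index sets
  of the cells are taken (which HOL cannot quantify over). Taking the \<open>S n\<close> in the type of \<open>X\<close> is
  no restriction: base inclusions of cones are injective, hence so are \<open>f n\<close> and
  \<open>\<iota> n\<close>, and \<open>S n\<close> can be transported to its image in \<open>X\<close>.\<close>

definition is_CW :: "'j itself \<Rightarrow> 'a pointed \<Rightarrow> 'x pointed \<Rightarrow> bool" where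
  "is_CW _ A X \<longleftrightarrow>
     (\<exists>(S :: nat \<Rightarrow> 'x pointed) f \<iota>.
        topspace (fst (S 0)) = {snd (S 0)} \<and>
        (\<forall>n. \<exists>J :: 'j set. attaches_cells A n J (S n) (f n) (S (Suc n))) \<and>
        is_seq_colimit S f X \<iota>)"

text \<open>A type for the complexes to be constructed: apart from its base point, a CW(B)-complex with
  cells indexed by \<open>'j\<close> has as points the triples of a dimension \<open>n\<close>, an index
  in \<open>'j\<close>, and a point of \<open>B\<close> (if \<open>n = 0\<close>) or of \<open>C\<Sigma>\<^sup>n\<^sup>-\<^sup>1B\<close> outside the base of the cone.\<close>

type_synonym ('j, 'b) cw_space = "(nat \<times> 'j \<times> 'b cpoint) option pointed"

end

(* The CW(B)-complex Y is built along the skeleta of X: a cell with attaching map g is replaced by one with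
   attaching map phi o g o (suspended beta), where phi maps the previous skeleton of X to that of Y. If
   beta alpha = id, then alpha and beta act on the cones and give phi and psi with psi phi = id. If beta is
   a homotopy equivalence, then both replacing the base space of a pushout along phi and replacing the
   attached cone along beta are homotopy equivalences (under the previous skeleton in the second case), so
   phi extends to a homotopy equivalence of the next skeleta. Skeletal inclusions have the homotopy
   extension property, by which homotopy inverses and homotopies can be chosen strictly compatibly on
   all skeleta and pass to the colimit. In case (iii), phi is a homotopy equivalence with strict left
   inverse psi, hence phi psi is homotopic to the identity. *)

theory Submission
  imports Defs
begin

section \<open>Parametrized families of pointed maps\<close>

text \<open>Write \<open>a\<close> and \<open>b\<close> for the maps of suspended cells induced by
  \<open>\<alpha>\<close> and \<open>\<beta>\<close>. A map from old cells to new ones must respect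
  the attaching map \<open>phi o g o b\<close>. If \<open>\<beta> \<alpha>\<close> is the identity,
  \<open>a\<close> does so because \<open>b a\<close> cancels. If \<open>\<beta>\<close> is only an
  equivalence, a homotopy inverse of \<open>b\<close> need not do so, whereas \<open>b\<close>
  always does. So \<open>b\<close> gives a map from the new cells back to the old ones, which has to
  be inverted under the lower skeleton; the contractibility of cones supplies this inverse.
  Homotopies on the skeleta must themselves be corrected relative to the lower skeleton. This takes
  an extension property for homotopies of homotopies, hence a property with a parameter. Its source
  is the collar at the base of a reduced cone, and wedges and pushouts inherit it. That all these
  constructions carry homotopies along rests on one topological fact: the product of a quotient map
  with a compact interval or square is again a quotient map.\<close>

text \<open>Maps and homotopies are treated together: a homotopy is a family over \<open>[0,1]\<close>, and the homotopy
  extension property needs families over \<open>[0,1]\<^sup>2\<close>. Over a compact parameter space, families descend along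
  quotient maps.\<close>

definition pfam :: "'p::metric_space set \<Rightarrow> 'a pointed \<Rightarrow> 'b pointed \<Rightarrow> ('p \<Rightarrow> 'a \<Rightarrow> 'b) \<Rightarrow> bool" where
  "pfam S X Y H \<longleftrightarrow>
     continuous_map (prod_topology (top_of_set S) (fst X)) (fst Y) (\<lambda>(s, x). H s x) \<and>
     (\<forall>s \<in> S. H s (snd X) = snd Y)"

lemma pfam_base: "pfam S X Y H \<Longrightarrow> s \<in> S \<Longrightarrow> H s (snd X) = snd Y"
  by (simp add: pfam_def)

lemma pfam_in:
  "pfam S X Y H \<Longrightarrow> s \<in> S \<Longrightarrow> x \<in> topspace (fst X) \<Longrightarrow> H s x \<in> topspace (fst Y)"
  unfolding pfam_def continuous_map_def by (auto simp: Pi_iff)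

lemma pmap_base: "pmap X Y f \<Longrightarrow> f (snd X) = snd Y"
  by (simp add: pmap_def)

lemma pmap_in: "pmap X Y f \<Longrightarrow> x \<in> topspace (fst X) \<Longrightarrow> f x \<in> topspace (fst Y)"
  unfolding pmap_def continuous_map_def by (auto simp: Pi_iff)

lemma pmap_pointed: "pmap X Y f \<Longrightarrow> pointed_space X \<Longrightarrow> pointed_space Y"
  using pmap_in[of X Y f "snd X"] by (simp add: pointed_space_def pmap_def)

lemma pfam_cong:
  assumes "pfam S X Y H" "pointed_space X"
    and "\<And>s x. s \<in> S \<Longrightarrow> x \<in> topspace (fst X) \<Longrightarrow> H s x = H' s x"
  shows "pfam S X Y H'"
  unfolding pfam_def
proof
  show "continuous_map (prod_topology (top_of_set S) (fst X)) (fst Y) (\<lambda>(s, x). H' s x)"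
    by (rule continuous_map_eq[where f = "\<lambda>(s, x). H s x"]) (use assms in \<open>auto simp: pfam_def\<close>)
  show "\<forall>s\<in>S. H' s (snd X) = snd Y"
    using assms by (metis pfam_base pointed_space_def)
qed

lemma pmap_cong:
  assumes "pmap X Y f" "pointed_space X" "\<And>x. x \<in> topspace (fst X) \<Longrightarrow> f x = f' x"
  shows "pmap X Y f'"
  using assms continuous_map_eq[of "fst X" "fst Y" f f'] by (auto simp: pmap_def pointed_space_def)

lemma pmap_id: "pmap X X (\<lambda>x. x)"
  by (simp add: pmap_def)

lemma pmap_compose: "pmap X Y f \<Longrightarrow> pmap Y T g \<Longrightarrow> pmap X T (\<lambda>x. g (f x))"
  unfolding pmap_def using continuous_map_compose[of "fst X" "fst Y" f "fst T" g]
  by (auto simp: o_def)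

lemma pmap_const: "pointed_space T \<Longrightarrow> pmap X T (\<lambda>_. snd T)"
  by (simp add: pmap_def pointed_space_def)

lemma pfam_compose:
  assumes "pfam S X Y H" "pfam S Y T K"
  shows "pfam S X T (\<lambda>s x. K s (H s x))"
proof -
  have "continuous_map (prod_topology (top_of_set S) (fst X)) (prod_topology (top_of_set S) (fst Y))
          (\<lambda>z. (fst z, (\<lambda>(s, x). H s x) z))"
    using assms(1) by (simp add: continuous_map_paired continuous_map_fst pfam_def)
  then have "continuous_map (prod_topology (top_of_set S) (fst X)) (fst T)
          ((\<lambda>(s, x). K s x) \<circ> (\<lambda>z. (fst z, (\<lambda>(s, x). H s x) z)))"
    using assms(2) by (intro continuous_map_compose) (auto simp: pfam_def)
  then show ?thesis
    using assms by (auto simp: pfam_def o_def case_prod_unfold)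
qed

lemma pfam_reparam:
  assumes "pfam S X Y H" "continuous_on S' c" "c ` S' \<subseteq> S"
  shows "pfam S' X Y (\<lambda>s. H (c s))"
proof -
  have c: "continuous_map (top_of_set S') (top_of_set S) c"
    using assms(2,3) by (simp add: continuous_map_in_subtopology image_subset_iff_funcset)
  have "continuous_map (prod_topology (top_of_set S') (fst X)) (prod_topology (top_of_set S) (fst X))
          (\<lambda>z. (c (fst z), snd z))"
    using continuous_map_compose[OF continuous_map_fst c]
    by (simp add: continuous_map_paired continuous_map_snd o_def)
  then have "continuous_map (prod_topology (top_of_set S') (fst X)) (fst Y)
          ((\<lambda>(s, x). H s x) \<circ> (\<lambda>z. (c (fst z), snd z)))"
    using assms(1) by (intro continuous_map_compose) (auto simp: pfam_def)
  then show ?thesis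
    using assms by (auto simp: pfam_def o_def case_prod_unfold)
qed

lemma pfam_pmap:
  assumes "pfam S X Y H" "s \<in> S" shows "pmap X Y (H s)"
proof -
  have "continuous_map (fst X) (prod_topology (top_of_set S) (fst X)) (\<lambda>x. (s, x))"
    using assms(2) by (simp add: continuous_map_paired)
  then have "continuous_map (fst X) (fst Y) ((\<lambda>(s, x). H s x) \<circ> (\<lambda>x. (s, x)))"
    using assms(1) by (intro continuous_map_compose) (auto simp: pfam_def)
  then show ?thesis
    using assms by (auto simp: pfam_def pmap_def o_def)
qed

lemma pmap_pfam: "pmap X Y f \<Longrightarrow> pfam S X Y (\<lambda>_. f)"
  unfolding pmap_def pfam_def using continuous_map_compose[OF continuous_map_snd, of "fst X" "fst Y" f]
  by (simp add: case_prod_unfold o_def)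

text \<open>The pasting lemma for the closed sets \<open>p \<le> q\<close> and
  \<open>q \<le> p\<close>. Both families live over all of \<open>S\<close>, so callers clamp their
  parameters with \<open>min\<close> and \<open>max\<close>.\<close>

lemma pfam_if_le:
  fixes p q :: "'p::metric_space \<Rightarrow> real"
  assumes "pfam S X Y H" "pfam S X Y K" "continuous_on S p" "continuous_on S q"
    and "\<And>s x. s \<in> S \<Longrightarrow> p s = q s \<Longrightarrow> x \<in> topspace (fst X) \<Longrightarrow> H s x = K s x"
  shows "pfam S X Y (\<lambda>s. if p s \<le> q s then H s else K s)"
proof -
  let ?P = "prod_topology (top_of_set S) (fst X)"
  have c: "continuous_map ?P euclideanreal (\<lambda>z. r (fst z))" if "continuous_on S r" for r :: "'p \<Rightarrow> real"
    using continuous_map_compose[OF continuous_map_fst, of "top_of_set S" euclideanreal r] that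
    by (simp add: o_def)
  have "continuous_map ?P (fst Y)
      (\<lambda>z. if p (fst z) \<le> q (fst z) then (\<lambda>(s, x). H s x) z else (\<lambda>(s, x). K s x) z)"
    by (rule continuous_map_cases_le)
      (use assms in \<open>auto intro!: c continuous_map_from_subtopology simp: pfam_def\<close>)
  moreover have "(\<lambda>z. if p (fst z) \<le> q (fst z) then (\<lambda>(s, x). H s x) z else (\<lambda>(s, x). K s x) z)
      = (\<lambda>(s, x). (if p s \<le> q s then H s else K s) x)"
    by auto
  ultimately show ?thesis
    using assms(1,2) by (simp add: pfam_def)
qed

section \<open>Descent of families along quotient maps and out of disjoint sums\<close>

text \<open>The product of a quotient map with a compact, hence locally compact, metric space is
  again a quotient map, so joint continuity of the lift can be tested before passing to the
  quotient.\<close>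

lemma quotient_map_fam_lift:
  fixes S :: "'p::metric_space set"
  assumes "quotient_map D X \<pi>" "compact S"
    and k: "continuous_map (prod_topology (top_of_set S) D) T (\<lambda>(s, d). k s d)"
    and resp: "\<And>s d d'. \<lbrakk>s \<in> S; d \<in> topspace D; d' \<in> topspace D; \<pi> d = \<pi> d'\<rbrakk> \<Longrightarrow> k s d = k s d'"
  obtains f where "continuous_map (prod_topology (top_of_set S) X) T (\<lambda>(s, x). f s x)"
    "\<And>s d. s \<in> S \<Longrightarrow> d \<in> topspace D \<Longrightarrow> f s (\<pi> d) = k s d"
proof
  \<comment> \<open>Any preimage serves as representative, by \<open>resp\<close>; outside the space
    the value is arbitrary.\<close>
  define f where "f s x = k s (SOME d. d \<in> topspace D \<and> \<pi> d = x)" for s x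
  show eq: "f s (\<pi> d) = k s d" if "s \<in> S" "d \<in> topspace D" for s d
  proof -
    let ?d = "SOME d'. d' \<in> topspace D \<and> \<pi> d' = \<pi> d"
    have "?d \<in> topspace D \<and> \<pi> ?d = \<pi> d"
      by (rule someI[of _ d]) (use that in simp)
    then have "k s ?d = k s d"
      by (intro resp) (use that in blast)+
    then show ?thesis by (simp only: f_def)
  qed
  have "quotient_map (prod_topology (top_of_set S) D) (prod_topology (top_of_set S) X) (\<lambda>(s, d). (s, \<pi> d))"
    using assms(1,2)
    by (intro quotient_map_prod_right)
      (auto simp: compact_imp_locally_compact_space Hausdorff_space_subtopology
        compact_space_subtopology)
  then show "continuous_map (prod_topology (top_of_set S) X) T (\<lambda>(s, x). f s x)"
  proof (rule continuous_compose_quotient_map)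
    show "continuous_map (prod_topology (top_of_set S) D) T ((\<lambda>(s, x). f s x) \<circ> (\<lambda>(s, d). (s, \<pi> d)))"
      by (rule continuous_map_eq[OF k]) (auto simp: eq)
  qed
qed

text \<open>Products with \<open>S\<close> preserve disjoint sums: the summands are open, so an open
  box inside one summand is open in the whole product.\<close>

lemma continuous_map_prod_sum_topology:
  assumes "\<And>j. j \<in> J \<Longrightarrow> continuous_map (prod_topology S (X j)) T (\<lambda>(s, x). k s (j, x))"
  shows "continuous_map (prod_topology S (sum_topology X J)) T (\<lambda>(s, d). k s d)"
  unfolding continuous_map_def
proof (intro conjI allI impI)
  show "(\<lambda>(s, d). k s d) \<in> topspace (prod_topology S (sum_topology X J)) \<rightarrow> topspace T"
  proof clarsimp
    fix s j x assume "s \<in> topspace S" "j \<in> J" "x \<in> topspace (X j)"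
    then show "k s (j, x) \<in> topspace T"
      using continuous_map_funspace[OF assms[of j]] by (auto simp: Pi_iff)
  qed
  fix U assume U: "openin T U"
  show "openin (prod_topology S (sum_topology X J))
     {z \<in> topspace (prod_topology S (sum_topology X J)). (\<lambda>(s, d). k s d) z \<in> U}"
    (is "openin _ ?R")
    unfolding openin_prod_topology_alt
  proof (intro allI impI)
    fix s d assume sd: "(s, d) \<in> ?R"
    obtain j x where d: "d = (j, x)" by (cases d)
    then have *: "s \<in> topspace S" "j \<in> J" "x \<in> topspace (X j)" "k s (j, x) \<in> U"
      using sd by auto
    let ?P = "{z \<in> topspace (prod_topology S (X j)). (\<lambda>(s, x). k s (j, x)) z \<in> U}"
    have "openin (prod_topology S (X j)) ?P"
      using assms[OF *(2)] U by (simp add: continuous_map_def)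
    moreover have "(s, x) \<in> ?P" using * by simp
    ultimately obtain V W where VW: "openin S V" "openin (X j) W" "s \<in> V" "x \<in> W" "V \<times> W \<subseteq> ?P"
      unfolding openin_prod_topology_alt by meson
    have "openin (sum_topology X J) (Pair j ` W)"
      using open_map_component_injection[OF *(2), of X] VW(2) by (auto simp: open_map_def)
    then show "\<exists>V W. openin S V \<and> openin (sum_topology X J) W \<and> s \<in> V \<and> d \<in> W \<and> V \<times> W \<subseteq> ?R"
      using VW *(2) d by (intro exI[of _ V] exI[of _ "Pair j ` W"] conjI) auto
  qed
qed

lemma continuous_map_prod_disjoint_union:
  fixes X :: "'a topology" and Y :: "'b topology"
  assumes "continuous_map (prod_topology S X) T (\<lambda>(s, x). k s (Inl x))"
    and "continuous_map (prod_topology S Y) T (\<lambda>(s, x). k s (Inr x))"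
  shows "continuous_map (prod_topology S (disjoint_union X Y)) T (\<lambda>(s, d). k s d)"
  unfolding continuous_map_def
proof (intro conjI allI impI)
  show "(\<lambda>(s, d). k s d) \<in> topspace (prod_topology S (disjoint_union X Y)) \<rightarrow> topspace T"
    using continuous_map_funspace[OF assms(1)] continuous_map_funspace[OF assms(2)]
    by (auto simp: Pi_iff)
  fix U assume U: "openin T U"
  \<comment> \<open>Stated for a variable summand \<open>Z\<close> with an open inclusion
    \<open>f\<close>, so that it applies to both \<open>Inl\<close> and \<open>Inr\<close>.\<close>
  have *: "\<exists>V. openin S V \<and> (\<exists>W. openin (disjoint_union X Y) W \<and> s \<in> V \<and> f x \<in> W \<and>
        V \<times> W \<subseteq> {z \<in> topspace (prod_topology S (disjoint_union X Y)). (\<lambda>(s, d). k s d) z \<in> U})"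
    if "s \<in> topspace S" "x \<in> topspace Z" "k s (f x) \<in> U"
      and c: "continuous_map (prod_topology S Z) T (\<lambda>(s, x). k s (f x))"
      and o: "\<And>W. openin Z W \<Longrightarrow> openin (disjoint_union X Y) (f ` W)"
    for s x and Z :: "'z topology" and f
  proof -
    let ?P = "{z \<in> topspace (prod_topology S Z). (\<lambda>(s, x). k s (f x)) z \<in> U}"
    have "openin (prod_topology S Z) ?P"
      using c U by (simp add: continuous_map_def)
    moreover have "(s, x) \<in> ?P" using that by simp
    ultimately obtain V W where VW: "openin S V" "openin Z W" "s \<in> V" "x \<in> W" "V \<times> W \<subseteq> ?P"
      unfolding openin_prod_topology_alt by meson
    then show ?thesis
      using openin_subset[OF o[OF VW(2)]] openin_subset[OF VW(1)] o[OF VW(2)]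
      by (intro exI[of _ V] conjI exI[of _ "f ` W"]) auto
  qed
  have l: "openin (disjoint_union X Y) (Inl ` W)" if "openin X W" for W
  proof -
    have "Inr -` (Inl ` W) = ({} :: 'b set)" by auto
    then show ?thesis using that by (simp add: openin_disjoint_union_iff inj_vimage_image_eq)
  qed
  have r: "openin (disjoint_union X Y) (Inr ` W)" if "openin Y W" for W
  proof -
    have "Inl -` (Inr ` W) = ({} :: 'a set)" by auto
    then show ?thesis using that by (simp add: openin_disjoint_union_iff inj_vimage_image_eq)
  qed
  show "openin (prod_topology S (disjoint_union X Y))
     {z \<in> topspace (prod_topology S (disjoint_union X Y)). (\<lambda>(s, d). k s d) z \<in> U}"
    (is "openin _ ?R")
    unfolding openin_prod_topology_alt
  proof (intro allI impI)
    fix s d assume "(s, d) \<in> ?R"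
    then show "\<exists>V W. openin S V \<and> openin (disjoint_union X Y) W \<and> s \<in> V \<and> d \<in> W \<and> V \<times> W \<subseteq> ?R"
      using *[OF _ _ _ assms(1) l] *[OF _ _ _ assms(2) r] by (cases d) auto
  qed
qed

abbreviation unit_ivl :: "real set" where "unit_ivl \<equiv> {0..1}"

section \<open>Maps and homotopies out of pushouts, sequential colimits, wedges, cones and
  suspensions\<close>

lemma is_pushoutD:
  assumes "is_pushout W Z C g i X p q"
  shows "pmap W Z g" "pmap W C i" "pmap Z X p" "pmap C X q"
    "\<And>w. w \<in> topspace (fst W) \<Longrightarrow> p (g w) = q (i w)"
proof -
  show g: "pmap W Z g" and i: "pmap W C i" and "pmap Z X p" "pmap C X q"
    using assms by (auto simp: is_pushout_def)
  fix w assume w: "w \<in> topspace (fst W)"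
  let ?R = "\<lambda>u v. \<exists>w \<in> topspace (fst W). u = Inl (g w) \<and> v = Inr (i w)"
  have "equivclp ?R (Inl (g w)) (Inr (i w))"
    using w by (intro r_into_equivclp) blast
  moreover have "Inl (g w) \<in> topspace (fst Z) <+> topspace (fst C)"
      "Inr (i w) \<in> topspace (fst Z) <+> topspace (fst C)"
    using pmap_in[OF g w] pmap_in[OF i w] by auto
  ultimately have "case_sum p q (Inl (g w)) = case_sum p q (Inr (i w))"
    using assms unfolding is_pushout_def by blast
  then show "p (g w) = q (i w)" by simp
qed

lemma pushout_cases:
  assumes "is_pushout W Z C g i X p q" "x \<in> topspace (fst X)"
  obtains z where "z \<in> topspace (fst Z)" "x = p z" | c where "c \<in> topspace (fst C)" "x = q c"
proof -
  have "case_sum p q ` (topspace (fst Z) <+> topspace (fst C)) = topspace (fst X)"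
    using assms(1) quotient_imp_surjective_map unfolding is_pushout_def
    by (metis topspace_disjoint_union)
  then obtain u where "u \<in> topspace (fst Z) <+> topspace (fst C)" "x = case_sum p q u"
    using assms(2) by (metis imageE)
  then show thesis using that by (cases u) auto
qed

text \<open>The universal property for families: a pushout is a quotient of a disjoint union, so
  compatible homotopies, and not only maps, descend to it.\<close>

lemma pushout_pfam:
  assumes P: "is_pushout W Z C g i X p q" and "pointed_space Z" "compact S"
    and h: "pfam S Z T h" and k: "pfam S C T k"
    and "\<And>s w. \<lbrakk>s \<in> S; w \<in> topspace (fst W)\<rbrakk> \<Longrightarrow> h s (g w) = k s (i w)"
  obtains f where "pfam S X T f"
    "\<And>s z. \<lbrakk>s \<in> S; z \<in> topspace (fst Z)\<rbrakk> \<Longrightarrow> f s (p z) = h s z"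
    "\<And>s c. \<lbrakk>s \<in> S; c \<in> topspace (fst C)\<rbrakk> \<Longrightarrow> f s (q c) = k s c"
proof -
  let ?D = "disjoint_union (fst Z) (fst C)"
  have Q: "quotient_map ?D (fst X) (case_sum p q)"
    using P by (simp add: is_pushout_def)
  have c: "continuous_map (prod_topology (top_of_set S) ?D) (fst T) (\<lambda>(s, d). case_sum (h s) (k s) d)"
    by (rule continuous_map_prod_disjoint_union) (use h k in \<open>simp_all add: pfam_def\<close>)
  have resp: "case_sum (h s) (k s) u = case_sum (h s) (k s) v"
    if "s \<in> S" "u \<in> topspace ?D" "v \<in> topspace ?D" "case_sum p q u = case_sum p q v" for s u v
  proof -
    have "equivclp (\<lambda>u v. \<exists>w \<in> topspace (fst W). u = Inl (g w) \<and> v = Inr (i w)) u v"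
      using that P unfolding is_pushout_def topspace_disjoint_union by blast
    then show ?thesis
      by (rule equivclp_respects) (use assms(6) that(1) in auto)
  qed
  obtain f where f: "continuous_map (prod_topology (top_of_set S) (fst X)) (fst T) (\<lambda>(s, x). f s x)"
    "\<And>s d. s \<in> S \<Longrightarrow> d \<in> topspace ?D \<Longrightarrow> f s (case_sum p q d) = case_sum (h s) (k s) d"
    using quotient_map_fam_lift[OF Q \<open>compact S\<close> c resp] by blast
  have fp: "f s (p z) = h s z" if "s \<in> S" "z \<in> topspace (fst Z)" for s z
    using f(2)[of s "Inl z"] that by simp
  have fq: "f s (q c) = k s c" if "s \<in> S" "c \<in> topspace (fst C)" for s c
    using f(2)[of s "Inr c"] that by simp
  have "f s (snd X) = snd T" if "s \<in> S" for s
    using fp[OF that, of "snd Z"] pfam_base[OF h that] pmap_base[OF is_pushoutD(3)[OF P]] \<open>pointed_space Z\<close>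
    by (simp add: pointed_space_def)
  then have "pfam S X T f" using f(1) by (simp add: pfam_def)
  then show thesis using fp fq that by blast
qed

lemma colimit_cases:
  assumes "is_seq_colimit S f X \<iota>" "x \<in> topspace (fst X)"
  obtains n y where "y \<in> topspace (fst (S n))" "x = \<iota> n y"
proof -
  have "(\<lambda>(n, x). \<iota> n x) ` topspace (sum_topology (\<lambda>n. fst (S n)) UNIV) = topspace (fst X)"
    using assms(1) quotient_imp_surjective_map unfolding is_seq_colimit_def by blast
  then show thesis
    using assms(2) that by (force simp: image_iff)
qed

lemma is_seq_colimitD:
  assumes "is_seq_colimit S f X \<iota>"
  shows "pmap (S n) (S (Suc n)) (f n)" "pmap (S n) X (\<iota> n)"
    "x \<in> topspace (fst (S n)) \<Longrightarrow> \<iota> (Suc n) (f n x) = \<iota> n x"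
proof -
  show f: "pmap (S n) (S (Suc n)) (f n)" and "pmap (S n) X (\<iota> n)"
    using assms by (auto simp: is_seq_colimit_def)
  assume x: "x \<in> topspace (fst (S n))"
  let ?R = "\<lambda>u v. \<exists>k. \<exists>z \<in> topspace (fst (S k)). u = (k, z) \<and> v = (Suc k, f k z)"
  have "equivclp ?R (n, x) (Suc n, f n x)"
    using x by (intro r_into_equivclp) blast
  moreover have "f n x \<in> topspace (fst (S (Suc n)))"
    using pmap_in[OF f x] .
  ultimately have "\<iota> n x = \<iota> (Suc n) (f n x)"
    using assms x unfolding is_seq_colimit_def by blast
  then show "\<iota> (Suc n) (f n x) = \<iota> n x" ..
qed

text \<open>The same descent for colimits. Homotopies on the stages have to commute strictly with
  the maps \<open>f n\<close>, which is the reason for the strict choices made later.\<close>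

lemma colimit_pfam:
  assumes P: "is_seq_colimit S f X \<iota>" and "pointed_space (S 0)" "compact R"
    and h: "\<And>n. pfam R (S n) T (h n)"
    and "\<And>s n x. \<lbrakk>s \<in> R; x \<in> topspace (fst (S n))\<rbrakk> \<Longrightarrow> h (Suc n) s (f n x) = h n s x"
  obtains r where "pfam R X T r"
    "\<And>s n x. \<lbrakk>s \<in> R; x \<in> topspace (fst (S n))\<rbrakk> \<Longrightarrow> r s (\<iota> n x) = h n s x"
proof -
  let ?D = "sum_topology (\<lambda>n. fst (S n)) UNIV"
  let ?k = "\<lambda>s (n, x). h n s x"
  have Q: "quotient_map ?D (fst X) (\<lambda>(n, x). \<iota> n x)"
    using P by (simp add: is_seq_colimit_def)
  have c: "continuous_map (prod_topology (top_of_set R) ?D) (fst T) (\<lambda>(s, d). ?k s d)"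
    by (rule continuous_map_prod_sum_topology) (use h in \<open>simp add: pfam_def\<close>)
  have resp: "?k s u = ?k s v"
    if "s \<in> R" "u \<in> topspace ?D" "v \<in> topspace ?D" "(\<lambda>(n, x). \<iota> n x) u = (\<lambda>(n, x). \<iota> n x) v" for s u v
  proof -
    have "equivclp (\<lambda>u v. \<exists>k. \<exists>z \<in> topspace (fst (S k)). u = (k, z) \<and> v = (Suc k, f k z)) u v"
      using that P unfolding is_seq_colimit_def by (cases u; cases v) auto
    then show ?thesis
      by (rule equivclp_respects) (use assms(5) that(1) in auto)
  qed
  obtain r where r: "continuous_map (prod_topology (top_of_set R) (fst X)) (fst T) (\<lambda>(s, x). r s x)"
    "\<And>s d. s \<in> R \<Longrightarrow> d \<in> topspace ?D \<Longrightarrow> r s ((\<lambda>(n, x). \<iota> n x) d) = ?k s d"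
    using quotient_map_fam_lift[OF Q \<open>compact R\<close> c resp] by blast
  have ri: "r s (\<iota> n x) = h n s x" if "s \<in> R" "x \<in> topspace (fst (S n))" for s n x
    using r(2)[of s "(n, x)"] that by simp
  have "r s (snd X) = snd T" if "s \<in> R" for s
    using ri[OF that, of "snd (S 0)" 0] pfam_base[OF h[of 0] that]
      pmap_base[OF is_seq_colimitD(2)[OF P, of 0]] \<open>pointed_space (S 0)\<close>
    by (simp add: pointed_space_def)
  then have "pfam R X T r" using r(1) by (simp add: pfam_def)
  then show thesis using ri that by blast
qed

lemma topspace_wedge:
  "topspace (fst (wedge J X)) = insert None (wedge_in X ` (J \<times> topspace (fst X)))"
  unfolding wedge_def Let_def by (subst fst_conv, subst topspace_final_topology) auto

lemma snd_wedge [simp]: "snd (wedge J X) = None"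
  by (simp add: wedge_def Let_def)

lemma wedge_cases:
  assumes "x \<in> topspace (fst (wedge J X))"
  obtains "x = None" | j y where "j \<in> J" "y \<in> topspace (fst X)" "x = wedge_in X (j, y)"
  using assms by (auto simp: topspace_wedge)

lemma wedge_in_base [simp]: "wedge_in X (j, snd X) = None"
  by (simp add: wedge_in_def)

lemma pmap_wedge_in:
  assumes "j \<in> J" shows "pmap X (wedge J X) (\<lambda>x. wedge_in X (j, x))"
proof -
  let ?S = "sum_topology (\<lambda>_. fst X) J"
  have "continuous_map ?S (fst (wedge J X)) (wedge_in X)"
    unfolding continuous_map_def using topspace_wedge[of J X]
    by (auto simp: wedge_def openin_final_topology)
  moreover have "continuous_map (fst X) ?S (\<lambda>x. (j, x))"
    using continuous_map_component_injection[OF assms, of "\<lambda>_. fst X"] by simp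
  ultimately have "continuous_map (fst X) (fst (wedge J X)) (wedge_in X \<circ> (\<lambda>x. (j, x)))"
    by (rule continuous_map_compose[rotated])
  then show ?thesis by (simp add: pmap_def o_def)
qed

lemma wedge_pfam:
  assumes "pointed_space X" "pointed_space T" "compact S"
    and h: "\<And>j. j \<in> J \<Longrightarrow> pfam S X T (h j)"
  obtains f where "pfam S (wedge J X) T f"
    "\<And>s j x. \<lbrakk>s \<in> S; j \<in> J; x \<in> topspace (fst X)\<rbrakk> \<Longrightarrow> f s (wedge_in X (j, x)) = h j s x"
proof (cases "J = {}")
  \<comment> \<open>The one-point wedge is not a quotient of the empty sum; a constant family does
    the job.\<close>
  case True
  then show thesis
    using that[OF pmap_pfam[OF pmap_const[OF \<open>pointed_space T\<close>]]] by blast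
next
  case False
  let ?D = "sum_topology (\<lambda>_. fst X) J"
  let ?k = "\<lambda>s (j, x). h j s x"
  note Q = quotient_map_wedge[OF \<open>pointed_space X\<close> False]
  have c: "continuous_map (prod_topology (top_of_set S) ?D) (fst T) (\<lambda>(s, d). ?k s d)"
    by (rule continuous_map_prod_sum_topology) (use h in \<open>simp add: pfam_def\<close>)
  have resp: "?k s u = ?k s v"
    if "s \<in> S" "u \<in> topspace ?D" "v \<in> topspace ?D" "wedge_in X u = wedge_in X v" for s u v
    using that pfam_base[OF h \<open>s \<in> S\<close>] by (auto simp: wedge_in_def split: if_splits)
  obtain f where f: "continuous_map (prod_topology (top_of_set S) (fst (wedge J X))) (fst T) (\<lambda>(s, x). f s x)"
    "\<And>s d. s \<in> S \<Longrightarrow> d \<in> topspace ?D \<Longrightarrow> f s (wedge_in X d) = ?k s d"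
    using quotient_map_fam_lift[OF Q \<open>compact S\<close> c resp] by blast
  have fw: "f s (wedge_in X (j, x)) = h j s x" if "s \<in> S" "j \<in> J" "x \<in> topspace (fst X)" for s j x
    using f(2)[of s "(j, x)"] that by simp
  obtain j where j: "j \<in> J" using False by blast
  have "f s None = snd T" if "s \<in> S" for s
    using fw[OF that j, of "snd X"] pfam_base[OF h[OF j] that] \<open>pointed_space X\<close>
    by (simp add: pointed_space_def)
  then have "pfam S (wedge J X) T f" using f(1) by (simp add: pfam_def)
  then show thesis using fw that by blast
qed

lemma cone_proj_base: "cone_proj X (snd X, t) = Base" "cone_proj X (x, 1) = Base"
  by (simp_all add: cone_proj_def)

lemma susp_proj_base: "susp_proj X (snd X, t) = Base" "susp_proj X (x, 0) = Base" "susp_proj X (x, 1) = Base"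
  by (simp_all add: susp_proj_def)

lemma snd_red_cone [simp]: "snd (red_cone X) = Base" and snd_red_susp [simp]: "snd (red_susp X) = Base"
  by (simp_all add: red_cone_def red_susp_def Let_def)

lemma cone_cases:
  assumes "x \<in> topspace (fst (red_cone X))"
  obtains y t where "y \<in> topspace (fst X)" "t \<in> unit_ivl" "x = cone_proj X (y, t)"
proof -
  have "x \<in> cone_proj X ` topspace (prod_topology (fst X) (top_of_set unit_ivl))"
    using assms quotient_imp_surjective_map[OF quotient_map_cone[of X]] by simp
  then show thesis using that by auto
qed

lemma susp_cases:
  assumes "x \<in> topspace (fst (red_susp X))"
  obtains y t where "y \<in> topspace (fst X)" "t \<in> unit_ivl" "x = susp_proj X (y, t)"
proof -
  have "x \<in> susp_proj X ` topspace (prod_topology (fst X) (top_of_set unit_ivl))"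
    using assms quotient_imp_surjective_map[OF quotient_map_susp[of X]] by simp
  then show thesis using that by auto
qed

lemma pfam_cone_proj: "pfam unit_ivl X (red_cone X) (\<lambda>t x. cone_proj X (x, t))"
proof -
  have "continuous_map (prod_topology (top_of_set unit_ivl) (fst X)) (prod_topology (fst X) (top_of_set unit_ivl))
      (\<lambda>z. (snd z, fst z))"
    by (simp add: continuous_map_paired continuous_map_fst continuous_map_snd)
  from continuous_map_compose[OF this quotient_imp_continuous_map[OF quotient_map_cone]]
  show ?thesis
    by (simp add: pfam_def o_def case_prod_unfold cone_proj_base)
qed

lemma pfam_susp_proj: "pfam unit_ivl X (red_susp X) (\<lambda>t x. susp_proj X (x, t))"
proof -
  have "continuous_map (prod_topology (top_of_set unit_ivl) (fst X)) (prod_topology (fst X) (top_of_set unit_ivl))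
      (\<lambda>z. (snd z, fst z))"
    by (simp add: continuous_map_paired continuous_map_fst continuous_map_snd)
  from continuous_map_compose[OF this quotient_imp_continuous_map[OF quotient_map_susp]]
  show ?thesis
    by (simp add: pfam_def o_def case_prod_unfold susp_proj_base)
qed

text \<open>Cones and suspensions are quotients of \<open>X \<times> [0,1]\<close> and are treated
  together. The cylinder coordinate is moved into the parameter: a family over \<open>S\<close> on
  the quotient comes from a family over \<open>S \<times> [0,1]\<close> on \<open>X\<close>.\<close>

lemma cylinder_pfam:
  assumes Q: "quotient_map (prod_topology (fst X) (top_of_set unit_ivl)) (fst Y) \<pi>"
    and b: "\<pi> (snd X, 0) = snd Y" "pointed_space X" and S: "compact S"
    and k: "pfam (S \<times> unit_ivl) X T k"
    and resp: "\<And>s x t x' t'. \<lbrakk>s \<in> S; x \<in> topspace (fst X); t \<in> unit_ivl; x' \<in> topspace (fst X); t' \<in> unit_ivl;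
       \<pi> (x, t) = \<pi> (x', t')\<rbrakk> \<Longrightarrow> k (s, t) x = k (s, t') x'"
  obtains f where "pfam S Y T f"
    "\<And>s x t. \<lbrakk>s \<in> S; x \<in> topspace (fst X); t \<in> unit_ivl\<rbrakk> \<Longrightarrow> f s (\<pi> (x, t)) = k (s, t) x"
proof -
  let ?D = "prod_topology (fst X) (top_of_set unit_ivl)"
  let ?P = "prod_topology (top_of_set S) ?D"
  have "continuous_map ?P (prod_topology (prod_topology (top_of_set S) (top_of_set unit_ivl)) (fst X))
          (\<lambda>z. ((fst z, snd (snd z)), fst (snd z)))"
    using continuous_map_compose[OF continuous_map_snd continuous_map_fst, of "top_of_set S" "fst X" "top_of_set unit_ivl"]
      continuous_map_compose[OF continuous_map_snd continuous_map_snd, of "top_of_set S" "fst X" "top_of_set unit_ivl"]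
    by (simp add: continuous_map_paired continuous_map_fst o_def del: prod_topology_subtopology_eu)
  then have "continuous_map ?P (fst T) ((\<lambda>(s, x). k s x) \<circ> (\<lambda>z. ((fst z, snd (snd z)), fst (snd z))))"
    using k by (intro continuous_map_compose) (auto simp: pfam_def prod_topology_subtopology_eu)
  then have c: "continuous_map ?P (fst T) (\<lambda>(s, d). (\<lambda>s (x, t). k (s, t) x) s d)"
    by (simp add: o_def case_prod_unfold)
  have r: "(\<lambda>s (x, t). k (s, t) x) s d = (\<lambda>s (x, t). k (s, t) x) s d'"
    if "s \<in> S" "d \<in> topspace ?D" "d' \<in> topspace ?D" "\<pi> d = \<pi> d'" for s d d'
    using that resp[of s "fst d" "snd d" "fst d'" "snd d'"] by (cases d; cases d') simp
  obtain f where f: "continuous_map (prod_topology (top_of_set S) (fst Y)) (fst T) (\<lambda>(s, x). f s x)"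
    "\<And>s d. s \<in> S \<Longrightarrow> d \<in> topspace ?D \<Longrightarrow> f s (\<pi> d) = (\<lambda>s (x, t). k (s, t) x) s d"
    using quotient_map_fam_lift[OF Q S c r] by blast
  have fw: "f s (\<pi> (x, t)) = k (s, t) x" if "s \<in> S" "x \<in> topspace (fst X)" "t \<in> unit_ivl" for s x t
    using f(2)[of s "(x, t)"] that by simp
  have "f s (snd Y) = snd T" if "s \<in> S" for s
    using fw[OF that, of "snd X" 0] pfam_base[OF k, of "(s, 0)"] b that
    by (simp add: pointed_space_def)
  then have "pfam S Y T f" using f(1) by (simp add: pfam_def)
  then show thesis using fw that by blast
qed

lemma cone_pfam:
  assumes "pointed_space X" "compact S" and k: "pfam (S \<times> unit_ivl) X T k"
    and k1: "\<And>s x. \<lbrakk>s \<in> S; x \<in> topspace (fst X)\<rbrakk> \<Longrightarrow> k (s, 1) x = snd T"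
  obtains f where "pfam S (red_cone X) T f"
    "\<And>s x t. \<lbrakk>s \<in> S; x \<in> topspace (fst X); t \<in> unit_ivl\<rbrakk> \<Longrightarrow> f s (cone_proj X (x, t)) = k (s, t) x"
proof (rule cylinder_pfam[OF quotient_map_cone _ assms(1-3)])
  fix s x t x' t' assume *: "s \<in> S" "x \<in> topspace (fst X)" "t \<in> unit_ivl" "x' \<in> topspace (fst X)" "t' \<in> unit_ivl"
    and eq: "cone_proj X (x, t) = cone_proj X (x', t')"
  have "k (s, t) (snd X) = snd T" "k (s, t') (snd X) = snd T"
    using pfam_base[OF k] * by auto
  then show "k (s, t) x = k (s, t') x'"
    using eq k1 * by (auto simp: cone_proj_def split: if_splits)
qed (use that in \<open>auto simp: cone_proj_def\<close>)

lemma susp_pfam: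
  assumes "pointed_space X" "compact S" and k: "pfam (S \<times> unit_ivl) X T k"
    and k1: "\<And>s x. \<lbrakk>s \<in> S; x \<in> topspace (fst X)\<rbrakk> \<Longrightarrow> k (s, 0) x = snd T \<and> k (s, 1) x = snd T"
  obtains f where "pfam S (red_susp X) T f"
    "\<And>s x t. \<lbrakk>s \<in> S; x \<in> topspace (fst X); t \<in> unit_ivl\<rbrakk> \<Longrightarrow> f s (susp_proj X (x, t)) = k (s, t) x"
proof (rule cylinder_pfam[OF quotient_map_susp _ assms(1-3)])
  fix s x t x' t' assume *: "s \<in> S" "x \<in> topspace (fst X)" "t \<in> unit_ivl" "x' \<in> topspace (fst X)" "t' \<in> unit_ivl"
    and eq: "susp_proj X (x, t) = susp_proj X (x', t')"
  have "k (s, t) (snd X) = snd T" "k (s, t') (snd X) = snd T"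
    using pfam_base[OF k] * by auto
  then show "k (s, t) x = k (s, t') x'"
    using eq k1 * by (auto simp: susp_proj_def split: if_splits)
qed (use that in \<open>auto simp: susp_proj_def\<close>)

section \<open>Pointed homotopies\<close>

text \<open>\<open>homotopic_with\<close> unfolds well only if the condition on the intermediate
  maps depends on their values on the space alone; this holds because the base point lies in the
  space.\<close>

lemma phomotopic_iff_pfam:
  assumes "pointed_space X"
  shows "phomotopic X Y f g \<longleftrightarrow>
    (\<exists>H. pfam unit_ivl X Y H \<and> (\<forall>x \<in> topspace (fst X). H 0 x = f x \<and> H 1 x = g x))"
proof -
  have *: "phomotopic X Y f g \<longleftrightarrow>
     (\<exists>h. continuous_map (prod_topology (top_of_set unit_ivl) (fst X)) (fst Y) h \<and>
              (\<forall>x \<in> topspace (fst X). h(0,x) = f x) \<and>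
              (\<forall>x \<in> topspace (fst X). h(1,x) = g x) \<and>
              (\<forall>t \<in> unit_ivl. h (t, snd X) = snd Y))"
    unfolding phomotopic_def
    by (subst homotopic_with) (use assms in \<open>auto simp: pointed_space_def\<close>)
  show ?thesis
  proof
    assume "phomotopic X Y f g"
    then obtain h where "continuous_map (prod_topology (top_of_set unit_ivl) (fst X)) (fst Y) h"
        "\<forall>x \<in> topspace (fst X). h(0,x) = f x" "\<forall>x \<in> topspace (fst X). h(1,x) = g x"
        "\<forall>t \<in> unit_ivl. h (t, snd X) = snd Y"
      unfolding * by blast
    then show "\<exists>H. pfam unit_ivl X Y H \<and> (\<forall>x \<in> topspace (fst X). H 0 x = f x \<and> H 1 x = g x)"
      by (intro exI[of _ "\<lambda>s x. h (s, x)"]) (simp add: pfam_def)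
  next
    assume "\<exists>H. pfam unit_ivl X Y H \<and> (\<forall>x \<in> topspace (fst X). H 0 x = f x \<and> H 1 x = g x)"
    then obtain H where "pfam unit_ivl X Y H" "\<forall>x \<in> topspace (fst X). H 0 x = f x \<and> H 1 x = g x"
      by blast
    then show "phomotopic X Y f g"
      unfolding * by (intro exI[of _ "\<lambda>(s, x). H s x"]) (simp add: pfam_def)
  qed
qed

lemma phomotopicI:
  assumes "pfam unit_ivl X Y H" "pointed_space X"
    "\<And>x. x \<in> topspace (fst X) \<Longrightarrow> H 0 x = f x" "\<And>x. x \<in> topspace (fst X) \<Longrightarrow> H 1 x = g x"
  shows "phomotopic X Y f g"
  using assms by (auto simp: phomotopic_iff_pfam)

lemma phomotopicE:
  assumes "phomotopic X Y f g" "pointed_space X"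
  obtains H where "pfam unit_ivl X Y H"
    "\<And>x. x \<in> topspace (fst X) \<Longrightarrow> H 0 x = f x" "\<And>x. x \<in> topspace (fst X) \<Longrightarrow> H 1 x = g x"
  using assms by (auto simp: phomotopic_iff_pfam)

lemma phomotopic_cong:
  assumes "phomotopic X Y f g" "pointed_space X"
    "\<And>x. x \<in> topspace (fst X) \<Longrightarrow> f x = f' x" "\<And>x. x \<in> topspace (fst X) \<Longrightarrow> g x = g' x"
  shows "phomotopic X Y f' g'"
  using assms by (auto simp: phomotopic_iff_pfam)

lemma phomotopic_sym: "phomotopic X Y f g \<Longrightarrow> phomotopic X Y g f"
  unfolding phomotopic_def by (rule homotopic_with_symD)

lemma phomotopic_trans [trans]: "phomotopic X Y f g \<Longrightarrow> phomotopic X Y g h \<Longrightarrow> phomotopic X Y f h"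
  unfolding phomotopic_def by (rule homotopic_with_trans)

lemma phomotopic_eq:
  assumes "pmap X Y f" "pointed_space X" "\<And>x. x \<in> topspace (fst X) \<Longrightarrow> f x = g x"
  shows "phomotopic X Y f g"
  using phomotopicI[OF pmap_pfam[OF assms(1)] assms(2)] assms(3) by blast

lemma phomotopic_refl: "pmap X Y f \<Longrightarrow> pointed_space X \<Longrightarrow> phomotopic X Y f f"
  by (simp add: phomotopic_eq)

lemma phomotopic_compose:
  assumes "phomotopic X Y f g" "phomotopic Y Z f' g'" "pointed_space X" "pointed_space Y"
  shows "phomotopic X Z (\<lambda>x. f' (f x)) (\<lambda>x. g' (g x))"
proof -
  obtain H where H: "pfam unit_ivl X Y H"
    "\<And>x. x \<in> topspace (fst X) \<Longrightarrow> H 0 x = f x" "\<And>x. x \<in> topspace (fst X) \<Longrightarrow> H 1 x = g x"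
    using phomotopicE[OF assms(1,3)] by blast
  obtain K where K: "pfam unit_ivl Y Z K"
    "\<And>x. x \<in> topspace (fst Y) \<Longrightarrow> K 0 x = f' x" "\<And>x. x \<in> topspace (fst Y) \<Longrightarrow> K 1 x = g' x"
    using phomotopicE[OF assms(2,4)] by blast
  have "f x \<in> topspace (fst Y)" "g x \<in> topspace (fst Y)" if "x \<in> topspace (fst X)" for x
    using pfam_in[OF H(1), of 0 x] pfam_in[OF H(1), of 1 x] H(2,3) that by auto
  then show ?thesis
    using phomotopicI[OF pfam_compose[OF H(1) K(1)] assms(3)] H K by auto
qed

lemma phomotopic_compose_left:
  assumes "phomotopic X Y f g" "pmap Y Z h" "pointed_space X"
  shows "phomotopic X Z (\<lambda>x. h (f x)) (\<lambda>x. h (g x))"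
proof -
  obtain H where H: "pfam unit_ivl X Y H"
    "\<And>x. x \<in> topspace (fst X) \<Longrightarrow> H 0 x = f x" "\<And>x. x \<in> topspace (fst X) \<Longrightarrow> H 1 x = g x"
    using phomotopicE[OF assms(1,3)] by blast
  show ?thesis
    by (rule phomotopicI[OF pfam_compose[OF H(1) pmap_pfam[OF assms(2)]] assms(3)]) (simp_all add: H)
qed

lemma phomotopic_compose_right:
  assumes "phomotopic Y Z f g" "pmap X Y h" "pointed_space X"
  shows "phomotopic X Z (\<lambda>x. f (h x)) (\<lambda>x. g (h x))"
  using phomotopic_compose[OF phomotopic_refl[OF assms(2,3)] assms(1,3) pmap_pointed[OF assms(2,3)]] .

section \<open>Homotopy inverses and concatenation of homotopies\<close>

definition htpy_inverse :: "'a pointed \<Rightarrow> 'b pointed \<Rightarrow> ('a \<Rightarrow> 'b) \<Rightarrow> ('b \<Rightarrow> 'a) \<Rightarrow> bool" where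
  "htpy_inverse X Y f g \<longleftrightarrow> pmap X Y f \<and> pmap Y X g \<and>
     phomotopic X X (\<lambda>x. g (f x)) (\<lambda>x. x) \<and> phomotopic Y Y (\<lambda>y. f (g y)) (\<lambda>y. y)"

lemma phomotopy_equivalence_iff: "phomotopy_equivalence X Y f \<longleftrightarrow> (\<exists>g. htpy_inverse X Y f g)"
  unfolding phomotopy_equivalence_def htpy_inverse_def by (auto simp: o_def id_def)

lemma htpy_inverse_sym: "htpy_inverse X Y f g \<longleftrightarrow> htpy_inverse Y X g f"
  by (auto simp: htpy_inverse_def)

lemma htpy_inverse_compose:
  assumes "htpy_inverse X Y f g" "htpy_inverse Y Z f' g'" "pointed_space X" "pointed_space Z"
  shows "htpy_inverse X Z (\<lambda>x. f' (f x)) (\<lambda>z. g (g' z))"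
proof -
  have m: "pmap X Y f" "pmap Y X g" "pmap Y Z f'" "pmap Z Y g'"
    using assms by (auto simp: htpy_inverse_def)
  have "phomotopic X X (\<lambda>x. g (g' (f' (f x)))) (\<lambda>x. g (f x))"
    using phomotopic_compose_left[OF phomotopic_compose_right[of Y Y "\<lambda>y. g' (f' y)" "\<lambda>y. y" X f] m(2)] assms m
    by (simp add: htpy_inverse_def)
  moreover have "phomotopic Z Z (\<lambda>x. f' (f (g (g' x)))) (\<lambda>x. f' (g' x))"
    using phomotopic_compose_left[OF phomotopic_compose_right[of Y Y "\<lambda>y. f (g y)" "\<lambda>y. y" Z g'] m(3)] assms m
    by (simp add: htpy_inverse_def)
  ultimately show ?thesis
    using assms m by (auto simp: htpy_inverse_def intro: pmap_compose phomotopic_trans)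
qed

text \<open>\<open>g\<close>, \<open>g \<circ> f \<circ> h\<close> and \<open>h\<close> are
  homotopic, so the left and the right inverse can replace each other.\<close>

lemma htpy_inverse_two_sided:
  assumes "pmap X Y f" "pmap Y X g" "pmap Y X h" "pointed_space X" "pointed_space Y"
    and gf: "phomotopic X X (\<lambda>x. g (f x)) (\<lambda>x. x)" and fh: "phomotopic Y Y (\<lambda>y. f (h y)) (\<lambda>y. y)"
  shows "htpy_inverse X Y f g" "htpy_inverse X Y f h"
proof -
  have "phomotopic Y X (\<lambda>y. g (f (h y))) (\<lambda>y. g y)"
    using phomotopic_compose_left[OF fh assms(2,5)] .
  moreover have "phomotopic Y X (\<lambda>y. g (f (h y))) (\<lambda>y. h y)"
    using phomotopic_compose_right[OF gf assms(3,5)] .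
  ultimately have gh: "phomotopic Y X (\<lambda>y. g y) (\<lambda>y. h y)"
    by (meson phomotopic_sym phomotopic_trans)
  have "phomotopic Y Y (\<lambda>y. f (g y)) (\<lambda>y. f (h y))"
    using phomotopic_compose_left[OF gh assms(1,5)] .
  moreover have "phomotopic X X (\<lambda>x. h (f x)) (\<lambda>x. g (f x))"
    using phomotopic_compose_right[OF phomotopic_sym[OF gh] assms(1,4)] .
  ultimately show "htpy_inverse X Y f g" "htpy_inverse X Y f h"
    using assms by (auto simp: htpy_inverse_def intro: phomotopic_trans)
qed

text \<open>A left inverse of an equivalence is homotopic to any inverse. So an inverse can be
  modified, or a strict retraction used, while only one composite is checked.\<close>

lemma htpy_inverse_unique:
  assumes "htpy_inverse X Y f g" "pmap Y X h" "pointed_space X" "pointed_space Y"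
    and "phomotopic X X (\<lambda>x. h (f x)) (\<lambda>x. x)"
  shows "htpy_inverse X Y f h"
  by (rule htpy_inverse_two_sided(1)[where h = g]) (use assms in \<open>auto simp: htpy_inverse_def\<close>)

lemma pfam_concat:
  assumes "pfam unit_ivl X Y H" "pfam unit_ivl X Y K"
    and "\<And>x. x \<in> topspace (fst X) \<Longrightarrow> H 1 x = K 0 x"
  shows "pfam unit_ivl X Y (\<lambda>s. if s \<le> 1/2 then H (min 1 (2 * s)) else K (max 0 (2 * s - 1)))"
proof (rule pfam_if_le)
  show "pfam unit_ivl X Y (\<lambda>s. H (min 1 (2 * s)))"
    by (rule pfam_reparam[OF assms(1)]) (auto intro!: continuous_intros)
  show "pfam unit_ivl X Y (\<lambda>s. K (max 0 (2 * s - 1)))"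
    by (rule pfam_reparam[OF assms(2)]) (auto intro!: continuous_intros)
qed (use assms(3) in \<open>auto intro!: continuous_intros\<close>)

lemma pfam_reverse: "pfam unit_ivl X Y H \<Longrightarrow> pfam unit_ivl X Y (\<lambda>s. H (1 - s))"
  by (rule pfam_reparam) (auto intro!: continuous_intros)


section \<open>The homotopy extension property\<close>

text \<open>The usual property, with an additional parameter in \<open>[0,1]\<close> (the first coordinate), and for the
  single target \<open>T\<close>, because HOL cannot quantify over the type of the target.\<close>

definition hep :: "'w pointed \<Rightarrow> 'c pointed \<Rightarrow> ('w \<Rightarrow> 'c) \<Rightarrow> 't pointed \<Rightarrow> bool" where
  "hep W C i T \<longleftrightarrow> pmap W C i \<and>
     (\<forall>F h. pfam unit_ivl C T F \<and> pfam (unit_ivl \<times> unit_ivl) W T h \<and>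
        (\<forall>s \<in> unit_ivl. \<forall>w \<in> topspace (fst W). h (s, 0) w = F s (i w)) \<longrightarrow>
        (\<exists>K. pfam (unit_ivl \<times> unit_ivl) C T K \<and>
           (\<forall>s \<in> unit_ivl. \<forall>c \<in> topspace (fst C). K (s, 0) c = F s c) \<and>
           (\<forall>s \<in> unit_ivl. \<forall>r \<in> unit_ivl. \<forall>w \<in> topspace (fst W). K (s, r) (i w) = h (s, r) w)))"

lemma hepE:
  assumes "hep W C i T" "pfam unit_ivl C T F" "pfam (unit_ivl \<times> unit_ivl) W T h"
    "\<And>s w. \<lbrakk>s \<in> unit_ivl; w \<in> topspace (fst W)\<rbrakk> \<Longrightarrow> h (s, 0) w = F s (i w)"
  obtains K where "pfam (unit_ivl \<times> unit_ivl) C T K"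
    "\<And>s c. \<lbrakk>s \<in> unit_ivl; c \<in> topspace (fst C)\<rbrakk> \<Longrightarrow> K (s, 0) c = F s c"
    "\<And>s r w. \<lbrakk>s \<in> unit_ivl; r \<in> unit_ivl; w \<in> topspace (fst W)\<rbrakk> \<Longrightarrow> K (s, r) (i w) = h (s, r) w"
proof -
  have "\<exists>K. pfam (unit_ivl \<times> unit_ivl) C T K \<and>
           (\<forall>s \<in> unit_ivl. \<forall>c \<in> topspace (fst C). K (s, 0) c = F s c) \<and>
           (\<forall>s \<in> unit_ivl. \<forall>r \<in> unit_ivl. \<forall>w \<in> topspace (fst W). K (s, r) (i w) = h (s, r) w)"
    using assms unfolding hep_def by blast
  then show thesis using that by blast
qed

text \<open>Ordinary homotopy extension: the homotopy is made constant in the additional parameter,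
  and the result is read off at parameter 0.\<close>

lemma hep_extend:
  assumes "hep W C i T" "pmap C T F" "pfam unit_ivl W T h"
    "\<And>w. w \<in> topspace (fst W) \<Longrightarrow> h 0 w = F (i w)"
  obtains K where "pfam unit_ivl C T K" "\<And>c. c \<in> topspace (fst C) \<Longrightarrow> K 0 c = F c"
    "\<And>r w. \<lbrakk>r \<in> unit_ivl; w \<in> topspace (fst W)\<rbrakk> \<Longrightarrow> K r (i w) = h r w"
proof -
  have h: "pfam (unit_ivl \<times> unit_ivl) W T (\<lambda>z. h (snd z))"
    by (rule pfam_reparam[OF assms(3)]) (auto intro!: continuous_intros)
  obtain K where K: "pfam (unit_ivl \<times> unit_ivl) C T K"
    "\<And>s c. \<lbrakk>s \<in> unit_ivl; c \<in> topspace (fst C)\<rbrakk> \<Longrightarrow> K (s, 0) c = F c"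
    "\<And>s r w. \<lbrakk>s \<in> unit_ivl; r \<in> unit_ivl; w \<in> topspace (fst W)\<rbrakk> \<Longrightarrow> K (s, r) (i w) = h r w"
    by (rule hepE[OF assms(1) pmap_pfam[OF assms(2)] h]) (use assms(4) in auto)
  have "pfam unit_ivl C T (\<lambda>r. K (0, r))"
    by (rule pfam_reparam[OF K(1)]) (auto intro!: continuous_intros)
  then show thesis
    using that[of "\<lambda>r. K (0, r)"] K(2,3) by simp
qed

text \<open>The parametrized extension property yields a homotopy over the square which starts with \<open>\<Phi>\<close> and on
  \<open>W\<close> moves \<open>m s\<close> towards \<open>m' s\<close> at unit speed; \<open>\<Psi>\<close> is its restriction to the graph of
  \<open>\<bar>m' - m\<bar>\<close>, which meets the bottom edge at both ends.\<close>

lemma hep_reparam: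
  assumes hep: "hep W C i T" and \<Phi>: "pfam unit_ivl C T \<Phi>" and \<theta>: "pfam unit_ivl W T \<theta>"
    and m: "continuous_on unit_ivl m" "m ` unit_ivl \<subseteq> unit_ivl"
    and m': "continuous_on unit_ivl m'" "m' ` unit_ivl \<subseteq> unit_ivl"
    and ends: "m' 0 = m 0" "m' 1 = m 1"
    and eq: "\<And>s w. \<lbrakk>s \<in> unit_ivl; w \<in> topspace (fst W)\<rbrakk> \<Longrightarrow> \<Phi> s (i w) = \<theta> (m s) w"
  obtains \<Psi> where "pfam unit_ivl C T \<Psi>"
    "\<And>c. c \<in> topspace (fst C) \<Longrightarrow> \<Psi> 0 c = \<Phi> 0 c" "\<And>c. c \<in> topspace (fst C) \<Longrightarrow> \<Psi> 1 c = \<Phi> 1 c"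
    "\<And>s w. \<lbrakk>s \<in> unit_ivl; w \<in> topspace (fst W)\<rbrakk> \<Longrightarrow> \<Psi> s (i w) = \<theta> (m' s) w"
proof -
  \<comment> \<open>\<open>u (s, r)\<close> adds to \<open>m s\<close> the difference
    \<open>m' s - m s\<close> truncated to \<open>[-r, r]\<close>. It stays between
    \<open>m s\<close> and \<open>m' s\<close> and reaches \<open>m' s\<close> when \<open>r\<close>
    is their distance.\<close>
  define u :: "real \<times> real \<Rightarrow> real"
    where "u z = m (fst z) + max (- snd z) (min (snd z) (m' (fst z) - m (fst z)))" for z
  define \<rho> where "\<rho> s = \<bar>m' s - m s\<bar>" for s
  have mf: "continuous_on (unit_ivl \<times> unit_ivl) (\<lambda>z. m (fst z))" "continuous_on (unit_ivl \<times> unit_ivl) (\<lambda>z. m' (fst z))"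
    by (rule continuous_on_compose2[OF m(1)] continuous_on_compose2[OF m'(1)]; auto intro!: continuous_intros)+
  have u: "continuous_on (unit_ivl \<times> unit_ivl) u"
    unfolding u_def by (intro continuous_intros mf)
  have u01: "u ` (unit_ivl \<times> unit_ivl) \<subseteq> unit_ivl"
  proof (clarify, goal_cases)
    case (1 _ s r)
    then have "m s \<in> unit_ivl" "m' s \<in> unit_ivl" "0 \<le> r"
      using subsetD[OF m(2), OF imageI, of s] subsetD[OF m'(2), OF imageI, of s] by auto
    then show ?case by (auto simp: u_def max_def min_def)
  qed
  have h: "pfam (unit_ivl \<times> unit_ivl) W T (\<lambda>z. \<theta> (u z))"
    by (rule pfam_reparam[OF \<theta> u u01])
  obtain K where K: "pfam (unit_ivl \<times> unit_ivl) C T K"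
    "\<And>s c. \<lbrakk>s \<in> unit_ivl; c \<in> topspace (fst C)\<rbrakk> \<Longrightarrow> K (s, 0) c = \<Phi> s c"
    "\<And>s r w. \<lbrakk>s \<in> unit_ivl; r \<in> unit_ivl; w \<in> topspace (fst W)\<rbrakk> \<Longrightarrow> K (s, r) (i w) = \<theta> (u (s, r)) w"
    by (rule hepE[OF hep \<Phi> h]) (auto simp: eq u_def)
  have \<rho>: "continuous_on unit_ivl \<rho>" unfolding \<rho>_def by (intro continuous_intros m m')
  have \<rho>01: "\<rho> s \<in> unit_ivl" if "s \<in> unit_ivl" for s
  proof -
    have "m s \<in> unit_ivl" "m' s \<in> unit_ivl"
      using subsetD[OF m(2), OF imageI, of s] subsetD[OF m'(2), OF imageI, of s] that by auto
    then show ?thesis by (auto simp: \<rho>_def)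
  qed
  have "pfam unit_ivl C T (\<lambda>s. K (s, \<rho> s))"
    by (rule pfam_reparam[OF K(1)]) (use \<rho>01 in \<open>auto intro!: continuous_intros \<rho>\<close>)
  moreover have "u (s, \<rho> s) = m' s" for s
    by (simp add: u_def \<rho>_def max_def min_def)
  ultimately show thesis
    using that[of "\<lambda>s. K (s, \<rho> s)"] K(2,3) \<rho>01 by (simp add: \<rho>_def ends)
qed

text \<open>Reversing \<open>\<Gamma>\<close> and continuing with \<open>\<Gamma>'\<close> joins the
  two ends. On \<open>W\<close> this path runs along \<open>\<Gamma>\<close> from 1 down to 0 and up
  again, with parameter \<open>\<bar>2 * s - 1\<bar>\<close>; \<open>hep_reparam\<close> replaces
  that parameter by the constant 1, which has the same end values.\<close>

lemma hep_rel_homotopy: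
  assumes hep: "hep W C i T" and \<Gamma>: "pfam unit_ivl C T \<Gamma>" "pfam unit_ivl C T \<Gamma>'"
    and start: "\<And>c. c \<in> topspace (fst C) \<Longrightarrow> \<Gamma> 0 c = \<Gamma>' 0 c"
    and eq: "\<And>s w. \<lbrakk>s \<in> unit_ivl; w \<in> topspace (fst W)\<rbrakk> \<Longrightarrow> \<Gamma> s (i w) = \<Gamma>' s (i w)"
  obtains K where "pfam unit_ivl C T K"
    "\<And>c. c \<in> topspace (fst C) \<Longrightarrow> K 0 c = \<Gamma> 1 c" "\<And>c. c \<in> topspace (fst C) \<Longrightarrow> K 1 c = \<Gamma>' 1 c"
    "\<And>s w. \<lbrakk>s \<in> unit_ivl; w \<in> topspace (fst W)\<rbrakk> \<Longrightarrow> K s (i w) = \<Gamma> 1 (i w)"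
proof -
  let ?\<Phi> = "\<lambda>s. if s \<le> 1/2 then \<Gamma> (1 - min 1 (2 * s)) else \<Gamma>' (max 0 (2 * s - 1))"
  have \<Phi>: "pfam unit_ivl C T ?\<Phi>"
    using pfam_concat[OF pfam_reverse[OF \<Gamma>(1)] \<Gamma>(2)] start by simp
  have i: "pmap W C i" using hep by (simp add: hep_def)
  have \<theta>: "pfam unit_ivl W T (\<lambda>s w. \<Gamma> s (i w))"
    by (rule pfam_compose[OF pmap_pfam[OF i] \<Gamma>(1)])
  have e: "?\<Phi> s (i w) = \<Gamma> (\<bar>2 * s - 1\<bar>) (i w)" if "s \<in> unit_ivl" "w \<in> topspace (fst W)" for s w
  proof (cases "s \<le> 1/2")
    case True
    then have "1 - min 1 (2 * s) = \<bar>2 * s - 1\<bar>" by (simp add: min_def)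
    then show ?thesis using True by simp
  next
    case False
    then have "max 0 (2 * s - 1) = \<bar>2 * s - 1\<bar>" "\<bar>2 * s - 1\<bar> \<in> unit_ivl" using that by (auto simp: max_def)
    then show ?thesis using False eq[of "\<bar>2 * s - 1\<bar>" w] that by simp
  qed
  obtain K where K: "pfam unit_ivl C T K"
    "\<And>c. c \<in> topspace (fst C) \<Longrightarrow> K 0 c = ?\<Phi> 0 c" "\<And>c. c \<in> topspace (fst C) \<Longrightarrow> K 1 c = ?\<Phi> 1 c"
    "\<And>s w. \<lbrakk>s \<in> unit_ivl; w \<in> topspace (fst W)\<rbrakk> \<Longrightarrow> K s (i w) = \<Gamma> 1 (i w)"
    by (rule hep_reparam[OF hep \<Phi> \<theta>, of "\<lambda>s. \<bar>2 * s - 1\<bar>" "\<lambda>_. 1"])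
      (use e in \<open>auto intro!: continuous_intros\<close>)
  then show thesis using that[of K] by simp
qed

text \<open>Cofibrations are stable under cobase change: the homotopy on \<open>Z\<close> is pulled
  back to \<open>W\<close>, extended over \<open>C\<close>, and the extension is glued with the
  homotopy on \<open>Z\<close>.\<close>

lemma hep_pushout:
  assumes P: "is_pushout W Z C g i X p q" and "pointed_space Z" and hep: "hep W C i T"
  shows "hep Z X p T"
  unfolding hep_def
proof (intro conjI allI impI; (elim conjE)?)
  note PD = is_pushoutD[OF P]
  show "pmap Z X p" by (rule PD)
  fix F h assume F: "pfam unit_ivl X T F" and h: "pfam (unit_ivl \<times> unit_ivl) Z T h"
    and eq: "\<forall>s\<in>unit_ivl. \<forall>z\<in>topspace (fst Z). h (s, 0) z = F s (p z)"
  have Fq: "pfam unit_ivl C T (\<lambda>s c. F s (q c))"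
    by (rule pfam_compose[OF pmap_pfam[OF PD(4)] F])
  have hg: "pfam (unit_ivl \<times> unit_ivl) W T (\<lambda>s w. h s (g w))"
    by (rule pfam_compose[OF pmap_pfam[OF PD(1)] h])
  obtain K where K: "pfam (unit_ivl \<times> unit_ivl) C T K"
    "\<And>s c. \<lbrakk>s \<in> unit_ivl; c \<in> topspace (fst C)\<rbrakk> \<Longrightarrow> K (s, 0) c = F s (q c)"
    "\<And>s r w. \<lbrakk>s \<in> unit_ivl; r \<in> unit_ivl; w \<in> topspace (fst W)\<rbrakk> \<Longrightarrow> K (s, r) (i w) = h (s, r) (g w)"
    by (rule hepE[OF hep Fq hg]) (use eq PD(5) pmap_in[OF PD(1)] in auto)
  obtain f where f: "pfam (unit_ivl \<times> unit_ivl) X T f"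
    "\<And>s z. \<lbrakk>s \<in> unit_ivl \<times> unit_ivl; z \<in> topspace (fst Z)\<rbrakk> \<Longrightarrow> f s (p z) = h s z"
    "\<And>s c. \<lbrakk>s \<in> unit_ivl \<times> unit_ivl; c \<in> topspace (fst C)\<rbrakk> \<Longrightarrow> f s (q c) = K s c"
    by (rule pushout_pfam[OF P \<open>pointed_space Z\<close> _ h K(1)]) (use K(3) in \<open>auto intro: compact_Times\<close>)
  have "f (s, 0) x = F s x" if "s \<in> unit_ivl" "x \<in> topspace (fst X)" for s x
    using that(2) by (cases rule: pushout_cases[OF P]) (use f(2,3) K(2) eq that(1) in auto)
  then show "\<exists>K. pfam (unit_ivl \<times> unit_ivl) X T K \<and>
           (\<forall>s\<in>unit_ivl. \<forall>c\<in>topspace (fst X). K (s, 0) c = F s c) \<and>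
           (\<forall>s\<in>unit_ivl. \<forall>r\<in>unit_ivl. \<forall>w\<in>topspace (fst Z). K (s, r) (p w) = h (s, r) w)"
    using f(1,2) by (intro exI[of _ f]) auto
qed

text \<open>A pointed homotopy is stationary at the base point, so \<open>F\<close> extended
  constantly works. This covers 0-cells, which are attached over a point.\<close>

lemma hep_point:
  assumes "topspace (fst W) = {snd W}" "pmap W C i"
  shows "hep W C i T"
  unfolding hep_def
proof (intro conjI allI impI assms(2); (elim conjE)?)
  fix F h assume F: "pfam unit_ivl C T F" and h: "pfam (unit_ivl \<times> unit_ivl) W T h"
  have K: "pfam (unit_ivl \<times> unit_ivl) C T (\<lambda>z. F (fst z))"
    by (rule pfam_reparam[OF F]) (auto intro!: continuous_intros)
  show "\<exists>K. pfam (unit_ivl \<times> unit_ivl) C T K \<and>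
           (\<forall>s\<in>unit_ivl. \<forall>c\<in>topspace (fst C). K (s, 0) c = F s c) \<and>
           (\<forall>s\<in>unit_ivl. \<forall>r\<in>unit_ivl. \<forall>w\<in>topspace (fst W). K (s, r) (i w) = h (s, r) w)"
    using K pfam_base[OF h] pfam_base[OF F] pmap_base[OF assms(2)] by (intro exI[of _ "\<lambda>z. F (fst z)"]) (simp add: assms(1))
qed

section \<open>Homotopy invariance of pushouts\<close>

text \<open>Points of \<open>Z\<close> and points of \<open>C\<close> outside the image of
  \<open>i\<close> are normal forms for the generated equivalence relation; injectivity on them
  replaces the analysis of chains of identifications.\<close>

lemma is_pushoutI:
  assumes g: "pmap W Z g" and i: "pmap W C i" and p: "pmap Z X p" and q: "pmap C X q"
    and Q: "quotient_map (disjoint_union (fst Z) (fst C)) (fst X) (case_sum p q)"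
    and ip: "inj_on p (topspace (fst Z))" and iq: "inj_on q (topspace (fst C) - i ` topspace (fst W))"
    and disj: "p ` topspace (fst Z) \<inter> q ` (topspace (fst C) - i ` topspace (fst W)) = {}"
    and comm: "\<And>w. w \<in> topspace (fst W) \<Longrightarrow> p (g w) = q (i w)"
  shows "is_pushout W Z C g i X p q"
  unfolding is_pushout_def
proof (intro conjI g i p q Q ballI iffI)
  let ?R = "\<lambda>u v. \<exists>w \<in> topspace (fst W). u = Inl (g w) \<and> v = Inr (i w)"
  fix u v assume u: "u \<in> topspace (fst Z) <+> topspace (fst C)" and v: "v \<in> topspace (fst Z) <+> topspace (fst C)"
  show "case_sum p q u = case_sum p q v" if "equivclp ?R u v"
    by (rule equivclp_respects[OF that]) (auto simp: comm)
  let ?N = "Inl ` topspace (fst Z) \<union> Inr ` (topspace (fst C) - i ` topspace (fst W))"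
  have norm: "\<exists>n \<in> ?N. equivclp ?R u n \<and> case_sum p q u = case_sum p q n"
    if u: "u \<in> topspace (fst Z) <+> topspace (fst C)" for u
  proof (cases "u \<in> ?N")
    case True
    then show ?thesis by (intro bexI[of _ u]) auto
  next
    case False
    then obtain w where w: "w \<in> topspace (fst W)" "u = Inr (i w)" using u by auto
    then have "equivclp ?R (Inl (g w)) u" by (intro r_into_equivclp) blast
    then show ?thesis
      using w comm[OF w(1)] pmap_in[OF g w(1)] by (intro bexI[of _ "Inl (g w)"]) (auto intro: equivclp_sym)
  qed
  assume eq: "case_sum p q u = case_sum p q v"
  obtain n m where n: "n \<in> ?N" "equivclp ?R u n" "case_sum p q u = case_sum p q n"
    and m: "m \<in> ?N" "equivclp ?R v m" "case_sum p q v = case_sum p q m"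
    using norm[OF u] norm[OF v] by blast
  have nm: "case_sum p q n = case_sum p q m" using eq n m by simp
  have "n = m"
  proof -
    have "p z \<noteq> q c" "q c \<noteq> p z" if "z \<in> topspace (fst Z)" "c \<in> topspace (fst C) - i ` topspace (fst W)" for z c
      using that disj by blast+
    then show ?thesis
      using n(1) m(1) nm by (auto dest: inj_onD[OF ip] inj_onD[OF iq])
  qed
  then show "equivclp ?R u v"
    using n(2) m(2) by (meson equivclp_sym equivclp_trans)
qed

lemma continuous_map_Inl: "continuous_map X (disjoint_union X Y) Inl"
  and continuous_map_Inr: "continuous_map Y (disjoint_union X Y) Inr"
proof -
  have "{x \<in> topspace X. Inl x \<in> U} = Inl -` U" if "openin X (Inl -` U)" for U :: "('a + 'b) set"
    using openin_subset[OF that] by auto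
  moreover have "{x \<in> topspace Y. Inr x \<in> U} = Inr -` U" if "openin Y (Inr -` U)" for U :: "('a + 'b) set"
    using openin_subset[OF that] by auto
  ultimately show "continuous_map X (disjoint_union X Y) Inl" "continuous_map Y (disjoint_union X Y) Inr"
    by (auto simp: continuous_map_def openin_disjoint_union_iff)
qed

text \<open>The point set is prescribed: \<open>p\<close> names the points of \<open>Z\<close> and
  \<open>e\<close> the new ones. With \<open>p\<close> the identity, the stages of a complex become
  nested subsets of one type.\<close>

lemma pushout_exists:
  fixes W :: "'w pointed" and Z :: "'z pointed" and C :: "'c pointed" and p :: "'z \<Rightarrow> 'x"
  assumes W: "pointed_space W" "pointed_space Z" and g: "pmap W Z g" and i: "pmap W C i"
    and ii: "inj_on i (topspace (fst W))" and ip: "inj_on p (topspace (fst Z))"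
    and ie: "inj_on e (topspace (fst C) - i ` topspace (fst W))"
    and disj: "p ` topspace (fst Z) \<inter> e ` (topspace (fst C) - i ` topspace (fst W)) = {}"
  obtains X :: "'x pointed" and q where "is_pushout W Z C g i X p q"
    "topspace (fst X) = p ` topspace (fst Z) \<union> e ` (topspace (fst C) - i ` topspace (fst W))"
    "snd X = p (snd Z)"
proof -
  \<comment> \<open>On the image of \<open>i\<close> the value is forced by
    \<open>p \<circ> g\<close>, and injectivity of \<open>i\<close> makes it well defined.\<close>
  define q where "q c = (if c \<in> i ` topspace (fst W) then p (g (inv_into (topspace (fst W)) i c)) else e c)" for c
  have qi: "q (i w) = p (g w)" if "w \<in> topspace (fst W)" for w
    using that ii by (simp add: q_def)
  have qe: "q c = e c" if "c \<in> topspace (fst C) - i ` topspace (fst W)" for c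
    using that by (simp add: q_def)
  let ?D = "disjoint_union (fst Z) (fst C)"
  define X where "X = (final_topology (case_sum p q ` topspace ?D) ?D (case_sum p q), p (snd Z))"
  have Q: "quotient_map ?D (fst X) (case_sum p q)"
    by (simp add: X_def quotient_map_final_topology)
  have c: "continuous_map (fst Z) (fst X) p" "continuous_map (fst C) (fst X) q"
    using continuous_map_compose[OF continuous_map_Inl quotient_imp_continuous_map[OF Q]]
      continuous_map_compose[OF continuous_map_Inr quotient_imp_continuous_map[OF Q]]
    by (simp_all add: o_def)
  have base: "q (snd C) = p (snd Z)"
    using qi[of "snd W"] W(1) pmap_base[OF g] pmap_base[OF i] by (simp add: pointed_space_def)
  have eqe: "q ` (topspace (fst C) - i ` topspace (fst W)) = e ` (topspace (fst C) - i ` topspace (fst W))"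
    by (intro image_cong refl qe)
  have "is_pushout W Z C g i X p q"
  proof (rule is_pushoutI[OF g i _ _ Q ip])
    show "inj_on q (topspace (fst C) - i ` topspace (fst W))"
      using ie by (rule inj_on_cong[THEN iffD1, rotated]) (simp add: qe)
    show "p ` topspace (fst Z) \<inter> q ` (topspace (fst C) - i ` topspace (fst W)) = {}"
      using disj eqe by simp
  qed (use c base qi in \<open>auto simp: pmap_def X_def\<close>)
  moreover have "topspace (fst X) = p ` topspace (fst Z) \<union> e ` (topspace (fst C) - i ` topspace (fst W))"
  proof -
    have "topspace (fst X) = case_sum p q ` topspace ?D"
      using quotient_imp_surjective_map[OF Q] by simp
    also have "\<dots> = p ` topspace (fst Z) \<union> q ` topspace (fst C)"
      by (simp add: Plus_def image_Un image_image)
    also have "topspace (fst C) = i ` topspace (fst W) \<union> (topspace (fst C) - i ` topspace (fst W))"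
      using pmap_in[OF i] by auto
    also have "p ` topspace (fst Z) \<union> q ` (i ` topspace (fst W) \<union> (topspace (fst C) - i ` topspace (fst W)))
        = p ` topspace (fst Z) \<union> e ` (topspace (fst C) - i ` topspace (fst W))"
      unfolding image_Un eqe using qi pmap_in[OF g] by auto
    finally show ?thesis .
  qed
  ultimately show thesis using that by (simp add: X_def)
qed

text \<open>Auxiliary pushouts live in a sum type; this fixes the target types for which later
  lemmas assume the extension property.\<close>

lemma pushout_exists_sum:
  fixes W :: "'w pointed" and Z :: "'z pointed" and C :: "'c pointed"
  assumes "pointed_space W" "pointed_space Z" "pmap W Z g" "pmap W C i" "inj_on i (topspace (fst W))"
  obtains X :: "('z + 'c) pointed" and p q where "is_pushout W Z C g i X p q"
  by (rule pushout_exists[OF assms, of Inl Inr]) (use that in auto)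

text \<open>Presents \<open>C\<close> itself as a pushout, so that
  \<open>pushout_htpy_inverse\<close> can compare it with a pushout along another map.\<close>

lemma is_pushout_id:
  assumes "pmap W C i" "inj_on i (topspace (fst W))"
  shows "is_pushout W W C (\<lambda>w. w) i C i (\<lambda>c. c)"
proof (rule is_pushoutI)
  have "case_sum i (\<lambda>c. c) ` topspace (disjoint_union (fst W) (fst C)) = topspace (fst C)"
    using pmap_in[OF assms(1)] by (auto simp: Plus_def image_Un image_image)
  moreover have "openin (disjoint_union (fst W) (fst C))
        {x \<in> topspace (disjoint_union (fst W) (fst C)). case_sum i (\<lambda>c. c) x \<in> U} \<longleftrightarrow> openin (fst C) U"
    if "U \<subseteq> topspace (fst C)" for U
  proof -
    have 1: "Inl -` {x \<in> topspace (disjoint_union (fst W) (fst C)). case_sum i (\<lambda>c. c) x \<in> U}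
        = {w \<in> topspace (fst W). i w \<in> U}"
      "Inr -` {x \<in> topspace (disjoint_union (fst W) (fst C)). case_sum i (\<lambda>c. c) x \<in> U} = U"
      using that by auto
    show ?thesis
      using assms(1) unfolding openin_disjoint_union_iff 1 by (auto simp: pmap_def continuous_map_def)
  qed
  ultimately show "quotient_map (disjoint_union (fst W) (fst C)) (fst C) (case_sum i (\<lambda>c. c))"
    unfolding quotient_map_def by blast
qed (use assms in \<open>auto intro: pmap_id inj_on_id\<close>)

section \<open>Change of the base space of a pushout\<close>

lemma pushout_map:
  assumes P: "is_pushout W Z C g i X p q" and "pointed_space Z" and "pmap Z T h" "pmap C T k"
    and "\<And>w. w \<in> topspace (fst W) \<Longrightarrow> h (g w) = k (i w)"
  obtains f where "pmap X T f" "\<And>z. z \<in> topspace (fst Z) \<Longrightarrow> f (p z) = h z"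
    "\<And>c. c \<in> topspace (fst C) \<Longrightarrow> f (q c) = k c"
  using is_pushout_universal[OF assms(1-4)] assms(5) by metis

lemma pushout_pointed:
  assumes "is_pushout W Z C g i X p q" "pointed_space Z" shows "pointed_space X"
  by (rule pmap_pointed[OF is_pushoutD(3)[OF assms(1)] assms(2)])

lemma pushout_homotopy:
  assumes P: "is_pushout W Z C g i X p q" and Z: "pointed_space Z"
    and h: "pfam unit_ivl Z T h" and k: "pfam unit_ivl C T k"
    and comm: "\<And>s w. \<lbrakk>s \<in> unit_ivl; w \<in> topspace (fst W)\<rbrakk> \<Longrightarrow> h s (g w) = k s (i w)"
    and h01: "\<And>z. z \<in> topspace (fst Z) \<Longrightarrow> h 0 z = u (p z) \<and> h 1 z = v (p z)"
    and k01: "\<And>c. c \<in> topspace (fst C) \<Longrightarrow> k 0 c = u (q c) \<and> k 1 c = v (q c)"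
  shows "phomotopic X T u v"
proof -
  obtain f where f: "pfam unit_ivl X T f"
    "\<And>s z. \<lbrakk>s \<in> unit_ivl; z \<in> topspace (fst Z)\<rbrakk> \<Longrightarrow> f s (p z) = h s z"
    "\<And>s c. \<lbrakk>s \<in> unit_ivl; c \<in> topspace (fst C)\<rbrakk> \<Longrightarrow> f s (q c) = k s c"
    using pushout_pfam[OF P Z compact_Icc h k comm] by blast
  have "f 0 x = u x" "f 1 x = v x" if "x \<in> topspace (fst X)" for x
    using that by (cases rule: pushout_cases[OF P]; use f h01 k01 in auto)+
  then show ?thesis
    by (intro phomotopicI[OF f(1)] pushout_pointed[OF P Z]) auto
qed

text \<open>A homotopy \<open>N\<close> between two attaching maps induces a map of the pushouts which runs through \<open>N\<close> on a
  collar of \<open>C\<close>. The map induced by the reversed homotopy is inverse to it: the composite runs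
  through \<open>N\<close> back and forth.\<close>

lemma collar_cancel:
  assumes P0: "is_pushout W Z C k0 i X0 p0 q0" and P1: "is_pushout W Z C k1 i X1 p1 q1"
    and Z: "pointed_space Z" and N: "pfam unit_ivl W Z N" and hep: "hep W C i X0"
    and f: "pmap X0 X1 f" "\<And>z. z \<in> topspace (fst Z) \<Longrightarrow> f (p0 z) = p1 z"
      "\<And>c. c \<in> topspace (fst C) \<Longrightarrow> f (q0 c) = Q 1 c"
    and Q: "pfam unit_ivl C X1 Q" "\<And>c. c \<in> topspace (fst C) \<Longrightarrow> Q 0 c = q1 c"
      "\<And>s w. \<lbrakk>s \<in> unit_ivl; w \<in> topspace (fst W)\<rbrakk> \<Longrightarrow> Q s (i w) = p1 (N (1 - s) w)"
    and f': "pmap X1 X0 f'" "\<And>z. z \<in> topspace (fst Z) \<Longrightarrow> f' (p1 z) = p0 z"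
      "\<And>c. c \<in> topspace (fst C) \<Longrightarrow> f' (q1 c) = Q' 1 c"
    and Q': "pfam unit_ivl C X0 Q'" "\<And>c. c \<in> topspace (fst C) \<Longrightarrow> Q' 0 c = q0 c"
      "\<And>s w. \<lbrakk>s \<in> unit_ivl; w \<in> topspace (fst W)\<rbrakk> \<Longrightarrow> Q' s (i w) = p0 (N s w)"
  shows "phomotopic X0 X0 (\<lambda>x. f' (f x)) (\<lambda>x. x)"
proof -
  note D0 = is_pushoutD[OF P0]
  \<comment> \<open>The reverse of \<open>Q'\<close> and \<open>f' \<circ> Q\<close> start at the
    same map and agree on \<open>W\<close>, so their ends \<open>q0\<close> and
    \<open>f' \<circ> f \<circ> q0\<close> are homotopic relative to \<open>W\<close>. On
    \<open>Z\<close> the homotopy is constant.\<close>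
  have "Q' (1 - 0) c = f' (Q 0 c)" if "c \<in> topspace (fst C)" for c
    using that f'(3) Q(2) by simp
  moreover have "Q' (1 - s) (i w) = f' (Q s (i w))" if "s \<in> unit_ivl" "w \<in> topspace (fst W)" for s w
    using that Q(3) Q'(3)[of "1 - s" w] f'(2) pfam_in[OF N, of "1 - s" w] by simp
  ultimately obtain K where K: "pfam unit_ivl C X0 K"
    "\<And>c. c \<in> topspace (fst C) \<Longrightarrow> K 0 c = Q' (1 - 1) c" "\<And>c. c \<in> topspace (fst C) \<Longrightarrow> K 1 c = f' (Q 1 c)"
    "\<And>s w. \<lbrakk>s \<in> unit_ivl; w \<in> topspace (fst W)\<rbrakk> \<Longrightarrow> K s (i w) = Q' (1 - 1) (i w)"
    using hep_rel_homotopy[OF hep pfam_reverse[OF Q'(1)] pfam_compose[OF Q(1) pmap_pfam[OF f'(1)]]] by blast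
  have "phomotopic X0 X0 (\<lambda>x. x) (\<lambda>x. f' (f x))"
  proof (rule pushout_homotopy[OF P0 Z pmap_pfam[OF D0(3)] K(1)])
    show "p0 (k0 w) = K s (i w)" if "s \<in> unit_ivl" "w \<in> topspace (fst W)" for s w
      using that K(4) Q'(2) D0(5) pmap_in[OF D0(2)] by simp
  qed (use f f' Q Q'(2) K(2,3) in auto)
  then show ?thesis by (rule phomotopic_sym)
qed

text \<open>\<open>Q'\<close> and \<open>f'\<close> are built like \<open>Q\<close> and
  \<open>f\<close>, with \<open>N\<close> run in the opposite direction; both composites are then
  instances of the same cancellation.\<close>

lemma collar_htpy_inverse:
  assumes P0: "is_pushout W Z C k0 i X0 p0 q0" and P1: "is_pushout W Z C k1 i X1 p1 q1"
    and Z: "pointed_space Z" and N: "pfam unit_ivl W Z N"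
    and N01: "\<And>w. w \<in> topspace (fst W) \<Longrightarrow> N 0 w = k0 w" "\<And>w. w \<in> topspace (fst W) \<Longrightarrow> N 1 w = k1 w"
    and hep: "hep W C i X0" "hep W C i X1"
    and f: "pmap X0 X1 f" "\<And>z. z \<in> topspace (fst Z) \<Longrightarrow> f (p0 z) = p1 z"
      "\<And>c. c \<in> topspace (fst C) \<Longrightarrow> f (q0 c) = Q 1 c"
    and Q: "pfam unit_ivl C X1 Q" "\<And>c. c \<in> topspace (fst C) \<Longrightarrow> Q 0 c = q1 c"
      "\<And>s w. \<lbrakk>s \<in> unit_ivl; w \<in> topspace (fst W)\<rbrakk> \<Longrightarrow> Q s (i w) = p1 (N (1 - s) w)"
  obtains f' where "htpy_inverse X0 X1 f f'"
proof -
  note D0 = is_pushoutD[OF P0]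
  obtain Q' where Q': "pfam unit_ivl C X0 Q'" "\<And>c. c \<in> topspace (fst C) \<Longrightarrow> Q' 0 c = q0 c"
      "\<And>s w. \<lbrakk>s \<in> unit_ivl; w \<in> topspace (fst W)\<rbrakk> \<Longrightarrow> Q' s (i w) = p0 (N s w)"
    by (rule hep_extend[OF hep(1) D0(4) pfam_compose[OF N pmap_pfam[OF D0(3)]]]) (use N01 D0(5) in auto)
  obtain f' where f': "pmap X1 X0 f'" "\<And>z. z \<in> topspace (fst Z) \<Longrightarrow> f' (p1 z) = p0 z"
      "\<And>c. c \<in> topspace (fst C) \<Longrightarrow> f' (q1 c) = Q' 1 c"
    by (rule pushout_map[OF P1 Z D0(3) pfam_pmap[OF Q'(1), of 1]]) (use Q'(3) N01 in auto)
  have "phomotopic X0 X0 (\<lambda>x. f' (f x)) (\<lambda>x. x)"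
    by (rule collar_cancel[OF P0 P1 Z N hep(1) f Q f' Q'])
  moreover have "phomotopic X1 X1 (\<lambda>x. f (f' x)) (\<lambda>x. x)"
    by (rule collar_cancel[OF P1 P0 Z pfam_reverse[OF N] hep(2) f' Q'(1,2) _ f Q]) (simp_all add: Q'(3))
  ultimately show thesis
    using that f(1) f'(1) by (auto simp: htpy_inverse_def)
qed

text \<open>Attaching \<open>C\<close> further along \<open>\<psi>0\<close> gives \<open>X2\<close>, whose attaching map \<open>\<psi>0 \<circ> \<phi>0 \<circ> g\<close> is homotopic to
  \<open>g\<close>; hence the left inverse of \<open>\<Phi>\<close> is \<open>\<Psi>\<close> followed by a collar map. That this left inverse
  factors through \<open>\<Psi>\<close>, which has a left inverse for the same reason, is what makes it two-sided.\<close>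

lemma pushout_left_inverse:
  assumes P: "is_pushout W Z C g i X p q" and P': "is_pushout W Z' C g' i Y p' q'"
    and P2: "is_pushout W Z C g2 i X2 p2 q2"
    and Z: "pointed_space Z" "pointed_space Z'" and hep: "hep W C i X" "hep W C i X2"
    and \<phi>0: "pmap Z Z' \<phi>0" and \<psi>0: "pmap Z' Z \<psi>0" and H0: "phomotopic Z Z (\<lambda>z. \<psi>0 (\<phi>0 z)) (\<lambda>z. z)"
    and g': "\<And>w. w \<in> topspace (fst W) \<Longrightarrow> g' w = \<phi>0 (g w)"
    and g2: "\<And>w. w \<in> topspace (fst W) \<Longrightarrow> g2 w = \<psi>0 (g' w)"
    and \<Phi>: "\<And>z. z \<in> topspace (fst Z) \<Longrightarrow> \<Phi> (p z) = p' (\<phi>0 z)" "\<And>c. c \<in> topspace (fst C) \<Longrightarrow> \<Phi> (q c) = q' c"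
    and \<Psi>: "\<And>z. z \<in> topspace (fst Z') \<Longrightarrow> \<Psi> (p' z) = p2 (\<psi>0 z)" "\<And>c. c \<in> topspace (fst C) \<Longrightarrow> \<Psi> (q' c) = q2 c"
  obtains c c' where "htpy_inverse X2 X c c'" "phomotopic X X (\<lambda>x. c (\<Psi> (\<Phi> x))) (\<lambda>x. x)"
proof -
  note D = is_pushoutD[OF P]
  obtain H where H: "pfam unit_ivl Z Z H" "\<And>z. z \<in> topspace (fst Z) \<Longrightarrow> H 0 z = \<psi>0 (\<phi>0 z)"
    "\<And>z. z \<in> topspace (fst Z) \<Longrightarrow> H 1 z = z"
    using phomotopicE[OF H0 Z(1)] by blast
  have N: "pfam unit_ivl W Z (\<lambda>s w. H s (g w))"
    by (rule pfam_compose[OF pmap_pfam[OF D(1)] H(1)])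
  have gin: "g w \<in> topspace (fst Z)" if "w \<in> topspace (fst W)" for w
    using pmap_in[OF D(1) that] .
  \<comment> \<open>\<open>q\<close> is dragged along the reversed \<open>H\<close>: on
    \<open>W\<close> it starts at \<open>p \<circ> g\<close> and ends at
    \<open>p \<circ> g2\<close>, so its end induces \<open>c\<close> on \<open>X2\<close>.\<close>
  obtain Q where Q: "pfam unit_ivl C X Q" "\<And>c. c \<in> topspace (fst C) \<Longrightarrow> Q 0 c = q c"
      "\<And>s w. \<lbrakk>s \<in> unit_ivl; w \<in> topspace (fst W)\<rbrakk> \<Longrightarrow> Q s (i w) = p (H (1 - s) (g w))"
    by (rule hep_extend[OF hep(1) D(4) pfam_compose[OF pfam_reverse[OF N] pmap_pfam[OF D(3)]]])
      (use H(3) gin D(5) in auto)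
  obtain c where c: "pmap X2 X c" "\<And>z. z \<in> topspace (fst Z) \<Longrightarrow> c (p2 z) = p z"
      "\<And>d. d \<in> topspace (fst C) \<Longrightarrow> c (q2 d) = Q 1 d"
    by (rule pushout_map[OF P2 Z(1) D(3) pfam_pmap[OF Q(1), of 1]]) (use Q(3) g' g2 H(2) gin in auto)
  obtain c' where c': "htpy_inverse X2 X c c'"
    by (rule collar_htpy_inverse[OF P2 P Z(1) N _ _ hep(2,1) c Q])
      (use g' g2 H(2,3) gin in auto)
  \<comment> \<open>\<open>H\<close> on \<open>Z\<close> and \<open>Q\<close> run backwards on
    \<open>C\<close> agree on \<open>W\<close>; together they move
    \<open>c \<circ> \<Psi> \<circ> \<Phi>\<close> to the identity.\<close>
  have "phomotopic X X (\<lambda>x. c (\<Psi> (\<Phi> x))) (\<lambda>x. x)"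
  proof (rule pushout_homotopy[OF P Z(1) pfam_compose[OF H(1) pmap_pfam[OF D(3)]] pfam_reverse[OF Q(1)]])
    show "p (H 0 z) = c (\<Psi> (\<Phi> (p z))) \<and> p (H 1 z) = p z" if "z \<in> topspace (fst Z)" for z
      using that \<Phi>(1) \<Psi>(1) c(2) H(2,3) pmap_in[OF \<phi>0] pmap_in[OF \<psi>0] by simp
  qed (use Q \<Phi>(2) \<Psi>(2) c(3) in auto)
  then show thesis using that c' by blast
qed

text \<open>\<open>X2\<close> and \<open>Y2\<close> arise by attaching \<open>C\<close> after going
  back along \<open>\<psi>0\<close> and forth again along \<open>\<phi>0\<close>; they provide left
  inverses of \<open>\<Phi>\<close> and of the comparison map \<open>\<Psi>\<close>. They live in
  sum types, which accounts for the last two extension hypotheses.\<close>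

lemma pushout_htpy_inverse:
  fixes W :: "'w pointed" and Z :: "'z pointed" and Z' :: "'y pointed" and C :: "'c pointed"
  assumes P: "is_pushout W Z C g i X p q" and P': "is_pushout W Z' C g' i Y p' q'"
    and pt: "pointed_space Z" "pointed_space Z'" "pointed_space W" and inj: "inj_on i (topspace (fst W))"
    and hep: "hep W C i X" "hep W C i Y" "\<And>T :: ('z + 'c) pointed. hep W C i T" "\<And>T :: ('y + 'c) pointed. hep W C i T"
    and \<phi>0: "htpy_inverse Z Z' \<phi>0 \<psi>0"
    and g': "\<And>w. w \<in> topspace (fst W) \<Longrightarrow> g' w = \<phi>0 (g w)"
    and \<Phi>: "pmap X Y \<Phi>" "\<And>z. z \<in> topspace (fst Z) \<Longrightarrow> \<Phi> (p z) = p' (\<phi>0 z)"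
      "\<And>c. c \<in> topspace (fst C) \<Longrightarrow> \<Phi> (q c) = q' c"
  obtains \<Psi> where "htpy_inverse X Y \<Phi> \<Psi>"
proof -
  note D = is_pushoutD[OF P] and D' = is_pushoutD[OF P']
  have m: "pmap Z Z' \<phi>0" "pmap Z' Z \<psi>0" "phomotopic Z Z (\<lambda>z. \<psi>0 (\<phi>0 z)) (\<lambda>z. z)" "phomotopic Z' Z' (\<lambda>z. \<phi>0 (\<psi>0 z)) (\<lambda>z. z)"
    using \<phi>0 by (auto simp: htpy_inverse_def)
  obtain X2 :: "('z + 'c) pointed" and p2 q2 where P2: "is_pushout W Z C (\<lambda>w. \<psi>0 (g' w)) i X2 p2 q2"
    using pushout_exists_sum[OF pt(3,1) pmap_compose[OF D'(1) m(2)] D(2) inj] by blast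
  obtain Y2 :: "('y + 'c) pointed" and r2 s2 where R2: "is_pushout W Z' C (\<lambda>w. \<phi>0 (\<psi>0 (g' w))) i Y2 r2 s2"
    using pushout_exists_sum[OF pt(3,2) pmap_compose[OF pmap_compose[OF D'(1) m(2)] m(1)] D(2) inj] by blast
  note D2 = is_pushoutD[OF P2] and E2 = is_pushoutD[OF R2]
  have pX: "pointed_space X" "pointed_space Y" "pointed_space X2"
    using pushout_pointed P P' P2 pt by blast+
  obtain \<Psi> where \<Psi>: "pmap Y X2 \<Psi>" "\<And>z. z \<in> topspace (fst Z') \<Longrightarrow> \<Psi> (p' z) = p2 (\<psi>0 z)" "\<And>c. c \<in> topspace (fst C) \<Longrightarrow> \<Psi> (q' c) = q2 c"
    by (rule pushout_map[OF P' pt(2) pmap_compose[OF m(2) D2(3)] D2(4)]) (use D2(5) in auto)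
  obtain \<Psi>' where \<Psi>': "pmap X2 Y2 \<Psi>'" "\<And>z. z \<in> topspace (fst Z) \<Longrightarrow> \<Psi>' (p2 z) = r2 (\<phi>0 z)" "\<And>c. c \<in> topspace (fst C) \<Longrightarrow> \<Psi>' (q2 c) = s2 c"
    by (rule pushout_map[OF P2 pt(1) pmap_compose[OF m(1) E2(3)] E2(4)]) (use E2(5) in auto)
  obtain c c' where c: "htpy_inverse X2 X c c'" "phomotopic X X (\<lambda>x. c (\<Psi> (\<Phi> x))) (\<lambda>x. x)"
    by (rule pushout_left_inverse[OF P P' P2 pt(1,2) hep(1,3) m(1,2,3) _ _ \<Phi>(2,3) \<Psi>(2,3)]) (use g' in auto)
  obtain d d' where d: "htpy_inverse Y2 Y d d'" "phomotopic Y Y (\<lambda>x. d (\<Psi>' (\<Psi> x))) (\<lambda>x. x)"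
    by (rule pushout_left_inverse[OF P' P2 R2 pt(2,1) hep(2,4) m(2,1,4) _ _ \<Psi>(2,3) \<Psi>'(2,3)]) auto
  have cm: "pmap X2 X c" "pmap X X2 c'" "phomotopic X2 X2 (\<lambda>x. c' (c x)) (\<lambda>x. x)" and dm: "pmap Y2 Y d"
    using c(1) d(1) by (auto simp: htpy_inverse_def)
  \<comment> \<open>\<open>c \<circ> \<Psi> \<circ> \<Phi>\<close> is homotopic to the identity.
    Composing with \<open>c\<close> on the right and cancelling the equivalence \<open>c\<close> on
    the left makes \<open>\<Phi> \<circ> c\<close> a right inverse of \<open>\<Psi>\<close>.\<close>
  let ?u = "\<lambda>x. \<Psi> (\<Phi> (c x))"
  have u: "pmap X2 X2 ?u"
    by (rule pmap_compose[OF pmap_compose[OF cm(1) \<Phi>(1)] \<Psi>(1)])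
  have "phomotopic X2 X2 (\<lambda>x. c' (c (?u x))) ?u"
    using phomotopic_compose_right[OF cm(3) u pX(3)] .
  moreover have "phomotopic X2 X2 (\<lambda>x. c' (c (?u x))) (\<lambda>x. c' (c x))"
    by (rule phomotopic_compose_left[OF phomotopic_compose_right[OF c(2) cm(1) pX(3)] cm(2) pX(3)])
  ultimately have "phomotopic X2 X2 ?u (\<lambda>x. x)"
    using cm(3) by (meson phomotopic_sym phomotopic_trans)
  \<comment> \<open>\<open>\<Psi>\<close> also has the left inverse
    \<open>d \<circ> \<Psi>'\<close>, hence its right inverse is two-sided.\<close>
  then have "htpy_inverse Y X2 \<Psi> (\<lambda>x. \<Phi> (c x))"
    by (rule htpy_inverse_two_sided(2)[OF \<Psi>(1) pmap_compose[OF \<Psi>'(1) dm] pmap_compose[OF cm(1) \<Phi>(1)] pX(2,3) d(2)])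
  then have "phomotopic Y Y (\<lambda>y. \<Phi> (c (\<Psi> y))) (\<lambda>y. y)"
    by (simp add: htpy_inverse_def)
  then have "htpy_inverse X Y \<Phi> (\<lambda>y. c (\<Psi> y))"
    using c(2) \<Phi>(1) pmap_compose[OF \<Psi>(1) cm(1)] by (simp add: htpy_inverse_def)
  then show thesis using that by blast
qed

section \<open>Contractible spaces and change of the attached space\<close>

definition pcontractible :: "'a pointed \<Rightarrow> bool" where
  "pcontractible X \<longleftrightarrow> phomotopic X X (\<lambda>_. snd X) (\<lambda>x. x)"

lemma pcontractible_htpy_inverse:
  assumes "htpy_inverse X Y f g" "pcontractible X" "pointed_space X" "pointed_space Y"
  shows "pcontractible Y"
proof -
  have m: "pmap X Y f" "pmap Y X g" "phomotopic Y Y (\<lambda>y. f (g y)) (\<lambda>y. y)"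
    using assms by (auto simp: htpy_inverse_def)
  have "phomotopic Y Y (\<lambda>y. f (snd X)) (\<lambda>y. f (g y))"
    using phomotopic_compose_left[OF phomotopic_compose_right[OF assms(2)[unfolded pcontractible_def] m(2) assms(4)] m(1) assms(4)] .
  from phomotopic_trans[OF this m(3)] show ?thesis
    by (simp add: pcontractible_def pmap_base[OF m(1)])
qed

text \<open>The contraction composed with \<open>u\<close> and with \<open>v\<close> gives two
  families that start at the constant map and agree on \<open>W\<close>;
  \<open>hep_rel_homotopy\<close> compares their ends.\<close>

lemma contractible_rel_homotopy:
  assumes hep: "hep W C i T" and T: "pcontractible T" "pointed_space T"
    and u: "pmap C T u" and v: "pmap C T v"
    and eq: "\<And>w. w \<in> topspace (fst W) \<Longrightarrow> u (i w) = v (i w)"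
  obtains K where "pfam unit_ivl C T K"
    "\<And>c. c \<in> topspace (fst C) \<Longrightarrow> K 0 c = u c" "\<And>c. c \<in> topspace (fst C) \<Longrightarrow> K 1 c = v c"
    "\<And>s w. \<lbrakk>s \<in> unit_ivl; w \<in> topspace (fst W)\<rbrakk> \<Longrightarrow> K s (i w) = u (i w)"
proof -
  obtain H where H: "pfam unit_ivl T T H" "\<And>x. x \<in> topspace (fst T) \<Longrightarrow> H 0 x = snd T"
    "\<And>x. x \<in> topspace (fst T) \<Longrightarrow> H 1 x = x"
    using phomotopicE[OF T(1)[unfolded pcontractible_def] T(2)] by blast
  have i: "pmap W C i" using hep by (simp add: hep_def)
  have "H 0 (u c) = H 0 (v c)" if "c \<in> topspace (fst C)" for c
    using H(2) pmap_in[OF u that] pmap_in[OF v that] by simp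
  then obtain K where K: "pfam unit_ivl C T K"
    "\<And>c. c \<in> topspace (fst C) \<Longrightarrow> K 0 c = H 1 (u c)" "\<And>c. c \<in> topspace (fst C) \<Longrightarrow> K 1 c = H 1 (v c)"
    "\<And>s w. \<lbrakk>s \<in> unit_ivl; w \<in> topspace (fst W)\<rbrakk> \<Longrightarrow> K s (i w) = H 1 (u (i w))"
    using hep_rel_homotopy[OF hep pfam_compose[OF pmap_pfam[OF u] H(1)] pfam_compose[OF pmap_pfam[OF v] H(1)]] eq
    by metis
  show thesis
    by (rule that[OF K(1)]) (use K H(3) pmap_in[OF u] pmap_in[OF v] pmap_in[OF i] in auto)
qed

text \<open>The pushout \<open>P\<close> of \<open>W \<leftarrow> V \<rightarrow> D\<close> is contractible, like \<open>C\<close>. Maps from \<open>P\<close> and \<open>C\<close> to contractible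
  spaces that agree on \<open>W\<close> are homotopic relative to \<open>W\<close>, so \<open>P\<close> and \<open>C\<close> are homotopy equivalent
  under \<open>W\<close>, and this equivalence can be pushed out along \<open>g\<close>.\<close>

lemma cell_replacement:
  fixes W :: "'w pointed" and V :: "'v pointed" and C :: "'c pointed" and D :: "'d pointed"
  assumes b: "htpy_inverse V W b a" and pt: "pointed_space V" "pointed_space W" "pointed_space Z"
    and i: "pmap W C i" and k: "pmap V D k" "inj_on k (topspace (fst V))"
    and contr: "pcontractible C" "pcontractible D"
    and b': "pmap D C b'" "\<And>v. v \<in> topspace (fst V) \<Longrightarrow> b' (k v) = i (b v)"
    and hepk: "hep V D k D" "\<And>T :: ('w + 'd) pointed. hep V D k T" "\<And>T :: ('v + 'd) pointed. hep V D k T"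
    and hepi: "hep W C i C" "\<And>T :: ('w + 'd) pointed. hep W C i T"
    and PX: "is_pushout W Z C g i X p q" and PY: "is_pushout V Z D g' k Y p' q'"
    and g': "\<And>v. v \<in> topspace (fst V) \<Longrightarrow> g' v = g (b v)"
    and F: "pmap Y X F" "\<And>z. z \<in> topspace (fst Z) \<Longrightarrow> F (p' z) = p z" "\<And>d. d \<in> topspace (fst D) \<Longrightarrow> F (q' d) = q (b' d)"
  obtains G where "htpy_inverse Y X F G" "\<And>z. z \<in> topspace (fst Z) \<Longrightarrow> G (p z) = p' z"
proof -
  note DX = is_pushoutD[OF PX] and DY = is_pushoutD[OF PY]
  have bm: "pmap V W b" using b by (simp add: htpy_inverse_def)
  have ptC: "pointed_space C" "pointed_space D" using pmap_pointed i k(1) pt by blast+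
  obtain P :: "('w + 'd) pointed" and pP qP where P: "is_pushout V W D b k P pP qP"
    using pushout_exists_sum[OF pt(1,2) bm k] by blast
  note DP = is_pushoutD[OF P]
  have ptP: "pointed_space P" by (rule pushout_pointed[OF P pt(2)])
  \<comment> \<open>\<open>D\<close> is the pushout along the identity of \<open>V\<close> and
    \<open>P\<close> the pushout along \<open>b\<close>, so changing the base along the equivalence
    \<open>b\<close> makes them equivalent.\<close>
  obtain e where "htpy_inverse D P qP e"
    by (rule pushout_htpy_inverse[OF is_pushout_id[OF k] P pt(1,2,1) k(2) hepk(1,2,3,2) b _ DP(4)])
      (use DP(5) in auto)
  then have contrP: "pcontractible P"
    using pcontractible_htpy_inverse contr(2) ptC(2) ptP by blast
  obtain f where f: "pmap P C f" "\<And>w. w \<in> topspace (fst W) \<Longrightarrow> f (pP w) = i w" "\<And>d. d \<in> topspace (fst D) \<Longrightarrow> f (qP d) = b' d"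
    by (rule pushout_map[OF P pt(2) i b'(1)]) (use b'(2) in auto)
  obtain K where K: "pfam unit_ivl P P K" "\<And>x. x \<in> topspace (fst P) \<Longrightarrow> K 0 x = snd P"
    "\<And>x. x \<in> topspace (fst P) \<Longrightarrow> K 1 x = x"
    using phomotopicE[OF contrP[unfolded pcontractible_def] ptP] by blast
  have pPin: "pP w \<in> topspace (fst P)" if "w \<in> topspace (fst W)" for w
    using pmap_in[OF DP(3) that] .
  \<comment> \<open>A map from \<open>C\<close> to \<open>P\<close> under \<open>W\<close> comes
    from a contraction of \<open>P\<close>: start at the constant map and follow the contraction
    until it restores \<open>pP\<close> on \<open>W\<close>.\<close>
  obtain E where E: "pfam unit_ivl C P E" "\<And>c. c \<in> topspace (fst C) \<Longrightarrow> E 0 c = snd P"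
    "\<And>r w. \<lbrakk>r \<in> unit_ivl; w \<in> topspace (fst W)\<rbrakk> \<Longrightarrow> E r (i w) = K r (pP w)"
    by (rule hep_extend[OF hepi(2) pmap_const[OF ptP] pfam_compose[OF pmap_pfam[OF DP(3)] K(1)]])
      (use K(2) pPin in auto)
  define \<theta> where "\<theta> = E 1"
  have \<theta>: "pmap C P \<theta>" "\<And>w. w \<in> topspace (fst W) \<Longrightarrow> \<theta> (i w) = pP w"
    using pfam_pmap[OF E(1), of 1] E(3)[of 1] K(3) pPin by (auto simp: \<theta>_def)
  obtain \<kappa> where \<kappa>: "pfam unit_ivl P P \<kappa>" "\<And>x. x \<in> topspace (fst P) \<Longrightarrow> \<kappa> 0 x = \<theta> (f x)"
    "\<And>x. x \<in> topspace (fst P) \<Longrightarrow> \<kappa> 1 x = x"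
    "\<And>s w. \<lbrakk>s \<in> unit_ivl; w \<in> topspace (fst W)\<rbrakk> \<Longrightarrow> \<kappa> s (pP w) = \<theta> (f (pP w))"
    by (rule contractible_rel_homotopy[OF hep_pushout[OF P pt(2) hepk(2)] contrP ptP pmap_compose[OF f(1) \<theta>(1)] pmap_id])
      (use f(2) \<theta>(2) in auto)
  obtain \<mu> where \<mu>: "pfam unit_ivl C C \<mu>" "\<And>x. x \<in> topspace (fst C) \<Longrightarrow> \<mu> 0 x = f (\<theta> x)"
    "\<And>x. x \<in> topspace (fst C) \<Longrightarrow> \<mu> 1 x = x"
    "\<And>s w. \<lbrakk>s \<in> unit_ivl; w \<in> topspace (fst W)\<rbrakk> \<Longrightarrow> \<mu> s (i w) = f (\<theta> (i w))"
    by (rule contractible_rel_homotopy[OF hepi(1) contr(1) ptC(1) pmap_compose[OF \<theta>(1) f(1)] pmap_id])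
      (use f(2) \<theta>(2) in auto)
  \<comment> \<open>\<open>m\<close> exhibits \<open>Y\<close> as \<open>P\<close> attached to
    \<open>Z\<close> along \<open>g\<close>; through it the equivalence of \<open>P\<close> and
    \<open>C\<close> under \<open>W\<close> is carried over to \<open>Y\<close> and
    \<open>X\<close>.\<close>
  obtain m where m: "pmap P Y m" "\<And>w. w \<in> topspace (fst W) \<Longrightarrow> m (pP w) = p' (g w)" "\<And>d. d \<in> topspace (fst D) \<Longrightarrow> m (qP d) = q' d"
    by (rule pushout_map[OF P pt(2) pmap_compose[OF DX(1) DY(3)] DY(4)]) (use DY(5) g' in auto)
  obtain G where G: "pmap X Y G" "\<And>z. z \<in> topspace (fst Z) \<Longrightarrow> G (p z) = p' z" "\<And>c. c \<in> topspace (fst C) \<Longrightarrow> G (q c) = m (\<theta> c)"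
    by (rule pushout_map[OF PX pt(3) DY(3) pmap_compose[OF \<theta>(1) m(1)]]) (use \<theta>(2) m(2) in auto)
  have GF: "phomotopic Y Y (\<lambda>y. G (F y)) (\<lambda>y. y)"
  proof (rule pushout_homotopy[OF PY pt(3) pmap_pfam[OF DY(3)]
        pfam_compose[OF pfam_compose[OF pmap_pfam[OF DP(4)] \<kappa>(1)] pmap_pfam[OF m(1)]]])
    show "p' (g' v) = m (\<kappa> s (qP (k v)))" if "s \<in> unit_ivl" "v \<in> topspace (fst V)" for s v
      using that DP(5)[symmetric] \<kappa>(4) f(2) \<theta>(2) m(2) g' pmap_in[OF bm] by simp
    show "m (\<kappa> 0 (qP d)) = G (F (q' d)) \<and> m (\<kappa> 1 (qP d)) = q' d" if "d \<in> topspace (fst D)" for d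
      using that \<kappa>(2,3) pmap_in[OF DP(4)] f(3) F(3) G(3) m(3) pmap_in[OF b'(1)] by simp
  qed (use F G in auto)
  \<comment> \<open>\<open>F\<close> corresponds to \<open>f\<close> under \<open>m\<close> and
    \<open>q\<close>, which identifies \<open>F \<circ> G\<close> on the part coming from
    \<open>C\<close>.\<close>
  have Fm: "F (m x) = q (f x)" if x: "x \<in> topspace (fst P)" for x
  proof -
    have "F (m (pP w)) = q (f (pP w))" if "w \<in> topspace (fst W)" for w
      using m(2)[OF that] f(2)[OF that] F(2)[OF pmap_in[OF DX(1) that]] DX(5)[OF that] by simp
    moreover have "F (m (qP d)) = q (f (qP d))" if "d \<in> topspace (fst D)" for d
      using m(3)[OF that] f(3)[OF that] F(3)[OF that] by simp
    ultimately show ?thesis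
      using pushout_cases[OF P x] by metis
  qed
  have FG: "phomotopic X X (\<lambda>x. F (G x)) (\<lambda>x. x)"
  proof (rule pushout_homotopy[OF PX pt(3) pmap_pfam[OF DX(3)] pfam_compose[OF \<mu>(1) pmap_pfam[OF DX(4)]]])
    show "p (g w) = q (\<mu> s (i w))" if "s \<in> unit_ivl" "w \<in> topspace (fst W)" for s w
      using that \<mu>(4) f(2) \<theta>(2) DX(5) by simp
    show "q (\<mu> 0 c) = F (G (q c)) \<and> q (\<mu> 1 c) = q c" if "c \<in> topspace (fst C)" for c
      using that \<mu>(2,3) G(3) Fm pmap_in[OF \<theta>(1)] by simp
  qed (use F G in auto)
  have "htpy_inverse Y X F G"
    unfolding htpy_inverse_def using F(1) G(1) GF FG by blast
  then show thesis
    using G(2) by (rule that)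
qed

section \<open>Homotopy equivalences of sequential colimits\<close>

text \<open>Both the inverse and the homotopy are extended strictly, so that iterating the lemma along a sequence
  gives a left inverse on the colimit.\<close>

lemma extend_htpy_inverse:
  assumes hepi: "hep A X i X" and hepj: "hep B Y j X"
    and pt: "pointed_space A" "pointed_space B" "pointed_space X" "pointed_space Y"
    and f: "htpy_inverse X Y f g1" and f0: "htpy_inverse A B f0 g0"
    and comm: "\<And>a. a \<in> topspace (fst A) \<Longrightarrow> f (i a) = j (f0 a)"
    and H0: "pfam unit_ivl A A H0" "\<And>a. a \<in> topspace (fst A) \<Longrightarrow> H0 0 a = g0 (f0 a)"
      "\<And>a. a \<in> topspace (fst A) \<Longrightarrow> H0 1 a = a"
  obtains g H where "htpy_inverse X Y f g" "\<And>b. b \<in> topspace (fst B) \<Longrightarrow> g (j b) = i (g0 b)"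
    "pfam unit_ivl X X H" "\<And>x. x \<in> topspace (fst X) \<Longrightarrow> H 0 x = g (f x)"
    "\<And>x. x \<in> topspace (fst X) \<Longrightarrow> H 1 x = x"
    "\<And>s a. \<lbrakk>s \<in> unit_ivl; a \<in> topspace (fst A)\<rbrakk> \<Longrightarrow> H s (i a) = i (H0 s a)"
proof -
  have i: "pmap A X i" and j: "pmap B Y j" using hepi hepj by (auto simp: hep_def)
  have fm: "pmap X Y f" "pmap Y X g1" "phomotopic X X (\<lambda>x. g1 (f x)) (\<lambda>x. x)"
    and f0m: "pmap A B f0" "pmap B A g0" "phomotopic B B (\<lambda>x. f0 (g0 x)) (\<lambda>x. x)"
    using f f0 by (auto simp: htpy_inverse_def)
  have "phomotopic B X (\<lambda>b. g1 (j (f0 (g0 b)))) (\<lambda>b. g1 (j b))"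
    by (rule phomotopic_compose_left[OF f0m(3) pmap_compose[OF j fm(2)] pt(2)])
  moreover have "phomotopic B X (\<lambda>b. g1 (j (f0 (g0 b)))) (\<lambda>b. i (g0 b))"
    by (rule phomotopic_cong[OF phomotopic_compose_right[OF fm(3) pmap_compose[OF f0m(2) i] pt(2)] pt(2)])
      (use comm pmap_in[OF f0m(2)] in auto)
  ultimately have "phomotopic B X (\<lambda>b. g1 (j b)) (\<lambda>b. i (g0 b))"
    by (meson phomotopic_sym phomotopic_trans)
  then obtain N where N: "pfam unit_ivl B X N" "\<And>b. b \<in> topspace (fst B) \<Longrightarrow> N 0 b = g1 (j b)"
    "\<And>b. b \<in> topspace (fst B) \<Longrightarrow> N 1 b = i (g0 b)"
    using phomotopicE[OF _ pt(2)] by blast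
  \<comment> \<open>\<open>g1\<close> is moved along an extension of \<open>N\<close> to a map
    \<open>g2\<close> that restricts strictly to \<open>i \<circ> g0\<close>.\<close>
  obtain M where M: "pfam unit_ivl Y X M" "\<And>y. y \<in> topspace (fst Y) \<Longrightarrow> M 0 y = g1 y"
    "\<And>r b. \<lbrakk>r \<in> unit_ivl; b \<in> topspace (fst B)\<rbrakk> \<Longrightarrow> M r (j b) = N r b"
    using hep_extend[OF hepj fm(2) N(1,2)] by blast
  define g2 where "g2 = M 1"
  have g2: "pmap Y X g2" "\<And>b. b \<in> topspace (fst B) \<Longrightarrow> g2 (j b) = i (g0 b)"
    using pfam_pmap[OF M(1), of 1] M(3)[of 1] N(3) by (auto simp: g2_def)
  have "phomotopic X X (\<lambda>x. g1 (f x)) (\<lambda>x. g2 (f x))"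
    by (rule phomotopicI[OF pfam_compose[OF pmap_pfam[OF fm(1)] M(1)] pt(3)])
      (use M(2) pmap_in[OF fm(1)] in \<open>auto simp: g2_def\<close>)
  then have g2f: "phomotopic X X (\<lambda>x. g2 (f x)) (\<lambda>x. x)"
    using fm(3) by (meson phomotopic_sym phomotopic_trans)
  have iH0: "pfam unit_ivl A X (\<lambda>s a. i (H0 s a))"
    by (rule pfam_compose[OF H0(1) pmap_pfam[OF i]])
  \<comment> \<open>Extending \<open>i \<circ> H0\<close> from \<open>g2 \<circ> f\<close> ends in a
    map \<open>e\<close> that fixes the image of \<open>i\<close> but is only homotopic to the
    identity.\<close>
  obtain P where P: "pfam unit_ivl X X P" "\<And>x. x \<in> topspace (fst X) \<Longrightarrow> P 0 x = g2 (f x)"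
    "\<And>r a. \<lbrakk>r \<in> unit_ivl; a \<in> topspace (fst A)\<rbrakk> \<Longrightarrow> P r (i a) = i (H0 r a)"
    by (rule hep_extend[OF hepi pmap_compose[OF fm(1) g2(1)] iH0])
      (use H0(2) g2(2) comm pmap_in[OF f0m(1)] in auto)
  define e where "e = P 1"
  have e: "pmap X X e" "\<And>a. a \<in> topspace (fst A) \<Longrightarrow> e (i a) = i a"
    using pfam_pmap[OF P(1), of 1] P(3)[of 1] H0(3) by (auto simp: e_def)
  have "phomotopic X X (\<lambda>x. g2 (f x)) e"
    by (rule phomotopicI[OF P(1) pt(3)]) (simp_all add: P(2) e_def)
  then have "phomotopic X X e (\<lambda>x. x)"
    using g2f by (meson phomotopic_sym phomotopic_trans)
  then obtain F where F: "pfam unit_ivl X X F" "\<And>x. x \<in> topspace (fst X) \<Longrightarrow> F 0 x = e x"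
    "\<And>x. x \<in> topspace (fst X) \<Longrightarrow> F 1 x = x"
    using phomotopicE[OF _ pt(3)] by blast
  \<comment> \<open>On \<open>A\<close> the homotopy \<open>F\<close> from \<open>e\<close> to the
    identity is a loop. Letting the identity follow this loop leads to \<open>e1\<close>. Then
    \<open>G \<circ> e\<close> and \<open>F\<close> have the same start and the same restriction to
    \<open>A\<close>, so \<open>e1 \<circ> e\<close> is homotopic to the identity relative to
    \<open>A\<close>.\<close>
  obtain G where G: "pfam unit_ivl X X G" "\<And>x. x \<in> topspace (fst X) \<Longrightarrow> G 0 x = x"
    "\<And>r a. \<lbrakk>r \<in> unit_ivl; a \<in> topspace (fst A)\<rbrakk> \<Longrightarrow> G r (i a) = F r (i a)"
    by (rule hep_extend[OF hepi pmap_id pfam_compose[OF pmap_pfam[OF i] F(1)]])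
      (use F(2) e(2) pmap_in[OF i] in auto)
  define e1 where "e1 = G 1"
  have e1: "pmap X X e1" "\<And>a. a \<in> topspace (fst A) \<Longrightarrow> e1 (i a) = i a"
    using pfam_pmap[OF G(1), of 1] G(3)[of 1] F(3) pmap_in[OF i] by (auto simp: e1_def)
  have "G 0 (e x) = F 0 x" if "x \<in> topspace (fst X)" for x
    using that G(2) F(2) pmap_in[OF e(1)] by simp
  moreover have "G s (e (i a)) = F s (i a)" if "s \<in> unit_ivl" "a \<in> topspace (fst A)" for s a
    using that G(3) e(2) by simp
  ultimately obtain K where K: "pfam unit_ivl X X K"
    "\<And>x. x \<in> topspace (fst X) \<Longrightarrow> K 0 x = G 1 (e x)" "\<And>x. x \<in> topspace (fst X) \<Longrightarrow> K 1 x = F 1 x"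
    "\<And>s a. \<lbrakk>s \<in> unit_ivl; a \<in> topspace (fst A)\<rbrakk> \<Longrightarrow> K s (i a) = G 1 (e (i a))"
    using hep_rel_homotopy[OF hepi pfam_compose[OF pmap_pfam[OF e(1)] G(1)] F(1)] by blast
  \<comment> \<open>\<open>e1 \<circ> P\<close> followed by \<open>K\<close> joins
    \<open>e1 \<circ> g2 \<circ> f\<close> to the identity. On \<open>A\<close> it runs through
    \<open>H0\<close> at double speed and then rests; \<open>hep_reparam\<close> turns
    \<open>min 1 (2 * s)\<close> into \<open>s\<close>.\<close>
  let ?\<Phi> = "\<lambda>s. if s \<le> 1/2 then (\<lambda>x. e1 (P (min 1 (2 * s)) x)) else K (max 0 (2 * s - 1))"
  have \<Phi>: "pfam unit_ivl X X ?\<Phi>"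
    by (rule pfam_concat[OF pfam_compose[OF P(1) pmap_pfam[OF e1(1)]] K(1)])
      (simp add: K(2) e_def e1_def)
  have on_A: "?\<Phi> s (i a) = i (H0 (min 1 (2 * s)) a)" if "s \<in> unit_ivl" "a \<in> topspace (fst A)" for s a
  proof (cases "s \<le> 1/2")
    case True
    then have "min 1 (2 * s) \<in> unit_ivl" using that by auto
    then show ?thesis
      using True that P(3) e1(2) pfam_in[OF H0(1)] by simp
  next
    case False
    then have "max 0 (2 * s - 1) \<in> unit_ivl" "min 1 (2 * s) = 1" using that by auto
    then show ?thesis
      using False that K(4) e(2) e1(2) H0(3) by (simp add: e1_def)
  qed
  obtain H where H: "pfam unit_ivl X X H"
    "\<And>x. x \<in> topspace (fst X) \<Longrightarrow> H 0 x = ?\<Phi> 0 x" "\<And>x. x \<in> topspace (fst X) \<Longrightarrow> H 1 x = ?\<Phi> 1 x"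
    "\<And>s a. \<lbrakk>s \<in> unit_ivl; a \<in> topspace (fst A)\<rbrakk> \<Longrightarrow> H s (i a) = i (H0 s a)"
    by (rule hep_reparam[OF hepi \<Phi> iH0, of "\<lambda>s. min 1 (2 * s)" "\<lambda>s. s"])
      (use on_A in \<open>auto intro!: continuous_intros\<close>)
  have H01: "H 0 x = e1 (g2 (f x))" "H 1 x = x" if "x \<in> topspace (fst X)" for x
    using H(2,3)[OF that] P(2)[OF that] K(3)[OF that] F(3)[OF that] by simp_all
  have "phomotopic X X (\<lambda>x. e1 (g2 (f x))) (\<lambda>x. x)"
    by (rule phomotopicI[OF H(1) pt(3)]) (simp_all add: H01)
  then have "htpy_inverse X Y f (\<lambda>y. e1 (g2 y))"
    by (rule htpy_inverse_unique[OF f pmap_compose[OF g2(1) e1(1)] pt(3,4)])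
  then show thesis
    by (rule that[OF _ _ H(1) H01 H(4)]) (use g2(2) e1(2) pmap_in[OF f0m(2)] in auto)
qed

lemma colimit_map:
  assumes "is_seq_colimit S f X \<iota>" "pointed_space (S 0)" "\<And>n. pmap (S n) T (h n)"
    and "\<And>n x. x \<in> topspace (fst (S n)) \<Longrightarrow> h (Suc n) (f n x) = h n x"
  obtains r where "pmap X T r" "\<And>n x. x \<in> topspace (fst (S n)) \<Longrightarrow> r (\<iota> n x) = h n x"
proof -
  have "\<exists>r. pmap X T r \<and> (\<forall>n. \<forall>x \<in> topspace (fst (S n)). r (\<iota> n x) = h n x)"
    by (rule is_seq_colimit_universal[OF assms(1-3)]) (rule assms(4))
  then show thesis using that by blast
qed

text \<open>Dependent choice yields inverses and homotopies that commute strictly with the stage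
  maps, so both pass to the colimit. The conclusion also hands out the \<open>\<psi> n\<close>, to
  which the lemma can be applied once more.\<close>

lemma colimit_left_inverse:
  fixes S :: "nat \<Rightarrow> 'x pointed" and S' :: "nat \<Rightarrow> 'y pointed"
  assumes X: "is_seq_colimit S f X \<iota>" and Y: "is_seq_colimit S' f' Y \<iota>'"
    and pt: "\<And>n. pointed_space (S n)" "\<And>n. pointed_space (S' n)"
    and hep: "\<And>n (T :: 'x pointed). hep (S n) (S (Suc n)) (f n) T"
      "\<And>n (T :: 'x pointed). hep (S' n) (S' (Suc n)) (f' n) T"
    and he: "\<And>n. \<exists>g. htpy_inverse (S n) (S' n) (\<phi> n) g"
    and comm: "\<And>n x. x \<in> topspace (fst (S n)) \<Longrightarrow> \<phi> (Suc n) (f n x) = f' n (\<phi> n x)"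
    and \<Phi>: "\<And>n x. x \<in> topspace (fst (S n)) \<Longrightarrow> \<Phi> (\<iota> n x) = \<iota>' n (\<phi> n x)"
  shows "\<exists>\<psi> \<Psi>. (\<forall>n. htpy_inverse (S' n) (S n) (\<psi> n) (\<phi> n)) \<and>
    (\<forall>n. \<forall>y \<in> topspace (fst (S' n)). \<psi> (Suc n) (f' n y) = f n (\<psi> n y)) \<and>
    pmap Y X \<Psi> \<and> (\<forall>n. \<forall>y \<in> topspace (fst (S' n)). \<Psi> (\<iota>' n y) = \<iota> n (\<psi> n y)) \<and>
    phomotopic X X (\<lambda>x. \<Psi> (\<Phi> x)) (\<lambda>x. x)"
proof -
  note DX = is_seq_colimitD[OF X] and DY = is_seq_colimitD[OF Y]
  define good where "good n = (\<lambda>(g, H). htpy_inverse (S n) (S' n) (\<phi> n) g \<and> pfam unit_ivl (S n) (S n) H \<and>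
      (\<forall>x \<in> topspace (fst (S n)). H 0 x = g (\<phi> n x) \<and> H 1 x = x))" for n
  have "\<exists>gH. \<forall>n. good n (gH n) \<and>
      ((\<forall>y \<in> topspace (fst (S' n)). fst (gH (Suc n)) (f' n y) = f n (fst (gH n) y)) \<and>
       (\<forall>s \<in> unit_ivl. \<forall>x \<in> topspace (fst (S n)). snd (gH (Suc n)) s (f n x) = f n (snd (gH n) s x)))"
  proof (rule dependent_nat_choice)
    obtain g where g: "htpy_inverse (S 0) (S' 0) (\<phi> 0) g" using he by blast
    then obtain H where "pfam unit_ivl (S 0) (S 0) H" "\<And>x. x \<in> topspace (fst (S 0)) \<Longrightarrow> H 0 x = g (\<phi> 0 x)"
      "\<And>x. x \<in> topspace (fst (S 0)) \<Longrightarrow> H 1 x = x"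
      unfolding htpy_inverse_def using phomotopicE[OF _ pt(1)] by blast
    with g show "\<exists>gH. good 0 gH"
      by (intro exI[of _ "(g, H)"]) (simp add: good_def)
  next
    fix gH n assume gH: "good n gH"
    obtain g H where gH_eq: "gH = (g, H)" by (cases gH)
    have g: "htpy_inverse (S n) (S' n) (\<phi> n) g" "pfam unit_ivl (S n) (S n) H"
      "\<And>x. x \<in> topspace (fst (S n)) \<Longrightarrow> H 0 x = g (\<phi> n x)" "\<And>x. x \<in> topspace (fst (S n)) \<Longrightarrow> H 1 x = x"
      using gH by (auto simp: good_def gH_eq)
    obtain g1 where g1: "htpy_inverse (S (Suc n)) (S' (Suc n)) (\<phi> (Suc n)) g1" using he by blast
    obtain g' H' where "htpy_inverse (S (Suc n)) (S' (Suc n)) (\<phi> (Suc n)) g'"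
      "\<And>y. y \<in> topspace (fst (S' n)) \<Longrightarrow> g' (f' n y) = f n (g y)"
      "pfam unit_ivl (S (Suc n)) (S (Suc n)) H'"
      "\<And>x. x \<in> topspace (fst (S (Suc n))) \<Longrightarrow> H' 0 x = g' (\<phi> (Suc n) x)"
      "\<And>x. x \<in> topspace (fst (S (Suc n))) \<Longrightarrow> H' 1 x = x"
      "\<And>s x. \<lbrakk>s \<in> unit_ivl; x \<in> topspace (fst (S n))\<rbrakk> \<Longrightarrow> H' s (f n x) = f n (H s x)"
      using extend_htpy_inverse[OF hep(1) hep(2) pt(1,2,1,2) g1 g(1) comm g(2-4)] by blast
    then show "\<exists>gH'. good (Suc n) gH' \<and>
      ((\<forall>y \<in> topspace (fst (S' n)). fst gH' (f' n y) = f n (fst gH y)) \<and>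
       (\<forall>s \<in> unit_ivl. \<forall>x \<in> topspace (fst (S n)). snd gH' s (f n x) = f n (snd gH s x)))"
      by (intro exI[of _ "(g', H')"]) (simp add: good_def gH_eq)
  qed
  then obtain gH where gH: "\<And>n. good n (gH n)"
      "\<And>n y. y \<in> topspace (fst (S' n)) \<Longrightarrow> fst (gH (Suc n)) (f' n y) = f n (fst (gH n) y)"
      "\<And>n s x. \<lbrakk>s \<in> unit_ivl; x \<in> topspace (fst (S n))\<rbrakk> \<Longrightarrow> snd (gH (Suc n)) s (f n x) = f n (snd (gH n) s x)"
    by blast
  define \<psi> where "\<psi> n = fst (gH n)" for n
  define H where "H n = snd (gH n)" for n
  have \<psi>: "htpy_inverse (S n) (S' n) (\<phi> n) (\<psi> n)" "pmap (S' n) (S n) (\<psi> n)" "pmap (S n) (S' n) (\<phi> n)"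
    and H: "pfam unit_ivl (S n) (S n) (H n)"
      "\<And>x. x \<in> topspace (fst (S n)) \<Longrightarrow> H n 0 x = \<psi> n (\<phi> n x)" "\<And>x. x \<in> topspace (fst (S n)) \<Longrightarrow> H n 1 x = x" for n
    using gH(1)[of n] by (auto simp: good_def \<psi>_def H_def htpy_inverse_def case_prod_unfold)
  have \<psi>f: "\<psi> (Suc n) (f' n y) = f n (\<psi> n y)" if "y \<in> topspace (fst (S' n))" for n y
    using gH(2)[OF that] by (simp add: \<psi>_def)
  have "\<iota> (Suc n) (\<psi> (Suc n) (f' n y)) = \<iota> n (\<psi> n y)" if "y \<in> topspace (fst (S' n))" for n y
    using that \<psi>f DX(3) pmap_in[OF \<psi>(2)] by simp
  then obtain \<Psi> where \<Psi>: "pmap Y X \<Psi>" "\<And>n y. y \<in> topspace (fst (S' n)) \<Longrightarrow> \<Psi> (\<iota>' n y) = \<iota> n (\<psi> n y)"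
    using colimit_map[OF Y pt(2) pmap_compose[OF \<psi>(2) DX(2)]] by blast
  have "\<iota> (Suc n) (H (Suc n) s (f n x)) = \<iota> n (H n s x)" if "s \<in> unit_ivl" "x \<in> topspace (fst (S n))" for s n x
    using that gH(3) DX(3) pfam_in[OF H(1)] by (simp add: H_def)
  then obtain R where R: "pfam unit_ivl X X R"
    "\<And>s n x. \<lbrakk>s \<in> unit_ivl; x \<in> topspace (fst (S n))\<rbrakk> \<Longrightarrow> R s (\<iota> n x) = \<iota> n (H n s x)"
    using colimit_pfam[OF X pt(1) compact_Icc pfam_compose[OF H(1) pmap_pfam[OF DX(2)]]] by blast
  have R01: "R 0 x = \<Psi> (\<Phi> x)" "R 1 x = x" if "x \<in> topspace (fst X)" for x
  proof -
    obtain n y where y: "y \<in> topspace (fst (S n))" "x = \<iota> n y" using colimit_cases[OF X \<open>x \<in> _\<close>] .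
    then show "R 0 x = \<Psi> (\<Phi> x)" "R 1 x = x"
      using R(2)[of 0 y n] R(2)[of 1 y n] H(2,3) \<Phi> \<Psi>(2) pmap_in[OF \<psi>(3)] by auto
  qed
  have ptX: "pointed_space X" using pmap_pointed DX(2) pt(1) by blast
  have "phomotopic X X (\<lambda>x. \<Psi> (\<Phi> x)) (\<lambda>x. x)"
    by (rule phomotopicI[OF R(1) ptX]) (simp_all add: R01)
  then show ?thesis
    using \<psi>(1) \<psi>f \<Psi>
    by (intro exI[of _ \<psi>] exI[of _ \<Psi>]) (simp add: htpy_inverse_sym[of "S' _"])
qed

text \<open>The left inverse \<open>\<Psi>\<close> of \<open>\<Phi>\<close> is itself induced by
  equivalences of the stages, so it has a left inverse \<open>\<xi>\<close>. With
  \<open>\<xi>\<close> on one side and \<open>\<Phi>\<close> on the other, \<open>\<Psi>\<close> is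
  an equivalence with inverse \<open>\<Phi>\<close>.\<close>

lemma colimit_htpy_inverse:
  fixes S :: "nat \<Rightarrow> 'x pointed" and S' :: "nat \<Rightarrow> 'y pointed"
  assumes X: "is_seq_colimit S f X \<iota>" and Y: "is_seq_colimit S' f' Y \<iota>'"
    and pt: "\<And>n. pointed_space (S n)" "\<And>n. pointed_space (S' n)"
    and hep: "\<And>n (T :: 'x pointed). hep (S n) (S (Suc n)) (f n) T"
      "\<And>n (T :: 'x pointed). hep (S' n) (S' (Suc n)) (f' n) T"
      "\<And>n (T :: 'y pointed). hep (S n) (S (Suc n)) (f n) T"
      "\<And>n (T :: 'y pointed). hep (S' n) (S' (Suc n)) (f' n) T"
    and he: "\<And>n. \<exists>g. htpy_inverse (S n) (S' n) (\<phi> n) g"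
    and comm: "\<And>n x. x \<in> topspace (fst (S n)) \<Longrightarrow> \<phi> (Suc n) (f n x) = f' n (\<phi> n x)"
    and \<Phi>: "pmap X Y \<Phi>" "\<And>n x. x \<in> topspace (fst (S n)) \<Longrightarrow> \<Phi> (\<iota> n x) = \<iota>' n (\<phi> n x)"
  obtains \<Psi> where "htpy_inverse X Y \<Phi> \<Psi>"
proof -
  have "\<exists>\<psi> \<Psi>. (\<forall>n. htpy_inverse (S' n) (S n) (\<psi> n) (\<phi> n)) \<and>
    (\<forall>n. \<forall>y \<in> topspace (fst (S' n)). \<psi> (Suc n) (f' n y) = f n (\<psi> n y)) \<and>
    pmap Y X \<Psi> \<and> (\<forall>n. \<forall>y \<in> topspace (fst (S' n)). \<Psi> (\<iota>' n y) = \<iota> n (\<psi> n y)) \<and>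
    phomotopic X X (\<lambda>x. \<Psi> (\<Phi> x)) (\<lambda>x. x)"
    by (rule colimit_left_inverse[OF X Y pt hep(1,2) he comm \<Phi>(2)])
  then obtain \<psi> \<Psi> where ex: "(\<forall>n. htpy_inverse (S' n) (S n) (\<psi> n) (\<phi> n)) \<and>
    (\<forall>n. \<forall>y \<in> topspace (fst (S' n)). \<psi> (Suc n) (f' n y) = f n (\<psi> n y)) \<and>
    pmap Y X \<Psi> \<and> (\<forall>n. \<forall>y \<in> topspace (fst (S' n)). \<Psi> (\<iota>' n y) = \<iota> n (\<psi> n y)) \<and>
    phomotopic X X (\<lambda>x. \<Psi> (\<Phi> x)) (\<lambda>x. x)"
    by (elim exE)
  then have \<psi>: "\<And>n. htpy_inverse (S' n) (S n) (\<psi> n) (\<phi> n)"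
    "\<And>n y. y \<in> topspace (fst (S' n)) \<Longrightarrow> \<psi> (Suc n) (f' n y) = f n (\<psi> n y)"
    "pmap Y X \<Psi>" "\<And>n y. y \<in> topspace (fst (S' n)) \<Longrightarrow> \<Psi> (\<iota>' n y) = \<iota> n (\<psi> n y)"
    "phomotopic X X (\<lambda>x. \<Psi> (\<Phi> x)) (\<lambda>x. x)"
    by auto
  have he': "\<exists>g. htpy_inverse (S' n) (S n) (\<psi> n) g" for n
    using \<psi>(1) by blast
  have "\<exists>\<xi> \<xi>'. (\<forall>n. htpy_inverse (S n) (S' n) (\<xi> n) (\<psi> n)) \<and>
    (\<forall>n. \<forall>y \<in> topspace (fst (S n)). \<xi> (Suc n) (f n y) = f' n (\<xi> n y)) \<and>
    pmap X Y \<xi>' \<and> (\<forall>n. \<forall>y \<in> topspace (fst (S n)). \<xi>' (\<iota> n y) = \<iota>' n (\<xi> n y)) \<and>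
    phomotopic Y Y (\<lambda>x. \<xi>' (\<Psi> x)) (\<lambda>x. x)"
    by (rule colimit_left_inverse[where \<phi> = \<psi> and \<Phi> = \<Psi>, OF Y X pt(2,1) hep(4,3) he'];
        rule \<psi>(2) \<psi>(4); assumption)
  then obtain \<xi> where \<xi>: "pmap X Y \<xi>" "phomotopic Y Y (\<lambda>x. \<xi> (\<Psi> x)) (\<lambda>x. x)"
    by (elim exE conjE) (rule that)
  have "pointed_space X" "pointed_space Y"
    using pmap_pointed is_seq_colimitD(2)[OF X] is_seq_colimitD(2)[OF Y] pt by blast+
  then have "htpy_inverse Y X \<Psi> \<Phi>"
    using htpy_inverse_two_sided(2)[OF \<psi>(3) \<xi>(1) \<Phi>(1)] \<xi>(2) \<psi>(5) by blast
  then show thesis using that htpy_inverse_sym by blast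
qed

section \<open>Induced maps of wedges, cones and suspensions\<close>

text \<open>\<open>wedge_in\<close> is applied to the image because \<open>f\<close> may send
  further points to the base point; \<open>cone_map\<close> and \<open>susp_map\<close> renormalize
  in the same way.\<close>

definition wedge_map :: "'b pointed \<Rightarrow> ('a \<Rightarrow> 'b) \<Rightarrow> ('j \<times> 'a) option \<Rightarrow> ('j \<times> 'b) option" where
  "wedge_map Y f w = (case w of None \<Rightarrow> None | Some (j, x) \<Rightarrow> wedge_in Y (j, f x))"

lemma wedge_map_None [simp]: "wedge_map Y f None = None"
  by (simp add: wedge_map_def)

lemma wedge_map_in: "f (snd X) = snd Y \<Longrightarrow> wedge_map Y f (wedge_in X (j, x)) = wedge_in Y (j, f x)"
  by (simp add: wedge_map_def wedge_in_def)

lemma pfam_wedge_map: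
  assumes "pointed_space X" "pointed_space Y" "compact S" and H: "pfam S X Y H"
  shows "pfam S (wedge J X) (wedge J Y) (\<lambda>s. wedge_map Y (H s))"
proof -
  have h: "pfam S X (wedge J Y) (\<lambda>s x. wedge_in Y (j, H s x))" if "j \<in> J" for j
    by (rule pfam_compose[OF H pmap_pfam[OF pmap_wedge_in[OF that]]])
  obtain f where f: "pfam S (wedge J X) (wedge J Y) f"
    "\<And>s j x. \<lbrakk>s \<in> S; j \<in> J; x \<in> topspace (fst X)\<rbrakk> \<Longrightarrow> f s (wedge_in X (j, x)) = wedge_in Y (j, H s x)"
    using wedge_pfam[where h = "\<lambda>j s x. wedge_in Y (j, H s x)", OF assms(1) pointed_space_wedge assms(3) h] by blast
  show ?thesis
  proof (rule pfam_cong[OF f(1) pointed_space_wedge])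
    fix s x assume s: "s \<in> S" and "x \<in> topspace (fst (wedge J X))"
    from this(2) show "f s x = wedge_map Y (H s) x"
      by (cases rule: wedge_cases)
        (use f(2) pfam_base[OF f(1) s] pfam_base[OF H s] s in \<open>auto simp: wedge_map_in\<close>)
  qed
qed

lemma pmap_wedge_map:
  assumes "pointed_space X" "pointed_space Y" "pmap X Y f"
  shows "pmap (wedge J X) (wedge J Y) (wedge_map Y f)"
proof -
  have "pfam unit_ivl (wedge J X) (wedge J Y) (\<lambda>_. wedge_map Y f)"
    by (rule pfam_wedge_map[OF assms(1,2) compact_Icc pmap_pfam[OF assms(3)]])
  from pfam_pmap[OF this, of 0] show ?thesis by simp
qed

lemma wedge_map_comp:
  assumes "pmap X Y f" "pmap Y Z g" "\<And>x. x \<in> topspace (fst X) \<Longrightarrow> g (f x) = h x"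
    and "x \<in> topspace (fst (wedge J X))" "pointed_space X"
  shows "wedge_map Z g (wedge_map Y f x) = wedge_map Z h x"
proof -
  have "h (snd X) = snd Z" using assms(3)[of "snd X"] assms(5) pmap_base[OF assms(1)] pmap_base[OF assms(2)]
    by (simp add: pointed_space_def)
  with assms(4) show ?thesis
    by (cases rule: wedge_cases) (auto simp: wedge_map_in pmap_base[OF assms(1)] pmap_base[OF assms(2)] assms(3))
qed

lemma wedge_map_id:
  assumes "x \<in> topspace (fst (wedge J X))"
  shows "wedge_map X (\<lambda>x. x) x = x"
  using assms by (cases rule: wedge_cases) (auto simp: wedge_map_in)

lemma htpy_inverse_wedge:
  assumes pt: "pointed_space X" "pointed_space Y" and f: "htpy_inverse X Y f g"
  shows "htpy_inverse (wedge J X) (wedge J Y) (wedge_map Y f) (wedge_map X g)"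
proof -
  \<comment> \<open>Kept general in \<open>U\<close> and \<open>V\<close>, so that it gives both
    composites.\<close>
  have *: "phomotopic (wedge J U) (wedge J U) (\<lambda>x. wedge_map U v (wedge_map V u x)) (\<lambda>x. x)"
    if pt: "pointed_space U" and m: "pmap U V u" "pmap V U v" "phomotopic U U (\<lambda>x. v (u x)) (\<lambda>x. x)"
    for U :: "'e pointed" and V :: "'f pointed" and u v
  proof -
    obtain H where H: "pfam unit_ivl U U H" "\<And>x. x \<in> topspace (fst U) \<Longrightarrow> H 0 x = v (u x)"
      "\<And>x. x \<in> topspace (fst U) \<Longrightarrow> H 1 x = x"
      using phomotopicE[OF m(3) pt] by blast
    show ?thesis
    proof (rule phomotopicI[OF pfam_wedge_map[OF pt pt compact_Icc H(1)] pointed_space_wedge])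
      fix x assume x: "x \<in> topspace (fst (wedge J U))"
      show "wedge_map U (H 0) x = wedge_map U v (wedge_map V u x)"
        using wedge_map_comp[OF m(1,2) _ x pt, of "H 0"] H(2) by simp
      show "wedge_map U (H 1) x = x"
        using wedge_map_comp[OF pmap_id pfam_pmap[OF H(1)] _ x pt, of 1 "\<lambda>x. x"] H(3) wedge_map_id[OF x] by simp
    qed
  qed
  show ?thesis
    using f pt by (auto simp: htpy_inverse_def intro!: pmap_wedge_map *)
qed

definition cone_map :: "'b cpoint pointed \<Rightarrow> ('a cpoint \<Rightarrow> 'b cpoint) \<Rightarrow> 'a cpoint \<Rightarrow> 'b cpoint" where
  "cone_map Y f c = (case c of Seg x t \<Rightarrow> cone_proj Y (f x, t) | _ \<Rightarrow> Base)"

lemma cone_map_proj: "f (snd X) = snd Y \<Longrightarrow> cone_map Y f (cone_proj X (x, t)) = cone_proj Y (f x, t)"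
  by (auto simp: cone_map_def cone_proj_def)

lemma pmap_cone_map:
  assumes "pointed_space X" "pmap X Y f"
  shows "pmap (red_cone X) (red_cone Y) (cone_map Y f)"
proof -
  \<comment> \<open>\<open>{0..0}\<close> is a one-point parameter space: a single map is treated as
    a family.\<close>
  have k: "pfam ({0..0::real} \<times> unit_ivl) X (red_cone Y) (\<lambda>z x. cone_proj Y (f x, snd z))"
    by (rule pfam_compose[OF pmap_pfam[OF assms(2)] pfam_reparam[OF pfam_cone_proj]]) (auto intro!: continuous_intros)
  obtain F where F: "pfam {0..0::real} (red_cone X) (red_cone Y) F"
    "\<And>s x t. \<lbrakk>s \<in> {0..0}; x \<in> topspace (fst X); t \<in> unit_ivl\<rbrakk> \<Longrightarrow> F s (cone_proj X (x, t)) = cone_proj Y (f x, t)"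
    using cone_pfam[OF assms(1) compact_Icc k] by (auto simp: cone_proj_base)
  show ?thesis
  proof (rule pmap_cong[OF pfam_pmap[OF F(1), of 0] pointed_space_cone[OF assms(1)]])
    show "F 0 x = cone_map Y f x" if "x \<in> topspace (fst (red_cone X))" for x
      using that by (cases rule: cone_cases) (use F(2) in \<open>auto simp: cone_map_proj pmap_base[OF assms(2)]\<close>)
  qed simp
qed

lemma cone_map_base: "f (snd X) = snd Y \<Longrightarrow> cone_map Y f (cone_base X x) = cone_base Y (f x)"
  by (simp add: cone_base_def cone_map_proj)

lemma pmap_cone_base: "pmap X (red_cone X) (cone_base X)"
  using pfam_pmap[OF pfam_cone_proj, of 0] by (simp add: cone_base_def[abs_def])

lemma inj_cone_base: "inj_on (cone_base X) S"
  by (auto simp: inj_on_def cone_base_def cone_proj_def split: if_splits)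

lemma pcontractible_cone:
  assumes "pointed_space X"
  shows "pcontractible (red_cone X)"
proof -
  \<comment> \<open>At time \<open>s\<close> every height is raised to at least
    \<open>1 - s\<close>: everything is at the apex at time 0, and nothing has moved at time
    1.\<close>
  have k: "pfam (unit_ivl \<times> unit_ivl) X (red_cone X) (\<lambda>z x. cone_proj X (x, max (snd z) (1 - fst z)))"
    by (rule pfam_reparam[OF pfam_cone_proj]) (auto intro!: continuous_intros)
  have "cone_proj X (x, max (snd (s, 1)) (1 - fst (s, 1))) = snd (red_cone X)" if "s \<in> unit_ivl" for s x
  proof -
    have "max 1 (1 - s) = 1" using that by auto
    then show ?thesis by (simp add: cone_proj_base)
  qed
  then obtain F where F: "pfam unit_ivl (red_cone X) (red_cone X) F"
    "\<And>s x t. \<lbrakk>s \<in> unit_ivl; x \<in> topspace (fst X); t \<in> unit_ivl\<rbrakk> \<Longrightarrow>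
       F s (cone_proj X (x, t)) = cone_proj X (x, max (snd (s, t)) (1 - fst (s, t)))"
    using cone_pfam[OF assms compact_Icc k] by blast
  have "F 0 x = Base \<and> F 1 x = x" if "x \<in> topspace (fst (red_cone X))" for x
    using that
  proof (cases rule: cone_cases)
    case (1 y t)
    have "max t 1 = 1" "max t 0 = t" using 1(2) by auto
    then show ?thesis using 1 F(2)[of 0 y t] F(2)[of 1 y t] by (simp add: cone_proj_base)
  qed
  then show ?thesis
    unfolding pcontractible_def
    by (intro phomotopicI[OF F(1) pointed_space_cone[OF assms]]) auto
qed

lemma pcontractible_wedge:
  assumes "pointed_space X" "pcontractible X"
  shows "pcontractible (wedge J X)"
proof -
  obtain H where H: "pfam unit_ivl X X H" "\<And>x. x \<in> topspace (fst X) \<Longrightarrow> H 0 x = snd X"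
    "\<And>x. x \<in> topspace (fst X) \<Longrightarrow> H 1 x = x"
    using phomotopicE[OF assms(2)[unfolded pcontractible_def] assms(1)] by blast
  have b: "H 0 (snd X) = snd X" "H 1 (snd X) = snd X"
    using pfam_base[OF H(1)] by auto
  have "wedge_map X (H 0) x = snd (wedge J X) \<and> wedge_map X (H 1) x = x" if "x \<in> topspace (fst (wedge J X))" for x
    using that by (cases rule: wedge_cases) (auto simp: wedge_map_in b H(2,3))
  then show ?thesis
    unfolding pcontractible_def
    by (intro phomotopicI[OF pfam_wedge_map[OF assms(1,1) compact_Icc H(1)] pointed_space_wedge]) auto
qed

section \<open>Homotopy extension for cones and wedges\<close>

lemma hep_cone:
  assumes V: "pointed_space V"
  shows "hep V (red_cone V) (cone_base V) T"
  unfolding hep_def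
proof (intro conjI allI impI pmap_cone_base; (elim conjE)?)
  fix F h assume F: "pfam unit_ivl (red_cone V) T F" and h: "pfam (unit_ivl \<times> unit_ivl) V T h"
    and eq: "\<forall>s\<in>unit_ivl. \<forall>x\<in>topspace (fst V). h (s, 0) x = F s (cone_base V x)"
  let ?Q = "(unit_ivl \<times> unit_ivl) \<times> unit_ivl"
  \<comment> \<open>At time \<open>r\<close>, the cone is rescaled from \<open>[0,1]\<close> to \<open>[-r,1]\<close>; the new collar \<open>[-r,0]\<close> is mapped by \<open>h\<close>.\<close>
  define \<tau> :: "(real \<times> real) \<times> real \<Rightarrow> real" where "\<tau> z = snd z * (1 + snd (fst z)) - snd (fst z)" for z
  have \<tau>c: "continuous_on ?Q \<tau>" unfolding \<tau>_def by (intro continuous_intros)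
  \<comment> \<open>The clamped values stay in the interval, so both branches below make sense over
    the whole cube.\<close>
  have \<tau>1: "max 0 (\<tau> ((s, r), t)) \<in> unit_ivl" "max 0 (- \<tau> ((s, r), t)) \<in> unit_ivl"
    if "r \<in> unit_ivl" "t \<in> unit_ivl" for s r t
  proof -
    have r: "0 \<le> r" "r \<le> 1" and t: "0 \<le> t" "t \<le> 1" using that by auto
    define m where "m = t * (1 + r)"
    have "m \<le> 1 + r" using mult_right_mono[OF t(2), of "1 + r"] r by (simp add: m_def)
    moreover have "0 \<le> m" using r t by (simp add: m_def)
    moreover have "\<tau> ((s, r), t) = m - r" by (simp add: \<tau>_def m_def)
    ultimately have "\<tau> ((s, r), t) \<le> 1" "- \<tau> ((s, r), t) \<le> 1"
      using r by simp_all
    then show "max 0 (\<tau> ((s, r), t)) \<in> unit_ivl" "max 0 (- \<tau> ((s, r), t)) \<in> unit_ivl"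
      by simp_all
  qed
  let ?u = "\<lambda>z x. F (fst (fst z)) (cone_proj V (x, max 0 (\<tau> z)))"
  let ?v = "\<lambda>z. h (fst (fst z), max 0 (- \<tau> z))"
  have Fs: "pfam ?Q (red_cone V) T (\<lambda>z. F (fst (fst z)))"
    by (rule pfam_reparam[OF F]) (auto intro!: continuous_intros)
  have ps: "pfam ?Q V (red_cone V) (\<lambda>z x. cone_proj V (x, max 0 (\<tau> z)))"
    by (rule pfam_reparam[OF pfam_cone_proj]) (use \<tau>1 in \<open>auto intro!: continuous_intros \<tau>c\<close>)
  have u: "pfam ?Q V T ?u" by (rule pfam_compose[OF ps Fs])
  have v: "pfam ?Q V T ?v"
    by (rule pfam_reparam[OF h]) (use \<tau>1 in \<open>auto intro!: continuous_intros \<tau>c\<close>)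
  \<comment> \<open>The branches meet where \<open>\<tau>\<close> vanishes, at the base of the
    original cone, and agree there by \<open>eq\<close>. At height 1 the value of
    \<open>\<tau>\<close> is 1 for every \<open>r\<close>, so the apex stays fixed.\<close>
  have k: "pfam ?Q V T (\<lambda>z. if 0 \<le> \<tau> z then ?u z else ?v z)"
    by (rule pfam_if_le[OF u v]) (use eq \<tau>c in \<open>auto intro!: continuous_intros simp: cone_base_def\<close>)
  have k1: "(if 0 \<le> \<tau> (s, 1) then ?u (s, 1) else ?v (s, 1)) x = snd T" if "s \<in> unit_ivl \<times> unit_ivl" for s x
    using that pfam_base[OF F, of "fst s"] by (auto simp: \<tau>_def cone_proj_base)
  obtain K where K: "pfam (unit_ivl \<times> unit_ivl) (red_cone V) T K"
    "\<And>s x t. \<lbrakk>s \<in> unit_ivl \<times> unit_ivl; x \<in> topspace (fst V); t \<in> unit_ivl\<rbrakk> \<Longrightarrow>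
      K s (cone_proj V (x, t)) = (if 0 \<le> \<tau> (s, t) then ?u (s, t) else ?v (s, t)) x"
    using cone_pfam[OF V compact_Times[OF compact_Icc compact_Icc] k k1] by blast
  show "\<exists>K. pfam (unit_ivl \<times> unit_ivl) (red_cone V) T K \<and>
           (\<forall>s\<in>unit_ivl. \<forall>c\<in>topspace (fst (red_cone V)). K (s, 0) c = F s c) \<and>
           (\<forall>s\<in>unit_ivl. \<forall>r\<in>unit_ivl. \<forall>w\<in>topspace (fst V). K (s, r) (cone_base V w) = h (s, r) w)"
  proof (intro exI[of _ K] conjI K(1) ballI)
    fix s c assume s: "s \<in> unit_ivl" and "c \<in> topspace (fst (red_cone V))"
    from this(2) show "K (s, 0) c = F s c"
      by (cases rule: cone_cases) (use s K(2) in \<open>auto simp: \<tau>_def\<close>)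
  next
    fix s r x assume *: "s \<in> unit_ivl" "r \<in> unit_ivl" "x \<in> topspace (fst V)"
    then show "K (s, r) (cone_base V x) = h (s, r) x"
      using K(2)[of "(s, r)" x 0] eq by (auto simp: \<tau>_def cone_base_def)
  qed
qed

text \<open>Each summand is extended on its own; the base point condition keeps the extensions in
  agreement at the wedge point.\<close>

lemma hep_wedge:
  assumes pt: "pointed_space V" "pointed_space C" and hep: "hep V C i T"
  shows "hep (wedge J V) (wedge J C) (wedge_map C i) T"
  unfolding hep_def
proof (intro conjI allI impI; (elim conjE)?)
  have i: "pmap V C i" using hep by (simp add: hep_def)
  show "pmap (wedge J V) (wedge J C) (wedge_map C i)" by (rule pmap_wedge_map[OF pt i])
  fix F h assume F: "pfam unit_ivl (wedge J C) T F" and h: "pfam (unit_ivl \<times> unit_ivl) (wedge J V) T h"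
    and eq: "\<forall>s\<in>unit_ivl. \<forall>w\<in>topspace (fst (wedge J V)). h (s, 0) w = F s (wedge_map C i w)"
  have "\<exists>K. pfam (unit_ivl \<times> unit_ivl) C T K \<and>
      (\<forall>s \<in> unit_ivl. \<forall>c \<in> topspace (fst C). K (s, 0) c = F s (wedge_in C (j, c))) \<and>
      (\<forall>s \<in> unit_ivl. \<forall>r \<in> unit_ivl. \<forall>x \<in> topspace (fst V). K (s, r) (i x) = h (s, r) (wedge_in V (j, x)))"
    if j: "j \<in> J" for j
  proof -
    have "h (s, 0) (wedge_in V (j, x)) = F s (wedge_in C (j, i x))" if "s \<in> unit_ivl" "x \<in> topspace (fst V)" for s x
      using eq that j by (simp add: topspace_wedge wedge_map_in pmap_base[OF i])
    then obtain K where "pfam (unit_ivl \<times> unit_ivl) C T K"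
      "\<And>s c. \<lbrakk>s \<in> unit_ivl; c \<in> topspace (fst C)\<rbrakk> \<Longrightarrow> K (s, 0) c = F s (wedge_in C (j, c))"
      "\<And>s r x. \<lbrakk>s \<in> unit_ivl; r \<in> unit_ivl; x \<in> topspace (fst V)\<rbrakk> \<Longrightarrow> K (s, r) (i x) = h (s, r) (wedge_in V (j, x))"
      using hepE[OF hep pfam_compose[OF pmap_pfam[OF pmap_wedge_in[OF j]] F]
          pfam_compose[OF pmap_pfam[OF pmap_wedge_in[OF j]] h]] by blast
    then show ?thesis by blast
  qed
  then obtain K where K: "\<And>j. j \<in> J \<Longrightarrow> pfam (unit_ivl \<times> unit_ivl) C T (K j)"
      "\<And>j s c. \<lbrakk>j \<in> J; s \<in> unit_ivl; c \<in> topspace (fst C)\<rbrakk> \<Longrightarrow> K j (s, 0) c = F s (wedge_in C (j, c))"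
      "\<And>j s r x. \<lbrakk>j \<in> J; s \<in> unit_ivl; r \<in> unit_ivl; x \<in> topspace (fst V)\<rbrakk> \<Longrightarrow>
         K j (s, r) (i x) = h (s, r) (wedge_in V (j, x))"
    by metis
  \<comment> \<open>\<open>wedge_pfam\<close> asks for a base point in \<open>T\<close>; the value
    of \<open>F\<close> at \<open>None\<close> provides it.\<close>
  have "pointed_space T"
    using pfam_in[OF F, of 0 None] pfam_base[OF F, of 0] by (simp add: pointed_space_def topspace_wedge)
  then obtain f where f: "pfam (unit_ivl \<times> unit_ivl) (wedge J C) T f"
    "\<And>s j x. \<lbrakk>s \<in> unit_ivl \<times> unit_ivl; j \<in> J; x \<in> topspace (fst C)\<rbrakk> \<Longrightarrow> f s (wedge_in C (j, x)) = K j s x"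
    using wedge_pfam[where h = K, OF pt(2) _ compact_Times[OF compact_Icc compact_Icc] K(1)] by blast
  have fN: "f (s, r) None = snd T" "h (s, r) None = snd T" "F s None = snd T" if "s \<in> unit_ivl" "r \<in> unit_ivl" for s r
    using pfam_base[OF f(1), of "(s, r)"] pfam_base[OF h, of "(s, r)"] pfam_base[OF F, of s] that by auto
  show "\<exists>K. pfam (unit_ivl \<times> unit_ivl) (wedge J C) T K \<and>
           (\<forall>s\<in>unit_ivl. \<forall>c\<in>topspace (fst (wedge J C)). K (s, 0) c = F s c) \<and>
           (\<forall>s\<in>unit_ivl. \<forall>r\<in>unit_ivl. \<forall>w\<in>topspace (fst (wedge J V)). K (s, r) (wedge_map C i w) = h (s, r) w)"
  proof (intro exI[of _ f] conjI f(1) ballI)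
    fix s c assume s: "s \<in> unit_ivl" and "c \<in> topspace (fst (wedge J C))"
    from this(2) show "f (s, 0) c = F s c"
      by (cases rule: wedge_cases) (use s K(2) f(2) fN in auto)
  next
    fix s r x assume s: "s \<in> unit_ivl" "r \<in> unit_ivl" and "x \<in> topspace (fst (wedge J V))"
    from this(3) show "f (s, r) (wedge_map C i x) = h (s, r) x"
      by (cases rule: wedge_cases)
        (use s K(3) f(2) fN pmap_in[OF i] in \<open>auto simp: wedge_map_in pmap_base[OF i]\<close>)
  qed
qed

lemma wedge_cone_base_eq: "wedge_cone_base X = wedge_map (red_cone X) (cone_base X)"
  by (auto simp: wedge_cone_base_def wedge_map_def fun_eq_iff)

lemma inj_wedge_map:
  assumes "inj_on f (topspace (fst X))" "f (snd X) = snd Y" "pointed_space X"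
  shows "inj_on (wedge_map Y f) (topspace (fst (wedge J X)))"
proof (rule inj_onI)
  fix x y assume "x \<in> topspace (fst (wedge J X))" "y \<in> topspace (fst (wedge J X))" "wedge_map Y f x = wedge_map Y f y"
  moreover have "f x = snd Y \<longleftrightarrow> x = snd X" if "x \<in> topspace (fst X)" for x
    using that assms inj_onD[OF assms(1), of x "snd X"] by (auto simp: pointed_space_def)
  ultimately show "x = y"
    using assms(1) by (auto simp: topspace_wedge wedge_map_def wedge_in_def split: if_splits dest: inj_onD)
qed

section \<open>Iterated suspensions of maps and homotopies\<close>

definition susp_map :: "'b cpoint pointed \<Rightarrow> ('a cpoint \<Rightarrow> 'b cpoint) \<Rightarrow> 'a cpoint \<Rightarrow> 'b cpoint" where
  "susp_map Y f c = (case c of Seg x t \<Rightarrow> susp_proj Y (f x, t) | _ \<Rightarrow> Base)"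

lemma susp_map_proj: "f (snd X) = snd Y \<Longrightarrow> susp_map Y f (susp_proj X (x, t)) = susp_proj Y (f x, t)"
  by (auto simp: susp_map_def susp_proj_def)

lemma pfam_susp_map:
  assumes "pointed_space X" "compact S" and H: "pfam S X Y H"
  shows "pfam S (red_susp X) (red_susp Y) (\<lambda>s. susp_map Y (H s))"
proof -
  have "pfam (S \<times> unit_ivl) X Y (\<lambda>z. H (fst z))"
    by (rule pfam_reparam[OF H]) (auto intro!: continuous_intros)
  moreover have "pfam (S \<times> unit_ivl) Y (red_susp Y) (\<lambda>z y. susp_proj Y (y, snd z))"
    by (rule pfam_reparam[OF pfam_susp_proj]) (auto intro!: continuous_intros)
  ultimately have k: "pfam (S \<times> unit_ivl) X (red_susp Y) (\<lambda>z x. susp_proj Y (H (fst z) x, snd z))"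
    by (rule pfam_compose)
  obtain F where F: "pfam S (red_susp X) (red_susp Y) F"
    "\<And>s x t. \<lbrakk>s \<in> S; x \<in> topspace (fst X); t \<in> unit_ivl\<rbrakk> \<Longrightarrow> F s (susp_proj X (x, t)) = susp_proj Y (H s x, t)"
    using susp_pfam[OF assms(1,2) k] by (auto simp: susp_proj_base)
  show ?thesis
  proof (rule pfam_cong[OF F(1) pointed_space_susp[OF assms(1)]])
    fix s x assume s: "s \<in> S" and "x \<in> topspace (fst (red_susp X))"
    from this(2) show "F s x = susp_map Y (H s) x"
      by (cases rule: susp_cases) (use F(2) s in \<open>auto simp: susp_map_proj pfam_base[OF H s]\<close>)
  qed
qed

text \<open>All points of the zeroth suspension have the form \<open>Pt a\<close>;
  \<open>Base\<close> is a default elsewhere. The target \<open>B\<close> is an argument because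
  \<open>susp_map\<close> has to recognize its base point.\<close>

primrec iter_susp_map :: "nat \<Rightarrow> 'b pointed \<Rightarrow> ('a \<Rightarrow> 'b) \<Rightarrow> 'a cpoint \<Rightarrow> 'b cpoint" where
  "iter_susp_map 0 B f = (\<lambda>c. case c of Pt a \<Rightarrow> Pt (f a) | _ \<Rightarrow> Base)"
| "iter_susp_map (Suc n) B f = susp_map (iter_susp n B) (iter_susp_map n B f)"

lemma iter_susp_Suc: "iter_susp (Suc n) A = red_susp (iter_susp n A)"
  by (simp add: iter_susp_def)

lemma topspace_iter_susp_0: "topspace (fst (iter_susp 0 A)) = Pt ` topspace (fst A)"
  by (simp add: iter_susp_def)

lemma snd_iter_susp_0: "snd (iter_susp 0 A) = Pt (snd A)"
  by (simp add: iter_susp_def)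

text \<open>Suspending a whole family at once is what makes suspension preserve homotopies. At level
  0 the family is transported along the homeomorphism \<open>Pt\<close>.\<close>

lemma pfam_iter_susp_map:
  assumes "pointed_space A" "pointed_space B" "compact S" and H: "pfam S A B H"
  shows "pfam S (iter_susp n A) (iter_susp n B) (\<lambda>s. iter_susp_map n B (H s))"
proof (induction n)
  case 0
  have Q: "quotient_map (fst A) (fst (iter_susp 0 A)) Pt"
    by (rule homeomorphic_map_iter_susp_0[unfolded homeomorphic_map_def, THEN conjunct1])
  have "continuous_map (fst (iter_susp 0 A)) (fst A) (\<lambda>c. case c of Pt a \<Rightarrow> a)"
    by (rule continuous_compose_quotient_map[OF Q]) (simp add: o_def)
  then have 1: "pmap (iter_susp 0 A) A (\<lambda>c. case c of Pt a \<Rightarrow> a)"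
    by (simp add: pmap_def snd_iter_susp_0)
  have "continuous_map (fst B) (fst (iter_susp 0 B)) Pt"
    by (rule quotient_imp_continuous_map[OF homeomorphic_map_iter_susp_0[unfolded homeomorphic_map_def, THEN conjunct1]])
  then have 2: "pmap B (iter_susp 0 B) Pt"
    by (simp add: pmap_def snd_iter_susp_0)
  show ?case
    by (rule pfam_cong[OF pfam_compose[OF pfam_compose[OF pmap_pfam[OF 1] H] pmap_pfam[OF 2]] pointed_space_iter_susp[OF assms(1)]])
      (auto simp: topspace_iter_susp_0)
next
  case (Suc n)
  show ?case
    unfolding iter_susp_Suc iter_susp_map.simps
    by (rule pfam_susp_map[OF pointed_space_iter_susp[OF assms(1)] assms(3) Suc])
qed

lemma pmap_iter_susp_map:
  assumes "pointed_space A" "pointed_space B" "pmap A B f"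
  shows "pmap (iter_susp n A) (iter_susp n B) (iter_susp_map n B f)"
proof -
  have "pfam unit_ivl (iter_susp n A) (iter_susp n B) (\<lambda>_. iter_susp_map n B f)"
    by (rule pfam_iter_susp_map[OF assms(1,2) compact_Icc pmap_pfam[OF assms(3)]])
  from pfam_pmap[OF this, of 0] show ?thesis by simp
qed

lemma iter_susp_map_comp:
  assumes pt: "pointed_space A" "pointed_space B" "pointed_space C" and m: "pmap A B f" "pmap B C g" "pmap A C h"
    and eq: "\<And>x. x \<in> topspace (fst A) \<Longrightarrow> g (f x) = h x"
  shows "x \<in> topspace (fst (iter_susp n A)) \<Longrightarrow> iter_susp_map n C g (iter_susp_map n B f x) = iter_susp_map n C h x"
proof (induction n arbitrary: x)
  case 0
  then show ?case using eq by (auto simp: topspace_iter_susp_0)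
next
  case (Suc n)
  note b = pmap_base[OF pmap_iter_susp_map[OF pt(1,2) m(1), of n]]
    pmap_base[OF pmap_iter_susp_map[OF pt(2,3) m(2), of n]] pmap_base[OF pmap_iter_susp_map[OF pt(1,3) m(3), of n]]
  have "x \<in> topspace (fst (red_susp (iter_susp n A)))" using Suc.prems by (simp add: iter_susp_Suc)
  then show ?case
    by (cases rule: susp_cases) (use Suc.IH in \<open>auto simp: susp_map_proj b\<close>)
qed

lemma iter_susp_map_id:
  assumes pt: "pointed_space A"
  shows "x \<in> topspace (fst (iter_susp n A)) \<Longrightarrow> iter_susp_map n A (\<lambda>x. x) x = x"
proof (induction n arbitrary: x)
  case 0
  then show ?case by (auto simp: topspace_iter_susp_0)
next
  case (Suc n)
  note b = pmap_base[OF pmap_iter_susp_map[OF pt pt pmap_id, of n]]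
  have "x \<in> topspace (fst (red_susp (iter_susp n A)))" using Suc.prems by (simp add: iter_susp_Suc)
  then show ?case
    by (cases rule: susp_cases) (use Suc.IH in \<open>auto simp: susp_map_proj b\<close>)
qed

lemma htpy_inverse_iter_susp:
  assumes pt: "pointed_space A" "pointed_space B" and f: "htpy_inverse A B f g"
  shows "htpy_inverse (iter_susp n A) (iter_susp n B) (iter_susp_map n B f) (iter_susp_map n A g)"
proof -
  have *: "phomotopic (iter_susp n U) (iter_susp n U) (\<lambda>x. iter_susp_map n U v (iter_susp_map n V u x)) (\<lambda>x. x)"
    if pt: "pointed_space U" "pointed_space V" and m: "pmap U V u" "pmap V U v" "phomotopic U U (\<lambda>x. v (u x)) (\<lambda>x. x)"
    for U :: "'e pointed" and V :: "'f pointed" and u v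
  proof -
    obtain H where H: "pfam unit_ivl U U H" "\<And>x. x \<in> topspace (fst U) \<Longrightarrow> H 0 x = v (u x)"
      "\<And>x. x \<in> topspace (fst U) \<Longrightarrow> H 1 x = x"
      using phomotopicE[OF m(3) pt(1)] by blast
    show ?thesis
    proof (rule phomotopicI[OF pfam_iter_susp_map[OF pt(1,1) compact_Icc H(1)] pointed_space_iter_susp[OF pt(1)]])
      fix x assume x: "x \<in> topspace (fst (iter_susp n U))"
      show "iter_susp_map n U (H 0) x = iter_susp_map n U v (iter_susp_map n V u x)"
        using iter_susp_map_comp[OF pt(1,2,1) m(1,2) pfam_pmap[OF H(1), of 0] _ x] H(2) by simp
      show "iter_susp_map n U (H 1) x = x"
        using iter_susp_map_comp[OF pt(1,1,1) pmap_id pfam_pmap[OF H(1), of 1] pmap_id _ x] H(3)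
          iter_susp_map_id[OF pt(1)] x by simp
    qed
  qed
  show ?thesis
    using f pt by (auto simp: htpy_inverse_def intro!: pmap_iter_susp_map *)
qed

section \<open>Replacing cells of type A by cells of type B\<close>

lemma wedge_map_inverse:
  assumes "pointed_space X" "pmap X Y f" "pmap Y X g" "\<And>x. x \<in> topspace (fst X) \<Longrightarrow> g (f x) = x"
    and "w \<in> topspace (fst (wedge J X))"
  shows "wedge_map X g (wedge_map Y f w) = w"
  using wedge_map_comp[OF assms(2,3,4,5,1)] wedge_map_id[OF assms(5)] by simp

lemma cone_map_inverse:
  assumes "pmap X Y f" "pmap Y X g" "\<And>x. x \<in> topspace (fst X) \<Longrightarrow> g (f x) = x"
    and "c \<in> topspace (fst (red_cone X))"
  shows "cone_map X g (cone_map Y f c) = c"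
  using assms(4) by (cases rule: cone_cases) (auto simp: cone_map_proj pmap_base[OF assms(1)] pmap_base[OF assms(2)] assms(3))

lemma iter_susp_map_inverse:
  assumes "pointed_space A" "pointed_space B" "pmap A B f" "pmap B A g" "\<And>x. x \<in> topspace (fst A) \<Longrightarrow> g (f x) = x"
    and "x \<in> topspace (fst (iter_susp n A))"
  shows "iter_susp_map n A g (iter_susp_map n B f x) = x"
  using iter_susp_map_comp[OF assms(1,2,1,3,4) pmap_id assms(5,6)] iter_susp_map_id[OF assms(1,6)] by simp

lemma hep_wedge_cone:
  assumes "pointed_space X"
  shows "hep (wedge J X) (wedge J (red_cone X)) (wedge_cone_base X) T"
  unfolding wedge_cone_base_eq
  by (rule hep_wedge[OF assms pointed_space_cone[OF assms] hep_cone[OF assms]])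

lemma inj_wedge_cone_base:
  assumes "pointed_space X"
  shows "inj_on (wedge_cone_base X) (topspace (fst (wedge J X)))"
  unfolding wedge_cone_base_eq
  by (rule inj_wedge_map[OF inj_cone_base pmap_base[OF pmap_cone_base] assms])

lemma wedge_cone_square:
  assumes "pointed_space X" "pmap X Y f" and w: "w \<in> topspace (fst (wedge J X))"
  shows "wedge_map (red_cone Y) (cone_map Y f) (wedge_cone_base X w) = wedge_cone_base Y (wedge_map Y f w)"
  using w
proof (cases rule: wedge_cases)
  case 1
  then show ?thesis by (simp add: wedge_cone_base_eq)
next
  case (2 j x)
  have b: "f (snd X) = snd Y" using assms(2) by (rule pmap_base)
  have "cone_map Y f (snd (red_cone X)) = snd (red_cone Y)"
    by (rule pmap_base[OF pmap_cone_map[OF assms(1,2)]])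
  then show ?thesis
    using 2(3) pmap_base[OF pmap_cone_base, of X] pmap_base[OF pmap_cone_base, of Y]
    by (simp add: wedge_cone_base_eq wedge_map_in b cone_map_base)
qed

text \<open>The form of the replacement for 0-cells. Over a point, pointed maps and homotopies agree
  automatically, so equivalences of the wedges glue with the identity of \<open>Z\<close>.\<close>

lemma wedge_replacement:
  assumes W: "topspace (fst W) = {snd W}" and V: "topspace (fst V) = {snd V}"
    and b': "htpy_inverse D C b' a'" and pt: "pointed_space Z" "pointed_space D"
    and PX: "is_pushout W Z C g i X p q" and PY: "is_pushout V Z D g' k Y p' q'"
    and F: "pmap Y X F" "\<And>z. z \<in> topspace (fst Z) \<Longrightarrow> F (p' z) = p z" "\<And>d. d \<in> topspace (fst D) \<Longrightarrow> F (q' d) = q (b' d)"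
  shows "\<exists>G. htpy_inverse Y X F G \<and> (\<forall>z \<in> topspace (fst Z). G (p z) = p' z)"
proof -
  note DX = is_pushoutD[OF PX] and DY = is_pushoutD[OF PY]
  have m: "pmap D C b'" "pmap C D a'" "phomotopic D D (\<lambda>x. a' (b' x)) (\<lambda>x. x)" "phomotopic C C (\<lambda>x. b' (a' x)) (\<lambda>x. x)"
    using b' by (auto simp: htpy_inverse_def)
  have ptC: "pointed_space C" using pmap_pointed[OF m(1) pt(2)] .
  obtain H where H: "pfam unit_ivl D D H" "\<And>x. x \<in> topspace (fst D) \<Longrightarrow> H 0 x = a' (b' x)"
    "\<And>x. x \<in> topspace (fst D) \<Longrightarrow> H 1 x = x" using phomotopicE[OF m(3) pt(2)] by blast
  obtain K where K: "pfam unit_ivl C C K" "\<And>x. x \<in> topspace (fst C) \<Longrightarrow> K 0 x = b' (a' x)"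
    "\<And>x. x \<in> topspace (fst C) \<Longrightarrow> K 1 x = x" using phomotopicE[OF m(4) ptC] by blast
  note bs = pmap_base[OF DX(1)] pmap_base[OF DX(2)] pmap_base[OF DX(3)] pmap_base[OF DX(4)]
    pmap_base[OF DY(1)] pmap_base[OF DY(2)] pmap_base[OF DY(3)] pmap_base[OF DY(4)] pmap_base[OF m(1)] pmap_base[OF m(2)]
  obtain G where G: "pmap X Y G" "\<And>z. z \<in> topspace (fst Z) \<Longrightarrow> G (p z) = p' z" "\<And>c. c \<in> topspace (fst C) \<Longrightarrow> G (q c) = q' (a' c)"
    by (rule pushout_map[OF PX pt(1) DY(3) pmap_compose[OF m(2) DY(4)]]) (auto simp: W bs)
  have "phomotopic Y Y (\<lambda>y. G (F y)) (\<lambda>y. y)"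
  proof (rule pushout_homotopy[OF PY pt(1) pmap_pfam[OF DY(3)] pfam_compose[OF H(1) pmap_pfam[OF DY(4)]]])
    show "p' (g' w) = q' (H s (k w))" if "s \<in> unit_ivl" "w \<in> topspace (fst V)" for s w
      using that pfam_base[OF H(1)] by (simp add: V bs)
  qed (use F G H(2,3) pmap_in[OF m(1)] in auto)
  moreover have "phomotopic X X (\<lambda>y. F (G y)) (\<lambda>y. y)"
  proof (rule pushout_homotopy[OF PX pt(1) pmap_pfam[OF DX(3)] pfam_compose[OF K(1) pmap_pfam[OF DX(4)]]])
    show "p (g w) = q (K s (i w))" if "s \<in> unit_ivl" "w \<in> topspace (fst W)" for s w
      using that pfam_base[OF K(1)] by (simp add: W bs)
  qed (use F G K(2,3) pmap_in[OF m(2)] in auto)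
  ultimately have "htpy_inverse Y X F G"
    using F(1) G(1) by (simp add: htpy_inverse_def)
  then show ?thesis using G(2) by blast
qed

text \<open>The flags select what is wanted: \<open>strict\<close> a strict retraction, \<open>he\<close> a homotopy equivalence. The
  attaching map \<open>\<phi>0 \<circ> g \<circ> b\<close> serves all cases. Without \<open>strict\<close>, the map \<open>X \<rightarrow> Y\<close> is \<open>X \<rightarrow> X'\<close> followed
  by an inverse under \<open>Z'\<close> of the map \<open>Y \<rightarrow> X'\<close> that \<open>b'\<close> induces.\<close>

lemma cell_step:
  fixes W :: "'w pointed" and V :: "'v pointed" and C :: "'c pointed" and D :: "'d pointed"
    and Z X :: "'x pointed" and Z' :: "'y pointed"
  assumes P: "is_pushout W Z C g i X p q"
    and pt: "pointed_space W" "pointed_space V" "pointed_space Z" "pointed_space Z'"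
    and k: "pmap V D k" "inj_on k (topspace (fst V))" and i: "inj_on i (topspace (fst W))"
    and b: "pmap V W b" and b': "pmap D C b'" "\<And>v. v \<in> topspace (fst V) \<Longrightarrow> b' (k v) = i (b v)"
    and \<phi>0: "pmap Z Z' \<phi>0"
    and e: "inj_on e (topspace (fst D) - k ` topspace (fst V))"
      "topspace (fst Z') \<inter> e ` (topspace (fst D) - k ` topspace (fst V)) = {}"
    and hep: "\<And>T :: 'x pointed. hep W C i T" "\<And>T :: ('x + 'c) pointed. hep W C i T" "\<And>T :: ('y + 'c) pointed. hep W C i T"
    and strict: "strict \<Longrightarrow> pmap W V a" "\<And>w. strict \<Longrightarrow> w \<in> topspace (fst W) \<Longrightarrow> b (a w) = w"
      "strict \<Longrightarrow> pmap C D a'" "\<And>w. strict \<Longrightarrow> w \<in> topspace (fst W) \<Longrightarrow> a' (i w) = k (a w)"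
      "\<And>c. strict \<Longrightarrow> c \<in> topspace (fst C) \<Longrightarrow> b' (a' c) = c"
      "strict \<Longrightarrow> pmap Z' Z \<psi>0" "\<And>z. strict \<Longrightarrow> z \<in> topspace (fst Z) \<Longrightarrow> \<psi>0 (\<phi>0 z) = z"
    and he: "he \<Longrightarrow> \<exists>\<zeta>. htpy_inverse Z Z' \<phi>0 \<zeta>"
    and replace: "\<And>(X' :: ('y + 'c) pointed) p2 q2 g2 (Y :: 'y pointed) q' g' F.
      \<lbrakk>he; \<not> strict; is_pushout W Z' C g2 i X' p2 q2; is_pushout V Z' D g' k Y (\<lambda>z. z) q';
       \<And>v. v \<in> topspace (fst V) \<Longrightarrow> g' v = g2 (b v); pmap Y X' F;
       \<And>z. z \<in> topspace (fst Z') \<Longrightarrow> F z = p2 z; \<And>d. d \<in> topspace (fst D) \<Longrightarrow> F (q' d) = q2 (b' d)\<rbrakk> \<Longrightarrow>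
      \<exists>G. htpy_inverse Y X' F G \<and> (\<forall>z \<in> topspace (fst Z'). G (p2 z) = z)"
    and replace': "\<And>(X' :: ('y + 'c) pointed) p2 q2 g2 (Y :: 'y pointed) q' g' F.
      \<lbrakk>he; strict; is_pushout V Z' D g' k Y (\<lambda>z. z) q'; is_pushout W Z' C g2 i X' p2 q2;
       \<And>w. w \<in> topspace (fst W) \<Longrightarrow> g2 w = g' (a w); pmap X' Y F;
       \<And>z. z \<in> topspace (fst Z') \<Longrightarrow> F (p2 z) = z; \<And>c. c \<in> topspace (fst C) \<Longrightarrow> F (q2 c) = q' (a' c)\<rbrakk> \<Longrightarrow>
      \<exists>G. htpy_inverse X' Y F G"
    and some: "strict \<or> he"
  shows "\<exists>Y q' \<phi> \<psi>. is_pushout V Z' D (\<lambda>v. \<phi>0 (g (b v))) k Y (\<lambda>z. z) q' \<and>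
    topspace (fst Y) = topspace (fst Z') \<union> e ` (topspace (fst D) - k ` topspace (fst V)) \<and>
    pmap X Y \<phi> \<and> (\<forall>z \<in> topspace (fst Z). \<phi> (p z) = \<phi>0 z) \<and>
    (strict \<longrightarrow> pmap Y X \<psi> \<and> (\<forall>z \<in> topspace (fst Z'). \<psi> z = p (\<psi>0 z)) \<and> (\<forall>x \<in> topspace (fst X). \<psi> (\<phi> x) = x)) \<and>
    (he \<longrightarrow> (\<exists>\<zeta>. htpy_inverse X Y \<phi> \<zeta>))"
proof -
  note D = is_pushoutD[OF P]
  let ?h = "\<lambda>v. \<phi>0 (g (b v))"
  have h: "pmap V Z' ?h" by (rule pmap_compose[OF pmap_compose[OF b D(1)] \<phi>0])
  \<comment> \<open>The map from \<open>Z'\<close> is the identity and \<open>e\<close> supplies new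
    points of the same type, so \<open>Y\<close> extends \<open>Z'\<close> as a set.\<close>
  obtain Y :: "'y pointed" and q' where Y: "is_pushout V Z' D ?h k Y (\<lambda>z. z) q'"
    and tY: "topspace (fst Y) = (\<lambda>z. z) ` topspace (fst Z') \<union> e ` (topspace (fst D) - k ` topspace (fst V))"
    and "snd Y = snd Z'"
    by (rule pushout_exists[OF pt(2,4) h k inj_on_id2 e(1)]) (use e(2) in simp)
  have tY: "topspace (fst Y) = topspace (fst Z') \<union> e ` (topspace (fst D) - k ` topspace (fst V))"
    using tY by simp
  note DY = is_pushoutD[OF Y]
  have ptX: "pointed_space X" "pointed_space Y" using pushout_pointed P Y pt by blast+
  \<comment> \<open>\<open>X'\<close> carries the original cells on the new lower stage; it
    separates the change of the base from the change of the cells.\<close>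
  obtain X' :: "('y + 'c) pointed" and p2 q2 where X': "is_pushout W Z' C (\<lambda>w. \<phi>0 (g w)) i X' p2 q2"
    using pushout_exists_sum[OF pt(1,4) pmap_compose[OF D(1) \<phi>0] D(2) i] by blast
  note D' = is_pushoutD[OF X']
  have ptX': "pointed_space X'" using pushout_pointed[OF X' pt(4)] .
  obtain \<Phi> where \<Phi>: "pmap X X' \<Phi>" "\<And>z. z \<in> topspace (fst Z) \<Longrightarrow> \<Phi> (p z) = p2 (\<phi>0 z)" "\<And>c. c \<in> topspace (fst C) \<Longrightarrow> \<Phi> (q c) = q2 c"
    by (rule pushout_map[OF P pt(3) pmap_compose[OF \<phi>0 D'(3)] D'(4)]) (use D'(5) in auto)
  have \<Phi>_he: "\<exists>\<zeta>. htpy_inverse X X' \<Phi> \<zeta>" if he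
  proof -
    obtain \<zeta> where \<zeta>: "htpy_inverse Z Z' \<phi>0 \<zeta>" using he \<open>he\<close> by blast
    show ?thesis
      by (rule pushout_htpy_inverse[OF P X' pt(3,4,1) i hep(1) hep(3) hep(2) hep(3) \<zeta> _ \<Phi>]) blast+
  qed
  show ?thesis
  proof (cases strict)
    case True
    note strict = strict[OF True]
    \<comment> \<open>On \<open>W\<close> the condition reads
      \<open>\<phi>0 (g w) = \<phi>0 (g (b (a w)))\<close>, which is where
      \<open>b (a w) = w\<close> enters.\<close>
    obtain F where F: "pmap X' Y F" "\<And>z. z \<in> topspace (fst Z') \<Longrightarrow> F (p2 z) = z" "\<And>c. c \<in> topspace (fst C) \<Longrightarrow> F (q2 c) = q' (a' c)"
      by (rule pushout_map[OF X' pt(4) DY(3) pmap_compose[OF strict(3) DY(4)]])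
        (use DY(5)[symmetric] strict pmap_in[OF strict(1)] in auto)
    define \<phi> where "\<phi> x = F (\<Phi> x)" for x
    have \<phi>: "pmap X Y \<phi>" "\<And>z. z \<in> topspace (fst Z) \<Longrightarrow> \<phi> (p z) = \<phi>0 z" "\<And>c. c \<in> topspace (fst C) \<Longrightarrow> \<phi> (q c) = q' (a' c)"
      using pmap_compose[OF \<Phi>(1) F(1)] \<Phi> F pmap_in[OF \<phi>0] by (auto simp: \<phi>_def[abs_def])
    \<comment> \<open>Here \<open>\<psi>0 \<circ> \<phi>0\<close> cancels: on \<open>V\<close> both
      sides become \<open>p (g (b v))\<close>.\<close>
    obtain \<psi> where \<psi>: "pmap Y X \<psi>" "\<And>z. z \<in> topspace (fst Z') \<Longrightarrow> \<psi> z = p (\<psi>0 z)" "\<And>d. d \<in> topspace (fst D) \<Longrightarrow> \<psi> (q' d) = q (b' d)"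
      by (rule pushout_map[OF Y pt(4) pmap_compose[OF strict(6) D(3)] pmap_compose[OF b'(1) D(4)]])
        (use b'(2) D(5) strict(7) pmap_in[OF b] pmap_in[OF D(1)] in auto)
    have "\<psi> (\<phi> x) = x" if "x \<in> topspace (fst X)" for x
    proof (rule pushout_cases[OF P that])
      show "\<psi> (\<phi> x) = x" if "z \<in> topspace (fst Z)" "x = p z" for z
        using that \<phi>(2) \<psi>(2) strict(7) pmap_in[OF \<phi>0] by simp
      show "\<psi> (\<phi> x) = x" if "c \<in> topspace (fst C)" "x = q c" for c
        using that \<phi>(3) \<psi>(3) strict(5) pmap_in[OF strict(3)] by simp
    qed
    moreover have "\<exists>\<zeta>. htpy_inverse X Y \<phi> \<zeta>" if h: he
    proof -
      obtain \<zeta> where \<zeta>: "htpy_inverse X X' \<Phi> \<zeta>" using \<Phi>_he[OF h] by blast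
      have "\<exists>G. htpy_inverse X' Y F G"
        by (rule replace'[OF h True Y X' _ F]) (simp_all add: strict)
      then obtain G where "htpy_inverse X' Y F G" by blast
      from htpy_inverse_compose[OF \<zeta> this ptX] show ?thesis
        by (auto simp: \<phi>_def[abs_def])
    qed
    ultimately show ?thesis
      using Y tY \<phi>(1,2) \<psi>(1,2) by blast
  next
    case False
    then have he using some by blast
    \<comment> \<open>The square formed by \<open>b\<close> and \<open>b'\<close> commutes strictly,
      so \<open>b'\<close> induces a map from \<open>Y\<close> to \<open>X'\<close>.\<close>
    obtain F where F: "pmap Y X' F" "\<And>z. z \<in> topspace (fst Z') \<Longrightarrow> F z = p2 z" "\<And>d. d \<in> topspace (fst D) \<Longrightarrow> F (q' d) = q2 (b' d)"
      by (rule pushout_map[OF Y pt(4) D'(3) pmap_compose[OF b'(1) D'(4)]])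
        (use D'(5) b'(2) pmap_in[OF b] in auto)
    have "\<exists>G. htpy_inverse Y X' F G \<and> (\<forall>z \<in> topspace (fst Z'). G (p2 z) = z)"
      by (rule replace[OF \<open>he\<close> False X' Y _ F]) simp
    then obtain G where G: "htpy_inverse X' Y G F" "\<And>z. z \<in> topspace (fst Z') \<Longrightarrow> G (p2 z) = z"
      using htpy_inverse_sym by blast
    obtain \<zeta> where "htpy_inverse X X' \<Phi> \<zeta>" using \<Phi>_he[OF \<open>he\<close>] by blast
    from htpy_inverse_compose[OF this G(1) ptX]
    have he': "htpy_inverse X Y (\<lambda>x. G (\<Phi> x)) (\<lambda>y. \<zeta> (F y))" .
    then have "pmap X Y (\<lambda>x. G (\<Phi> x))" by (simp add: htpy_inverse_def)
    moreover have "G (\<Phi> (p z)) = \<phi>0 z" if "z \<in> topspace (fst Z)" for z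
      using \<Phi>(2) G(2) pmap_in[OF \<phi>0] that by simp
    ultimately show ?thesis
      using Y tY he' False by (intro exI[of _ Y] exI[of _ q'] exI[of _ "\<lambda>x. G (\<Phi> x)"]) blast
  qed
qed

text \<open>Both kinds of attachment are pushouts of cofibrations: the inclusion of a point for
  0-cells, a wedge of cone bases otherwise.\<close>

lemma hep_attaches_cells:
  assumes "attaches_cells A n J Z p X" "pointed_space A" "pointed_space Z"
  shows "hep Z X p T"
proof (cases n)
  case 0
  then obtain q where P: "is_pushout (discrete_topology {()}, ()) Z (wedge J A) (\<lambda>_. snd Z) (\<lambda>_. None) X p q"
    using assms(1) by (auto simp: attaches_cells_def)
  show ?thesis
    by (rule hep_pushout[OF P assms(3) hep_point]) (use is_pushoutD(2)[OF P] in simp_all)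
next
  case (Suc m)
  then obtain g q where P: "is_pushout (wedge J (iter_susp m A)) Z (wedge J (red_cone (iter_susp m A)))
               g (wedge_cone_base (iter_susp m A)) X p q"
    using assms(1) by (auto simp: attaches_cells_def)
  show ?thesis
    by (rule hep_pushout[OF P assms(3) hep_wedge_cone[OF pointed_space_iter_susp[OF assms(2)]]])
qed

section \<open>Points of the new complex and one stage of its construction\<close>

text \<open>The base point \<open>None\<close> is always included; other points carry the dimension
  of their cell, so the tag \<open>n\<close> is fresh for \<open>below_dim n\<close>.\<close>

definition below_dim :: "nat \<Rightarrow> (nat \<times> 'j \<times> 'b cpoint) option set" where
  "below_dim n = {y. \<forall>m j x. y = Some (m, j, x) \<longrightarrow> m < n}"

text \<open>\<open>u\<close> places the points of a cell in \<open>'b cpoint\<close>: it is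
  \<open>Pt\<close> for 0-cells and the identity for cones.\<close>

definition cell_point :: "nat \<Rightarrow> ('e \<Rightarrow> 'b cpoint) \<Rightarrow> ('j \<times> 'e) option \<Rightarrow> (nat \<times> 'j \<times> 'b cpoint) option" where
  "cell_point n u w = map_option (\<lambda>(j, x). (n, j, u x)) w"

lemma cell_point_new:
  fixes u :: "'e \<Rightarrow> 'b cpoint" and S :: "('j \<times> 'e) option set"
  assumes "inj u" "None \<notin> S" "T \<subseteq> below_dim n"
  shows "inj_on (cell_point n u) S" "T \<inter> cell_point n u ` S = {}"
    "T \<union> cell_point n u ` S \<subseteq> below_dim (Suc n)"
proof -
  have "cell_point n u w \<notin> T" if w: "w \<in> S" for w
  proof -
    obtain j x where "w = Some (j, x)" using w assms(2) by (cases w) auto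
    then have "cell_point n u w \<notin> below_dim n" by (auto simp: cell_point_def below_dim_def)
    then show ?thesis using assms(3) by (rule contra_subsetD[rotated])
  qed
  then show "T \<inter> cell_point n u ` S = {}" by (auto simp: disjoint_iff)
  show "inj_on (cell_point n u) S"
  proof (rule inj_onI)
    fix x y assume "cell_point n u x = cell_point n u y"
    then show "x = y"
      using assms(1) by (cases x; cases y) (auto simp: cell_point_def dest: injD)
  qed
  have "cell_point n u w \<in> below_dim (Suc n)" for w :: "('j \<times> 'e) option"
    by (auto simp: below_dim_def cell_point_def)
  moreover have "below_dim n \<subseteq> (below_dim (Suc n) :: (nat \<times> 'j \<times> 'b cpoint) option set)"
    unfolding below_dim_def using less_SucI by blast
  ultimately show "T \<union> cell_point n u ` S \<subseteq> below_dim (Suc n)"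
    using subset_trans[OF assms(3)] by (simp add: image_subset_iff)
qed

text \<open>Discharges the replacement hypotheses of \<open>cell_step\<close>, by
  \<open>wedge_replacement\<close> in dimension 0 and by \<open>cell_replacement\<close> above. The
  bound by \<open>below_dim\<close> leaves room for the cells of the next dimension.\<close>

lemma attach_step:
  fixes A :: "'a pointed" and B :: "'b pointed" and Z X :: "'x pointed" and Z' :: "('j, 'b) cw_space"
  assumes X: "attaches_cells A n (J :: 'j set) Z f X"
    and pt: "pointed_space A" "pointed_space B" "pointed_space Z" "pointed_space Z'"
    and low: "topspace (fst Z') \<subseteq> below_dim n"
    and m: "pmap A B \<alpha>" "pmap B A \<beta>" and \<phi>0: "pmap Z Z' \<phi>0"
    and strict: "\<And>x. strict \<Longrightarrow> x \<in> topspace (fst A) \<Longrightarrow> \<beta> (\<alpha> x) = x"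
      "strict \<Longrightarrow> pmap Z' Z \<psi>0" "\<And>z. strict \<Longrightarrow> z \<in> topspace (fst Z) \<Longrightarrow> \<psi>0 (\<phi>0 z) = z"
    and he: "he \<Longrightarrow> \<exists>\<zeta>. htpy_inverse Z Z' \<phi>0 \<zeta>" "he \<Longrightarrow> htpy_inverse B A \<beta> \<gamma>"
      "he \<Longrightarrow> strict \<Longrightarrow> htpy_inverse A B \<alpha> \<beta>"
    and some: "strict \<or> he"
  shows "\<exists>(Y :: ('j, 'b) cw_space) \<phi> \<psi>. attaches_cells B n J Z' (\<lambda>z. z) Y \<and>
    topspace (fst Y) \<subseteq> below_dim (Suc n) \<and> pmap X Y \<phi> \<and> (\<forall>z \<in> topspace (fst Z). \<phi> (f z) = \<phi>0 z) \<and>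
    (strict \<longrightarrow> pmap Y X \<psi> \<and> (\<forall>z \<in> topspace (fst Z'). \<psi> z = f (\<psi>0 z)) \<and> (\<forall>x \<in> topspace (fst X). \<psi> (\<phi> x) = x)) \<and>
    (he \<longrightarrow> (\<exists>\<zeta>. htpy_inverse X Y \<phi> \<zeta>))"
proof (cases n)
  case 0
  let ?W = "(discrete_topology {()}, ()) :: unit pointed"
  let ?k = "\<lambda>_ :: unit. None"
  obtain q where P: "is_pushout ?W Z (wedge J A) (\<lambda>_. snd Z) ?k X f q"
    using X 0 by (auto simp: attaches_cells_def)
  have W: "topspace (fst ?W) = {snd ?W}" "pointed_space ?W" by (simp_all add: pointed_space_def)
  have k: "pmap ?W (wedge J B) ?k" "pmap ?W (wedge J A) ?k"
    by (simp_all add: pmap_def topspace_wedge)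
  let ?e = "cell_point n (Pt :: 'b \<Rightarrow> 'b cpoint)"
  let ?S = "topspace (fst (wedge J B)) - ?k ` topspace (fst ?W)"
  have S: "None \<notin> ?S" by simp
  have injPt: "inj (Pt :: 'b \<Rightarrow> 'b cpoint)" by (rule injI) simp
  note e = cell_point_new[OF injPt S low]
  have "\<exists>Y q' \<phi> \<psi>. is_pushout ?W Z' (wedge J B) (\<lambda>v. \<phi>0 (snd Z)) ?k Y (\<lambda>z. z) q' \<and>
    topspace (fst Y) = topspace (fst Z') \<union> ?e ` ?S \<and>
    pmap X Y \<phi> \<and> (\<forall>z \<in> topspace (fst Z). \<phi> (f z) = \<phi>0 z) \<and>
    (strict \<longrightarrow> pmap Y X \<psi> \<and> (\<forall>z \<in> topspace (fst Z'). \<psi> z = f (\<psi>0 z)) \<and> (\<forall>x \<in> topspace (fst X). \<psi> (\<phi> x) = x)) \<and>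
    (he \<longrightarrow> (\<exists>\<zeta>. htpy_inverse X Y \<phi> \<zeta>))"
  proof (rule cell_step[where a = "\<lambda>x. x" and b = "\<lambda>x. x" and a' = "wedge_map B \<alpha>" and b' = "wedge_map A \<beta>",
      OF P W(2) W(2) pt(3,4) k(1) _ _ pmap_id _ _ \<phi>0 e(1,2)])
    show "pmap (wedge J B) (wedge J A) (wedge_map A \<beta>)" "pmap (wedge J A) (wedge J B) (wedge_map B \<alpha>)"
      by (intro pmap_wedge_map pt m)+
    show "pmap ?W ?W (\<lambda>x. x)" by (rule pmap_id)
    show "wedge_map A \<beta> (wedge_map B \<alpha> c) = c" if strict "c \<in> topspace (fst (wedge J A))" for c
      by (rule wedge_map_inverse[OF pt(1) m strict(1)[OF that(1)] that(2)])
    show "\<exists>G. htpy_inverse Y X' F G \<and> (\<forall>z \<in> topspace (fst Z'). G (p2 z) = z)"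
      if he "is_pushout ?W Z' (wedge J A) g2 ?k X' p2 q2" "is_pushout ?W Z' (wedge J B) g' ?k Y (\<lambda>z. z) q'"
        "pmap Y X' F" "\<And>z. z \<in> topspace (fst Z') \<Longrightarrow> F z = p2 z"
        "\<And>d. d \<in> topspace (fst (wedge J B)) \<Longrightarrow> F (q' d) = q2 (wedge_map A \<beta> d)"
      for X' p2 q2 g2 Y q' g' F
      by (rule wedge_replacement[OF W(1) W(1) htpy_inverse_wedge[OF pt(2,1) he(2)[OF that(1)]] pt(4) pointed_space_wedge that(2-6)])
    show "\<exists>G. htpy_inverse X' Y F G"
      if he strict "is_pushout ?W Z' (wedge J B) g' ?k Y (\<lambda>z. z) q'" "is_pushout ?W Z' (wedge J A) g2 ?k X' p2 q2"
        "pmap X' Y F" "\<And>z. z \<in> topspace (fst Z') \<Longrightarrow> F (p2 z) = z"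
        "\<And>d. d \<in> topspace (fst (wedge J A)) \<Longrightarrow> F (q2 d) = q' (wedge_map B \<alpha> d)"
      for X' p2 q2 g2 Y q' g' F
      using wedge_replacement[OF W(1) W(1) htpy_inverse_wedge[OF pt(1,2) he(3)[OF that(1,2)]] pt(4) pointed_space_wedge that(3-7)]
      by blast
  qed (use hep_point[OF W(1) k(2)] strict(2,3) he(1) some pmap_id in auto)
  then obtain Y q' \<phi> \<psi> where Y: "is_pushout ?W Z' (wedge J B) (\<lambda>v. \<phi>0 (snd Z)) ?k Y (\<lambda>z. z) q' \<and>
    topspace (fst Y) = topspace (fst Z') \<union> ?e ` ?S \<and>
    pmap X Y \<phi> \<and> (\<forall>z \<in> topspace (fst Z). \<phi> (f z) = \<phi>0 z) \<and>
    (strict \<longrightarrow> pmap Y X \<psi> \<and> (\<forall>z \<in> topspace (fst Z'). \<psi> z = f (\<psi>0 z)) \<and> (\<forall>x \<in> topspace (fst X). \<psi> (\<phi> x) = x)) \<and>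
    (he \<longrightarrow> (\<exists>\<zeta>. htpy_inverse X Y \<phi> \<zeta>))"
    by (elim exE)
  note Y = conjunct1[OF Y] conjunct1[OF conjunct2[OF Y]] conjunct2[OF conjunct2[OF Y]]
  have "attaches_cells B n J Z' (\<lambda>z. z) Y"
    using Y(1) pmap_base[OF \<phi>0] 0 by (auto simp: attaches_cells_def)
  moreover have "topspace (fst Y) \<subseteq> below_dim (Suc n)" using Y(2) e(3) by simp
  ultimately show ?thesis using Y(3) by blast
next
  case (Suc l)
  let ?A = "iter_susp l A" and ?B = "iter_susp l B"
  let ?\<alpha> = "iter_susp_map l B \<alpha>" and ?\<beta> = "iter_susp_map l A \<beta>"
  let ?i = "wedge_cone_base ?A" and ?k = "wedge_cone_base ?B :: ('j \<times> 'b cpoint) option \<Rightarrow> _"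
  obtain g q where P: "is_pushout (wedge J ?A) Z (wedge J (red_cone ?A)) g ?i X f q"
    using X Suc by (auto simp: attaches_cells_def)
  have ptA: "pointed_space ?A" and ptB: "pointed_space ?B"
    by (simp_all add: pointed_space_iter_susp pt)
  have m': "pmap ?A ?B ?\<alpha>" "pmap ?B ?A ?\<beta>"
    by (simp_all add: pmap_iter_susp_map pt m)
  have inv: "?\<beta> (?\<alpha> x) = x" if strict "x \<in> topspace (fst ?A)" for x
    by (rule iter_susp_map_inverse[OF pt(1,2) m strict(1)[OF that(1)] that(2)])
  note hepA = hep_wedge_cone[OF ptA, of J] and hepB = hep_wedge_cone[OF ptB, of J]
  \<comment> \<open>Continuity of the inclusions is part of \<open>hep\<close>; a dummy target
    suffices to extract it.\<close>
  have k: "pmap (wedge J ?B) (wedge J (red_cone ?B)) ?k" and i: "pmap (wedge J ?A) (wedge J (red_cone ?A)) ?i"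
    using hepA[of "undefined :: unit pointed"] hepB[of "undefined :: unit pointed"] by (simp_all add: hep_def)
  note contr = pcontractible_wedge[OF pointed_space_cone pcontractible_cone]
  let ?e = "cell_point n (\<lambda>x :: 'b cpoint. x)"
  let ?S = "topspace (fst (wedge J (red_cone ?B))) - ?k ` topspace (fst (wedge J ?B))"
  \<comment> \<open>The wedge point lies in the base, so it is not among the new points;
    \<open>cell_point\<close> could not give it a dimension tag.\<close>
  have "?k None = None" by (simp add: wedge_cone_base_def)
  then have S: "None \<notin> ?S" by (force simp: topspace_wedge)
  note e = cell_point_new[OF inj_on_id2 S low]
  have "\<exists>Y q' \<phi> \<psi>. is_pushout (wedge J ?B) Z' (wedge J (red_cone ?B)) (\<lambda>v. \<phi>0 (g (wedge_map ?A ?\<beta> v))) ?k Y (\<lambda>z. z) q' \<and>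
    topspace (fst Y) = topspace (fst Z') \<union> ?e ` ?S \<and>
    pmap X Y \<phi> \<and> (\<forall>z \<in> topspace (fst Z). \<phi> (f z) = \<phi>0 z) \<and>
    (strict \<longrightarrow> pmap Y X \<psi> \<and> (\<forall>z \<in> topspace (fst Z'). \<psi> z = f (\<psi>0 z)) \<and> (\<forall>x \<in> topspace (fst X). \<psi> (\<phi> x) = x)) \<and>
    (he \<longrightarrow> (\<exists>\<zeta>. htpy_inverse X Y \<phi> \<zeta>))"
  proof (rule cell_step[where a = "wedge_map ?B ?\<alpha>" and b = "wedge_map ?A ?\<beta>"
        and a' = "wedge_map (red_cone ?B) (cone_map ?B ?\<alpha>)" and b' = "wedge_map (red_cone ?A) (cone_map ?A ?\<beta>)",
      OF P pointed_space_wedge pointed_space_wedge pt(3,4) k inj_wedge_cone_base[OF ptB] inj_wedge_cone_base[OF ptA]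
        pmap_wedge_map[OF ptB ptA m'(2)] _ _ \<phi>0 e(1,2)])
    show b': "pmap (wedge J (red_cone ?B)) (wedge J (red_cone ?A)) (wedge_map (red_cone ?A) (cone_map ?A ?\<beta>))"
      and a': "pmap (wedge J (red_cone ?A)) (wedge J (red_cone ?B)) (wedge_map (red_cone ?B) (cone_map ?B ?\<alpha>))"
      by (intro pmap_wedge_map pointed_space_cone ptA ptB pmap_cone_map m')+
    show "pmap (wedge J ?A) (wedge J ?B) (wedge_map ?B ?\<alpha>)"
      by (intro pmap_wedge_map ptA ptB m')
    show "wedge_map (red_cone ?A) (cone_map ?A ?\<beta>) (?k v) = ?i (wedge_map ?A ?\<beta> v)" if "v \<in> topspace (fst (wedge J ?B))" for v
      by (rule wedge_cone_square[OF ptB m'(2) that])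
    show "wedge_map (red_cone ?B) (cone_map ?B ?\<alpha>) (?i v) = ?k (wedge_map ?B ?\<alpha> v)" if "v \<in> topspace (fst (wedge J ?A))" for v
      by (rule wedge_cone_square[OF ptA m'(1) that])
    show "wedge_map ?A ?\<beta> (wedge_map ?B ?\<alpha> w) = w" if strict "w \<in> topspace (fst (wedge J ?A))" for w
      by (rule wedge_map_inverse[OF ptA m' inv[OF that(1)] that(2)])
    show "wedge_map (red_cone ?A) (cone_map ?A ?\<beta>) (wedge_map (red_cone ?B) (cone_map ?B ?\<alpha>) c) = c"
      if strict "c \<in> topspace (fst (wedge J (red_cone ?A)))" for c
      by (rule wedge_map_inverse[OF pointed_space_cone[OF ptA] pmap_cone_map[OF ptA m'(1)] pmap_cone_map[OF ptB m'(2)]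
            cone_map_inverse[OF m' inv[OF that(1)]] that(2)])
    show "\<exists>G. htpy_inverse Y X' F G \<and> (\<forall>z \<in> topspace (fst Z'). G (p2 z) = z)"
      if he "is_pushout (wedge J ?A) Z' (wedge J (red_cone ?A)) g2 ?i X' p2 q2"
        "is_pushout (wedge J ?B) Z' (wedge J (red_cone ?B)) g' ?k Y (\<lambda>z. z) q'"
        "\<And>v. v \<in> topspace (fst (wedge J ?B)) \<Longrightarrow> g' v = g2 (wedge_map ?A ?\<beta> v)"
        "pmap Y X' F" "\<And>z. z \<in> topspace (fst Z') \<Longrightarrow> F z = p2 z"
        "\<And>d. d \<in> topspace (fst (wedge J (red_cone ?B))) \<Longrightarrow> F (q' d) = q2 (wedge_map (red_cone ?A) (cone_map ?A ?\<beta>) d)"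
      for X' p2 q2 g2 Y q' g' F
    proof (rule cell_replacement[OF htpy_inverse_wedge[OF ptB ptA htpy_inverse_iter_susp[OF pt(2,1) he(2)[OF that(1)]]]
          pointed_space_wedge pointed_space_wedge pt(4) i k inj_wedge_cone_base[OF ptB] contr[OF ptA ptA] contr[OF ptB ptB]
          b' wedge_cone_square[OF ptB m'(2)] hepB hepB hepB hepA hepA that(2-7)])
    qed blast+
    \<comment> \<open>With both flags set, the comparison map goes from \<open>X'\<close> to
      \<open>Y\<close> and is induced by \<open>?\<alpha>\<close>, so
      \<open>cell_replacement\<close> is applied with the two types of cells exchanged.\<close>
    show "\<exists>G. htpy_inverse X' Y F G"
      if he strict "is_pushout (wedge J ?B) Z' (wedge J (red_cone ?B)) g' ?k Y (\<lambda>z. z) q'"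
        "is_pushout (wedge J ?A) Z' (wedge J (red_cone ?A)) g2 ?i X' p2 q2"
        "\<And>v. v \<in> topspace (fst (wedge J ?A)) \<Longrightarrow> g2 v = g' (wedge_map ?B ?\<alpha> v)"
        "pmap X' Y F" "\<And>z. z \<in> topspace (fst Z') \<Longrightarrow> F (p2 z) = z"
        "\<And>d. d \<in> topspace (fst (wedge J (red_cone ?A))) \<Longrightarrow> F (q2 d) = q' (wedge_map (red_cone ?B) (cone_map ?B ?\<alpha>) d)"
      for X' p2 q2 g2 Y q' g' F
    proof (rule cell_replacement[OF htpy_inverse_wedge[OF ptA ptB htpy_inverse_iter_susp[OF pt(1,2) he(3)[OF that(1,2)]]]
          pointed_space_wedge pointed_space_wedge pt(4) k i inj_wedge_cone_base[OF ptA] contr[OF ptB ptB] contr[OF ptA ptA]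
          a' wedge_cone_square[OF ptA m'(1)] hepA hepA hepA hepB hepB that(3-8)])
    qed blast+
  qed (use hepA strict(2,3) he(1) some in auto)
  then obtain Y q' \<phi> \<psi> where Y: "is_pushout (wedge J ?B) Z' (wedge J (red_cone ?B)) (\<lambda>v. \<phi>0 (g (wedge_map ?A ?\<beta> v))) ?k Y (\<lambda>z. z) q' \<and>
    topspace (fst Y) = topspace (fst Z') \<union> ?e ` ?S \<and>
    pmap X Y \<phi> \<and> (\<forall>z \<in> topspace (fst Z). \<phi> (f z) = \<phi>0 z) \<and>
    (strict \<longrightarrow> pmap Y X \<psi> \<and> (\<forall>z \<in> topspace (fst Z'). \<psi> z = f (\<psi>0 z)) \<and> (\<forall>x \<in> topspace (fst X). \<psi> (\<phi> x) = x)) \<and>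
    (he \<longrightarrow> (\<exists>\<zeta>. htpy_inverse X Y \<phi> \<zeta>))"
    by (elim exE)
  note Y = conjunct1[OF Y] conjunct1[OF conjunct2[OF Y]] conjunct2[OF conjunct2[OF Y]]
  have "attaches_cells B n J Z' (\<lambda>z. z) Y"
    using Y(1) Suc by (auto simp: attaches_cells_def)
  moreover have "topspace (fst Y) \<subseteq> below_dim (Suc n)" using Y(2) e(3) by simp
  ultimately show ?thesis using Y(3) by blast
qed

section \<open>Passage to the colimit and the three cases\<close>

text \<open>The stage maps are identities on points, so the union of the stages with the final
  topology is the colimit. Equal points of stages \<open>n\<close> and \<open>m\<close> are
  connected through stage \<open>n + m\<close>.\<close>

lemma seq_colimit_exists:
  assumes Y: "\<And>n. pmap (Y n) (Y (Suc n)) (\<lambda>y. y)" and pt: "\<And>n. pointed_space (Y n)"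
  obtains L where "is_seq_colimit Y (\<lambda>n y. y) L (\<lambda>n y. y)"
proof -
  let ?D = "sum_topology (\<lambda>n. fst (Y n)) UNIV"
  define L where "L = (final_topology ((\<lambda>(n, x). x) ` topspace ?D) ?D (\<lambda>(n, x). x), snd (Y 0))"
  have Q: "quotient_map ?D (fst L) (\<lambda>(n, x). x)"
    unfolding L_def fst_conv by (rule quotient_map_final_topology) (rule refl)
  have base: "snd (Y n) = snd (Y 0)" for n
    by (induction n) (use pmap_base[OF Y] in auto)
  have "continuous_map (fst (Y n)) (fst L) (\<lambda>y. y)" for n
    using continuous_map_compose[OF continuous_map_component_injection[of n UNIV "\<lambda>n. fst (Y n)"] quotient_imp_continuous_map[OF Q]]
    by (simp add: o_def)
  then have \<iota>: "pmap (Y n) L (\<lambda>y. y)" for n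
    using base by (simp add: pmap_def L_def)
  let ?R = "\<lambda>u v. \<exists>k. \<exists>z \<in> topspace (fst (Y k)). u = (k, z) \<and> v = (Suc k, z)"
  have mono: "x \<in> topspace (fst (Y (n + d)))" if "x \<in> topspace (fst (Y n))" for n d x
    using that by (induction d) (use pmap_in[OF Y] in auto)
  have up: "equivclp ?R (n, x) (n + d, x)" if x: "x \<in> topspace (fst (Y n))" for n d x
  proof (induction d)
    case (Suc d)
    have "equivclp ?R (n + d, x) (n + Suc d, x)"
      using mono[OF x, of d] by (intro r_into_equivclp) auto
    with Suc show ?case by (rule equivclp_trans)
  qed simp
  have "x = y \<longleftrightarrow> equivclp ?R (n, x) (m, y)"
    if x: "x \<in> topspace (fst (Y n))" and y: "y \<in> topspace (fst (Y m))" for n m x y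
  proof
    assume xy: "x = y"
    have "equivclp ?R (n, x) (n + m, x)" "equivclp ?R (m, x) (n + m, x)"
      using up[OF x, of m] up[of x m n] y xy by (simp_all add: add.commute)
    then show "equivclp ?R (n, x) (m, y)"
      unfolding xy by (meson equivclp_sym equivclp_trans)
  next
    assume "equivclp ?R (n, x) (m, y)"
    then have "snd (n, x) = snd (m, y)"
      by (rule equivclp_respects) auto
    then show "x = y" by simp
  qed
  then have "is_seq_colimit Y (\<lambda>n y. y) L (\<lambda>n y. y)"
    unfolding is_seq_colimit_def using Y \<iota> Q by blast
  then show thesis by (rule that)
qed

text \<open>One recursion serves all cases: \<open>strict\<close> alone for (i), \<open>he\<close>
  alone for (ii), both for (iii). The stages are built together with their maps, since the attaching
  maps of \<open>Y\<close> involve \<open>\<phi>\<close> on the stage below.\<close>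

lemma CW_transfer:
  fixes A :: "'a pointed" and B :: "'b pointed" and X :: "'x pointed"
  assumes pt: "pointed_space A" "pointed_space B" and X: "is_CW TYPE('j) A X"
    and m: "pmap A B \<alpha>" "pmap B A \<beta>"
    and strict: "\<And>x. strict \<Longrightarrow> x \<in> topspace (fst A) \<Longrightarrow> \<beta> (\<alpha> x) = x"
    and he: "he \<Longrightarrow> htpy_inverse B A \<beta> \<gamma>" "he \<Longrightarrow> strict \<Longrightarrow> htpy_inverse A B \<alpha> \<beta>"
    and some: "strict \<or> he"
  shows "\<exists>(Y :: ('j, 'b) cw_space) \<phi> \<psi>. is_CW TYPE('j) B Y \<and> pmap X Y \<phi> \<and>
    (strict \<longrightarrow> pmap Y X \<psi> \<and> (\<forall>x \<in> topspace (fst X). \<psi> (\<phi> x) = x)) \<and>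
    (he \<longrightarrow> (\<exists>\<zeta>. htpy_inverse X Y \<phi> \<zeta>))"
proof -
  obtain S :: "nat \<Rightarrow> 'x pointed" and f \<iota> where S0: "topspace (fst (S 0)) = {snd (S 0)}"
    and att: "\<And>n. \<exists>J :: 'j set. attaches_cells A n J (S n) (f n) (S (Suc n))"
    and col: "is_seq_colimit S f X \<iota>"
    using X unfolding is_CW_def by blast
  note DX = is_seq_colimitD[OF col]
  have ptS: "pointed_space (S n)" for n
  proof (induction n)
    case 0
    then show ?case using S0 by (simp add: pointed_space_def)
  next
    case (Suc n)
    then show ?case using pmap_pointed[OF DX(1)] by blast
  qed
  define good :: "nat \<Rightarrow> ('j, 'b) cw_space \<times> ('x \<Rightarrow> (nat \<times> 'j \<times> 'b cpoint) option) \<times> ((nat \<times> 'j \<times> 'b cpoint) option \<Rightarrow> 'x) \<Rightarrow> bool"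
    where "good n = (\<lambda>(Y, \<phi>, \<psi>). pointed_space Y \<and> topspace (fst Y) \<subseteq> below_dim n \<and>
      (n = 0 \<longrightarrow> topspace (fst Y) = {snd Y}) \<and> pmap (S n) Y \<phi> \<and>
      (strict \<longrightarrow> pmap Y (S n) \<psi> \<and> (\<forall>x \<in> topspace (fst (S n)). \<psi> (\<phi> x) = x)) \<and>
      (he \<longrightarrow> (\<exists>\<zeta>. htpy_inverse (S n) Y \<phi> \<zeta>)))" for n
  define step :: "nat \<Rightarrow> ('j, 'b) cw_space \<times> ('x \<Rightarrow> (nat \<times> 'j \<times> 'b cpoint) option) \<times> ((nat \<times> 'j \<times> 'b cpoint) option \<Rightarrow> 'x) \<Rightarrow> _ \<Rightarrow> bool"
    where "step n = (\<lambda>(Y, \<phi>, \<psi>) (Y', \<phi>', \<psi>'). (\<exists>J :: 'j set. attaches_cells B n J Y (\<lambda>y. y) Y') \<and>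
      (\<forall>x \<in> topspace (fst (S n)). \<phi>' (f n x) = \<phi> x) \<and>
      (strict \<longrightarrow> (\<forall>y \<in> topspace (fst Y). \<psi>' y = f n (\<psi> y))))" for n
  have "\<exists>F. \<forall>n. good n (F n) \<and> step n (F n) (F (Suc n))"
  proof (rule dependent_nat_choice)
    \<comment> \<open>The recursion starts at the space \<open>{None}\<close>, the counterpart of
      the point \<open>S 0\<close>.\<close>
    let ?P = "(discrete_topology {None}, None) :: ('j, 'b) cw_space"
    have P: "pmap (S 0) ?P (\<lambda>_. None)" "pmap ?P (S 0) (\<lambda>_. snd (S 0))" "pointed_space ?P"
      using ptS[of 0] by (simp_all add: pmap_def pointed_space_def)
    have "phomotopic (S 0) (S 0) (\<lambda>x. snd (S 0)) (\<lambda>x. x)"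
      by (rule phomotopic_eq[OF pmap_const ptS]) (use S0 ptS in auto)
    moreover have "phomotopic ?P ?P (\<lambda>x. None) (\<lambda>x. x)"
      by (rule phomotopic_eq[OF pmap_compose[OF P(2,1)] P(3)]) simp
    ultimately have "htpy_inverse (S 0) ?P (\<lambda>_. None) (\<lambda>_. snd (S 0))"
      using P by (simp add: htpy_inverse_def)
    then show "\<exists>F. good 0 F"
      using P S0 by (intro exI[of _ "(?P, \<lambda>_. None, \<lambda>_. snd (S 0))"]) (auto simp: good_def below_dim_def)
  next
    fix F n assume "good n F"
    moreover obtain Y \<phi> \<psi> where F: "F = (Y, \<phi>, \<psi>)" by (cases F)
    ultimately have g: "pointed_space Y" "topspace (fst Y) \<subseteq> below_dim n" "pmap (S n) Y \<phi>"
      "strict \<Longrightarrow> pmap Y (S n) \<psi>" "\<And>x. strict \<Longrightarrow> x \<in> topspace (fst (S n)) \<Longrightarrow> \<psi> (\<phi> x) = x"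
      "he \<Longrightarrow> \<exists>\<zeta>. htpy_inverse (S n) Y \<phi> \<zeta>"
      by (auto simp: good_def)
    obtain J :: "'j set" where J: "attaches_cells A n J (S n) (f n) (S (Suc n))" using att by blast
    have "\<exists>(Y' :: ('j, 'b) cw_space) \<phi>' \<psi>'. attaches_cells B n J Y (\<lambda>z. z) Y' \<and>
      topspace (fst Y') \<subseteq> below_dim (Suc n) \<and> pmap (S (Suc n)) Y' \<phi>' \<and> (\<forall>z \<in> topspace (fst (S n)). \<phi>' (f n z) = \<phi> z) \<and>
      (strict \<longrightarrow> pmap Y' (S (Suc n)) \<psi>' \<and> (\<forall>z \<in> topspace (fst Y). \<psi>' z = f n (\<psi> z)) \<and> (\<forall>x \<in> topspace (fst (S (Suc n))). \<psi>' (\<phi>' x) = x)) \<and>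
      (he \<longrightarrow> (\<exists>\<zeta>. htpy_inverse (S (Suc n)) Y' \<phi>' \<zeta>))"
      by (rule attach_step[OF J pt ptS g(1,2) m g(3) strict g(4,5,6) he some])
    then obtain Y' :: "('j, 'b) cw_space" and \<phi>' \<psi>' where Y': "attaches_cells B n J Y (\<lambda>z. z) Y' \<and>
      topspace (fst Y') \<subseteq> below_dim (Suc n) \<and> pmap (S (Suc n)) Y' \<phi>' \<and> (\<forall>z \<in> topspace (fst (S n)). \<phi>' (f n z) = \<phi> z) \<and>
      (strict \<longrightarrow> pmap Y' (S (Suc n)) \<psi>' \<and> (\<forall>z \<in> topspace (fst Y). \<psi>' z = f n (\<psi> z)) \<and> (\<forall>x \<in> topspace (fst (S (Suc n))). \<psi>' (\<phi>' x) = x)) \<and>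
      (he \<longrightarrow> (\<exists>\<zeta>. htpy_inverse (S (Suc n)) Y' \<phi>' \<zeta>))"
      by (elim exE)
    then have "pmap (S (Suc n)) Y' \<phi>'" by blast
    then have "pointed_space Y'" using pmap_pointed ptS by blast
    then have "good (Suc n) (Y', \<phi>', \<psi>')" "step n F (Y', \<phi>', \<psi>')"
      unfolding good_def step_def F prod.case using Y' by blast+
    then show "\<exists>F'. good (Suc n) F' \<and> step n F F'" by blast
  qed
  then obtain F where F: "\<And>n. good n (F n)" "\<And>n. step n (F n) (F (Suc n))" by blast
  define Y where "Y n = fst (F n)" for n
  define \<phi> where "\<phi> n = fst (snd (F n))" for n
  define \<psi> where "\<psi> n = snd (snd (F n))" for n
  have Feq: "F n = (Y n, \<phi> n, \<psi> n)" for n by (simp add: Y_def \<phi>_def \<psi>_def)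
  have ptY: "pointed_space (Y n)" and \<phi>: "pmap (S n) (Y n) (\<phi> n)"
    and \<psi>: "strict \<Longrightarrow> pmap (Y n) (S n) (\<psi> n)" "\<And>x. strict \<Longrightarrow> x \<in> topspace (fst (S n)) \<Longrightarrow> \<psi> n (\<phi> n x) = x"
    and \<phi>he: "he \<Longrightarrow> \<exists>\<zeta>. htpy_inverse (S n) (Y n) (\<phi> n) \<zeta>" for n
    using F(1)[of n] unfolding Feq good_def by auto
  have Y0: "topspace (fst (Y 0)) = {snd (Y 0)}"
    using F(1)[of 0] unfolding Feq good_def by auto
  have attY: "\<exists>J :: 'j set. attaches_cells B n J (Y n) (\<lambda>y. y) (Y (Suc n))"
    and \<phi>f: "\<And>x. x \<in> topspace (fst (S n)) \<Longrightarrow> \<phi> (Suc n) (f n x) = \<phi> n x"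
    and \<psi>f: "\<And>y. strict \<Longrightarrow> y \<in> topspace (fst (Y n)) \<Longrightarrow> \<psi> (Suc n) y = f n (\<psi> n y)" for n
    using F(2)[of n] unfolding Feq step_def by auto
  \<comment> \<open>Obtained for every target type; the colimit argument uses the types of both
    \<open>X\<close> and \<open>L\<close>.\<close>
  have hepS: "hep (S n) (S (Suc n)) (f n) T" for n and T :: "'t pointed"
    using att[of n] hep_attaches_cells pt(1) ptS by blast
  have hepY: "hep (Y n) (Y (Suc n)) (\<lambda>y. y) T" for n and T :: "'t pointed"
    using attY[of n] hep_attaches_cells pt(2) ptY by blast
  have Yinc: "pmap (Y n) (Y (Suc n)) (\<lambda>y. y)" for n
    using hepY[of n "undefined :: unit pointed"] by (simp add: hep_def)
  obtain L where L: "is_seq_colimit Y (\<lambda>n y. y) L (\<lambda>n y. y)"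
    using seq_colimit_exists[where Y = Y, OF Yinc ptY] by blast
  note DL = is_seq_colimitD[OF L]
  have "is_CW TYPE('j) B L"
    unfolding is_CW_def using Y0 attY L
    by (intro exI[of _ Y] exI[of _ "\<lambda>n y. y"]) blast
  moreover obtain \<Phi> where \<Phi>: "pmap X L \<Phi>" "\<And>n x. x \<in> topspace (fst (S n)) \<Longrightarrow> \<Phi> (\<iota> n x) = \<phi> n x"
    by (rule colimit_map[OF col ptS pmap_compose[OF \<phi> DL(2)]]) (auto simp: \<phi>f)
  moreover have "\<exists>\<Psi>. strict \<longrightarrow> pmap L X \<Psi> \<and> (\<forall>x \<in> topspace (fst X). \<Psi> (\<Phi> x) = x)"
  proof (cases strict)
    case True
    have "\<iota> (Suc n) (\<psi> (Suc n) y) = \<iota> n (\<psi> n y)" if "y \<in> topspace (fst (Y n))" for n y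
      using \<psi>f[OF True that] DX(3) pmap_in[OF \<psi>(1)[OF True] that] by simp
    then obtain \<Psi> where \<Psi>: "pmap L X \<Psi>" "\<And>n y. y \<in> topspace (fst (Y n)) \<Longrightarrow> \<Psi> y = \<iota> n (\<psi> n y)"
      using colimit_map[OF L ptY pmap_compose[OF \<psi>(1)[OF True] DX(2)]] by blast
    have "\<Psi> (\<Phi> x) = x" if x: "x \<in> topspace (fst X)" for x
    proof -
      obtain n y where y: "y \<in> topspace (fst (S n))" "x = \<iota> n y" using colimit_cases[OF col x] .
      then show ?thesis
        using \<Phi>(2)[OF y(1)] \<Psi>(2)[OF pmap_in[OF \<phi> y(1)]] \<psi>(2)[OF True y(1)] by simp
    qed
    with \<Psi>(1) show ?thesis by blast
  qed simp
  moreover have "\<exists>\<zeta>. htpy_inverse X L \<Phi> \<zeta>" if h: he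
  proof -
    show ?thesis
    proof (rule colimit_htpy_inverse[where \<phi> = \<phi> and \<Phi> = \<Phi>, OF col L ptS ptY hepS hepY hepS hepY])
      show "\<exists>\<zeta>. htpy_inverse (S n) (Y n) (\<phi> n) \<zeta>" for n
        using \<phi>he[OF h] .
      show "\<phi> (Suc n) (f n x) = \<phi> n x" if "x \<in> topspace (fst (S n))" for n x
        using that by (rule \<phi>f)
      show "pmap X L \<Phi>" by (rule \<Phi>)
      show "\<Phi> (\<iota> n x) = \<phi> n x" if "x \<in> topspace (fst (S n))" for n x
        using that by (rule \<Phi>)
    qed (rule exI)
  qed
  ultimately show ?thesis by blast
qed

theorem theorem4p1:
  fixes A :: "'a pointed" and B :: "'b pointed" and X :: "'x pointed"
    and \<alpha> :: "'a \<Rightarrow> 'b" and \<beta> :: "'b \<Rightarrow> 'a"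
  assumes "pointed_space A" and "pointed_space B"
    and "is_CW TYPE('j) A X"
    and "pmap A B \<alpha>" and "pmap B A \<beta>"
  shows "((\<forall>a \<in> topspace (fst A). \<beta> (\<alpha> a) = a) \<longrightarrow>
          (\<exists>(Y :: ('j, 'b) cw_space) \<phi> \<psi>.
             is_CW TYPE('j) B Y \<and> pmap X Y \<phi> \<and> pmap Y X \<psi> \<and>
             (\<forall>x \<in> topspace (fst X). \<psi> (\<phi> x) = x)))
       \<and> (closedin (fst A) {snd A} \<and> closedin (fst B) {snd B} \<and>
          phomotopy_equivalence B A \<beta> \<longrightarrow>
          (\<exists>(Y :: ('j, 'b) cw_space) \<phi>.
             is_CW TYPE('j) B Y \<and> phomotopy_equivalence X Y \<phi>))
       \<and> (closedin (fst A) {snd A} \<and> closedin (fst B) {snd B} \<and>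
          (\<forall>a \<in> topspace (fst A). \<beta> (\<alpha> a) = a) \<and> phomotopic B B (\<alpha> \<circ> \<beta>) id \<longrightarrow>
          (\<exists>(Y :: ('j, 'b) cw_space) \<phi> \<psi>.
             is_CW TYPE('j) B Y \<and> pmap X Y \<phi> \<and> pmap Y X \<psi> \<and>
             (\<forall>x \<in> topspace (fst X). \<psi> (\<phi> x) = x) \<and> phomotopic Y Y (\<phi> \<circ> \<psi>) id))"
proof (intro conjI impI; (elim conjE)?)
  assume "\<forall>a \<in> topspace (fst A). \<beta> (\<alpha> a) = a"
  then show "\<exists>(Y :: ('j, 'b) cw_space) \<phi> \<psi>. is_CW TYPE('j) B Y \<and> pmap X Y \<phi> \<and> pmap Y X \<psi> \<and>
             (\<forall>x \<in> topspace (fst X). \<psi> (\<phi> x) = x)"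
    using CW_transfer[OF assms, of True False] by simp
next
  assume "phomotopy_equivalence B A \<beta>"
  then obtain \<gamma> where "htpy_inverse B A \<beta> \<gamma>" by (auto simp: phomotopy_equivalence_iff)
  then show "\<exists>(Y :: ('j, 'b) cw_space) \<phi>. is_CW TYPE('j) B Y \<and> phomotopy_equivalence X Y \<phi>"
    using CW_transfer[OF assms, of False True \<gamma>] by (auto simp: phomotopy_equivalence_iff)
next
  assume ret: "\<forall>a \<in> topspace (fst A). \<beta> (\<alpha> a) = a" and "phomotopic B B (\<alpha> \<circ> \<beta>) id"
  \<comment> \<open>A strict identity is in particular a homotopy, so \<open>\<alpha>\<close> and
    \<open>\<beta>\<close> are mutually inverse equivalences and both flags can be set.\<close>
  moreover have "phomotopic A A (\<lambda>a. \<beta> (\<alpha> a)) (\<lambda>a. a)"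
    by (rule phomotopic_eq[OF pmap_compose[OF assms(4,5)] assms(1)]) (use ret in blast)
  ultimately have ab: "htpy_inverse A B \<alpha> \<beta>"
    using assms(4,5) by (simp add: htpy_inverse_def o_def id_def)
  then have "htpy_inverse B A \<beta> \<alpha>" using htpy_inverse_sym by blast
  from CW_transfer[OF assms, of True True \<alpha>, OF _ this ab]
  obtain Y :: "('j, 'b) cw_space" and \<phi> \<psi> \<zeta> where Y: "is_CW TYPE('j) B Y" "pmap X Y \<phi>" "pmap Y X \<psi>"
    "\<forall>x \<in> topspace (fst X). \<psi> (\<phi> x) = x" "htpy_inverse X Y \<phi> \<zeta>"
    using ret by auto
  \<comment> \<open>The base point of \<open>X\<close> is read off the colimit structure, as the
    image of the base point of \<open>S 0\<close>.\<close>
  obtain S and f :: "nat \<Rightarrow> 'x \<Rightarrow> 'x" and \<iota> :: "nat \<Rightarrow> 'x \<Rightarrow> 'x"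
    where "topspace (fst (S 0)) = {snd (S 0)}" "is_seq_colimit S f X \<iota>"
    using assms(3) unfolding is_CW_def by blast
  then have ptX: "pointed_space X"
    using pmap_pointed[OF is_seq_colimitD(2), of S f X \<iota> 0] by (simp add: pointed_space_def)
  have "phomotopic X X (\<lambda>x. \<psi> (\<phi> x)) (\<lambda>x. x)"
    by (rule phomotopic_eq[OF pmap_compose[OF Y(2,3)] ptX]) (use Y(4) in blast)
  then have "htpy_inverse X Y \<phi> \<psi>"
    by (rule htpy_inverse_unique[OF Y(5,3) ptX pmap_pointed[OF Y(2) ptX]])
  then have "phomotopic Y Y (\<phi> \<circ> \<psi>) id"
    by (simp add: htpy_inverse_def o_def id_def)
  with Y show "\<exists>(Y :: ('j, 'b) cw_space) \<phi> \<psi>. is_CW TYPE('j) B Y \<and> pmap X Y \<phi> \<and> pmap Y X \<psi> \<and>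
             (\<forall>x \<in> topspace (fst X). \<psi> (\<phi> x) = x) \<and> phomotopic Y Y (\<phi> \<circ> \<psi>) id"
    by blast
qed

end
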